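(* Let $j,k\in\mathbb{N}$ with $1\le j<k$, and let $A,B,C$ be Young functions. Consider the condition that there is a constant $c>0$, independent of $t$, such that $$( * )\qquad B^{-1}(t)^{\frac jk}\,C^{-1}(t)^{1-\frac jk}\le c\, A^{-1}(t)\qquad\text{for all }t>0.$$ (1) If $( * )$ holds, then there is a constant $c_1>0$, independent of $u$, such that $$\|\nabla^j u\|_{L^A}\le c_1\, \|(\nabla^k u)^{**}\|_{L^B}^{\frac{j}{k}}\,\|u^{**}\|^{1-\frac{j}{k}}_{L^C}$$ holds for all $k$-times weakly differentiable functions $u$ on $\mathbb{R}^n$. (2) If $( * )$ holds and, moreover, the upper Boyd indices of $L^B$ and $L^C$ are smaller than $1$, then there is a constant $c_2>0$, independent of $u$, such that $$( ** )\qquad \|\nabla^j u\|_{L^A}\le c_2\,\|\nabla^k u\|_{L^B}^{\frac jk}\,\|u\|_{L^C}^{1-\frac jk}$$ holds for all $k$-times weakly differentiable functions $u$ on $\mathbb{R}^n$. (3) If $( * )$ does not hold (for any constant $c$), then $( ** )$ fails, i.e. there is no constant $c_2$ for which $( ** )$ holds for all $k$-times weakly differentiable functions $u$ on $\mathbb{R}^n$.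
   Context: A Young function is a function $A:[0,\infty)\to[0,\infty)$ that is increasing, convex, and satisfies $\lim_{t\to\infty}A(t)/t=\infty$ and $\lim_{t\to0_+}A(t)/t=0$ (so $A(0)=0$ and $A>0$ on $(0,\infty)$); $A^{-1}$ is its inverse. The Orlicz space $L^A$ is given by the Luxemburg norm $\|u\|_{L^A}:=\inf\{\lambda>0:\int A(|u|/\lambda)\,dx\le1\}$, where the integral is over $\mathbb{R}^n$ for functions on $\mathbb{R}^n$ and over $(0,\infty)$ for functions on $(0,\infty)$ such as $u^{**}$. For scalar or vector-valued measurable $u$ on $\mathbb{R}^n$, $u^*(t):=\inf\{s\in(0,\infty):|\{|u|>s\}|\le t\}$ (with $\inf\emptyset=+\infty$) and $u^{**}(t):=\frac1t\int_0^t u^*(s)\,ds$, $t>0$, where $|\cdot|$ is the Euclidean norm for vector-valued $u$. The upper Boyd index of a rearrangement-invariant Banach function space $X$ is $\lim_{t\to\infty}\frac{\log h_X(t)}{\log t}\in[0,1]$, where $h_X(t)$ is the operator norm, on the representation space of $X$ over $(0,\infty)$ (for $L^A$, this is $L^A(0,\infty)$), of the dilation $f(\cdot)\mapsto f(\cdot/t)$. A function $u$ is $k$-times weakly differentiable if $u\in L^1_{\mathrm{loc}}(\mathbb{R}^n)$ has all weak partial derivatives up to order $k$ in $L^1_{\mathrm{loc}}(\mathbb{R}^n)$. $\nabla^j u$ is the vector of all weak partial derivatives of order $j$, and $\|\nabla^j u\|_{L^A}:=\||\nabla^j u|\|_{L^A}$. *)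

theory Defs
  imports "HOL-Analysis.Analysis"
begin

text \<open>Only the values on \<open>[0, \<infinity>)\<close> of the real functions below matter.\<close>

definition young_function :: "(real \<Rightarrow> real) \<Rightarrow> bool" where
  "young_function A \<longleftrightarrow>
     (\<forall>t\<ge>0. 0 \<le> A t) \<and> strict_mono_on {0..} A \<and> convex_on {0..} A \<and>
     filterlim (\<lambda>t. A t / t) at_top at_top \<and>
     ((\<lambda>t. A t / t) \<longlongrightarrow> 0) (at_right 0)"

abbreviation young_inv :: "(real \<Rightarrow> real) \<Rightarrow> real \<Rightarrow> real" where
  "young_inv A \<equiv> inv_into {0..} A"

text \<open>A Young function is continued by \<open>A(\<infinity>) = \<infinity>\<close>, since rearrangements may be infinite.\<close>

definition young_ext :: "(real \<Rightarrow> real) \<Rightarrow> ennreal \<Rightarrow> ennreal" where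
  "young_ext A x = (if x = \<infinity> then \<infinity> else ennreal (A (enn2real x)))"

definition luxemburg_norm :: "(real \<Rightarrow> real) \<Rightarrow> 'a measure \<Rightarrow> ('a \<Rightarrow> ennreal) \<Rightarrow> ennreal" where
  "luxemburg_norm A M f =
     Inf {ennreal r | r. r > 0 \<and> (\<integral>\<^sup>+ x. young_ext A (f x / ennreal r) \<partial>M) \<le> 1}"

definition orlicz_norm :: "(real \<Rightarrow> real) \<Rightarrow> (real ^ 'n \<Rightarrow> real) \<Rightarrow> ennreal" where
  "orlicz_norm A u = luxemburg_norm A lebesgue (\<lambda>x. ennreal \<bar>u x\<bar>)"

definition orlicz_norm_halfline :: "(real \<Rightarrow> real) \<Rightarrow> (real \<Rightarrow> ennreal) \<Rightarrow> ennreal" where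
  "orlicz_norm_halfline A f = luxemburg_norm A (lebesgue_on {0<..}) f"

text \<open>
  The rearrangement of a vector-valued function depends only on its pointwise norm, so
  \<open>(\<nabla>\<^sup>k u)\<^sup>*\<^sup>*\<close> is obtained from the scalar function \<open>\<bar>\<nabla>\<^sup>k u\<bar>\<close>.
\<close>

definition decr_rearr :: "(real ^ 'n \<Rightarrow> real) \<Rightarrow> real \<Rightarrow> ennreal" where
  "decr_rearr u t =
     Inf {ennreal s | s. s > 0 \<and> emeasure lebesgue {x. \<bar>u x\<bar> > s} \<le> ennreal t}"

definition max_rearr :: "(real ^ 'n \<Rightarrow> real) \<Rightarrow> real \<Rightarrow> ennreal" where
  "max_rearr u t = (\<integral>\<^sup>+ s \<in> {0<..<t}. decr_rearr u s \<partial>lebesgue) / ennreal t"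

text \<open>\<open>X\<close> is the norm of a function space over \<open>(0, \<infinity>)\<close>, equal to \<open>\<infinity>\<close> off the space.\<close>

definition dilation_norm :: "((real \<Rightarrow> ennreal) \<Rightarrow> ennreal) \<Rightarrow> real \<Rightarrow> ennreal" where
  "dilation_norm X t =
     (SUP f \<in> {f :: real \<Rightarrow> real. f \<in> borel_measurable (lebesgue_on {0<..}) \<and>
                 X (\<lambda>s. ennreal \<bar>f s\<bar>) \<le> 1}.
        X (\<lambda>s. ennreal \<bar>f (s / t)\<bar>))"

definition upper_boyd_index :: "((real \<Rightarrow> ennreal) \<Rightarrow> ennreal) \<Rightarrow> real" where
  "upper_boyd_index X = Lim at_top (\<lambda>t. ln (enn2real (dilation_norm X t)) / ln t)"

definition locally_integrable :: "(real ^ 'n \<Rightarrow> real) \<Rightarrow> bool" where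
  "locally_integrable u \<longleftrightarrow> (\<forall>K. compact K \<longrightarrow> set_integrable lebesgue K u)"

primrec partial_deriv :: "'n list \<Rightarrow> (real ^ 'n \<Rightarrow> real) \<Rightarrow> real ^ 'n \<Rightarrow> real" where
  "partial_deriv [] \<phi> = \<phi>"
| "partial_deriv (i # is) \<phi> =
     (\<lambda>x. frechet_derivative (partial_deriv is \<phi>) (at x) (axis i 1))"

text \<open>All iterated partial derivatives are differentiable, hence continuous.\<close>

definition test_function :: "(real ^ 'n \<Rightarrow> real) \<Rightarrow> bool" where
  "test_function \<phi> \<longleftrightarrow>
     (\<forall>is. partial_deriv is \<phi> differentiable_on UNIV) \<and> compact (closure {x. \<phi> x \<noteq> 0})"

definition has_weak_partial ::
  "(real ^ 'n \<Rightarrow> real) \<Rightarrow> 'n list \<Rightarrow> (real ^ 'n \<Rightarrow> real) \<Rightarrow> bool" where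
  "has_weak_partial u is v \<longleftrightarrow> locally_integrable v \<and>
     (\<forall>\<phi>. test_function \<phi> \<longrightarrow>
        (\<integral>x. u x * partial_deriv is \<phi> x \<partial>lebesgue) =
        (-1) ^ length is * (\<integral>x. v x * \<phi> x \<partial>lebesgue))"

definition weakly_differentiable :: "nat \<Rightarrow> (real ^ 'n \<Rightarrow> real) \<Rightarrow> bool" where
  "weakly_differentiable k u \<longleftrightarrow> locally_integrable u \<and>
     (\<forall>is. length is \<le> k \<longrightarrow> (\<exists>v. has_weak_partial u is v))"

text \<open>Weak derivatives are unique only almost everywhere; some representative is chosen.\<close>

definition weak_partial :: "(real ^ 'n \<Rightarrow> real) \<Rightarrow> 'n list \<Rightarrow> real ^ 'n \<Rightarrow> real" where
  "weak_partial u is = (SOME v. has_weak_partial u is v)"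

text \<open>
  The Euclidean norm of \<open>\<nabla>\<^sup>m u\<close>, the vector of all \<open>\<partial>\<close> indexed by \<open>m\<close>-tuples of directions.
  A mixed derivative occurs once for every ordering of its directions.  Listing it only once would
  change the norm by a factor between \<open>1\<close> and \<open>sqrt (fact m)\<close>.
\<close>

definition abs_nabla :: "nat \<Rightarrow> (real ^ 'n \<Rightarrow> real) \<Rightarrow> real ^ 'n \<Rightarrow> real" where
  "abs_nabla m u x = L2_set (\<lambda>is. weak_partial u is x) {is. length is = m}"

text \<open>
  \<open>a\<^sup>\<theta> b\<^sup>1\<^sup>-\<^sup>\<theta>\<close>, with value \<open>\<infinity>\<close> as soon as one factor is infinite.  Here \<open>0 \<cdot> \<infinity> = \<infinity>\<close>, unlike for
  multiplication of type \<open>ennreal\<close>: otherwise the inequalities would be false for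
  polynomials \<open>u\<close> of degree at least \<open>j\<close> and less than \<open>k\<close>.
\<close>

definition interp :: "real \<Rightarrow> ennreal \<Rightarrow> ennreal \<Rightarrow> ennreal" where
  "interp \<theta> a b =
     (if a = \<infinity> \<or> b = \<infinity> then \<infinity>
      else ennreal (enn2real a powr \<theta> * enn2real b powr (1 - \<theta>)))"

definition inverse_condition ::
  "real \<Rightarrow> (real \<Rightarrow> real) \<Rightarrow> (real \<Rightarrow> real) \<Rightarrow> (real \<Rightarrow> real) \<Rightarrow> bool" where
  "inverse_condition \<theta> A B C \<longleftrightarrow>
     (\<exists>c>0. \<forall>t>0. young_inv B t powr \<theta> * young_inv C t powr (1 - \<theta>) \<le> c * young_inv A t)"

end

theory Submission
  imports Defs
begin

text \<open>
  Mollify \<open>\<partial>\<^sup>\<alpha> u\<close>, \<open>|\<alpha>| = j\<close>, at scale \<open>r\<close> and move the derivatives to the kernel: this costs \<open>r\<^sup>-\<^sup>j\<close> times an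
  average of \<open>u\<close>. Halving the scale changes the mollification only by \<open>r\<close> times averages of the
  derivatives of order \<open>j + 1\<close>, so that summation over the scales \<open>2\<^sup>-\<^sup>m r\<close> bounds the error. Averages
  do not increase \<open>t g\<^sup>*\<^sup>*(t)\<close>, and iterating in \<open>j\<close> with the same \<open>r\<close> gives
  \<open>(\<nabla>\<^sup>j u)\<^sup>*(t) \<le> C (r\<^sup>k\<^sup>-\<^sup>j (\<nabla>\<^sup>k u)\<^sup>*\<^sup>*(t) + r\<^sup>-\<^sup>j u\<^sup>*\<^sup>*(t))\<close> for all \<open>r > 0\<close>. Optimising in \<open>r\<close> and a Young-type
  inequality for Orlicz norms give part (1). If the upper Boyd index is below \<open>1\<close>, then \<open>g\<^sup>*\<^sup>*\<close> is a
  norm-convergent sum of dilations of \<open>g\<^sup>*\<close>, whence part (2). Part (3) follows by testing with the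
  dilations \<open>\<phi>(x/\<epsilon>)\<close> of a single bump, where \<open>\<epsilon>\<^sup>n = 1/t\<close>.
\<close>

section \<open>Young functions and Luxemburg norms\<close>

text \<open>Halving the scale is cheap because the two rescaled kernels have the same integral, so
  that their difference is a sum of first derivatives of test functions. Each primitive gains one
  power of the scale, and over dyadic scales the gains form a geometric series. The obstacle is that
  \<open>u\<close> and its derivatives are only locally integrable: mollifications converge merely
  in L^1 on balls. Every estimate is therefore made after integration against a weight bounded by 1
  with bounded support, and the supremum over the weights comes last. This supremum is subadditive,
  unlike the rearrangement itself, which is why maximal rearrangements stand on the right;
  Chebyshev's inequality recovers the rearrangement on the left. The bound for one order has only
  higher orders and \<open>u\<close> on the right, so nothing is absorbed and infinite values do no
  harm. As r may depend on t, the optimisation is pointwise in t, which is the form in which an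
  inequality between inverse Young functions can be used.\<close>

lemma sigma_finite_lebesgue: "sigma_finite_measure (lebesgue :: 'a::euclidean_space measure)"
proof
  obtain A :: "'a set set" where A: "countable A" "A \<subseteq> sets lborel" "\<Union>A = space lborel"
    "\<forall>a\<in>A. emeasure lborel a \<noteq> \<infinity>"
    using lborel.sigma_finite_countable by blast
  then have "A \<subseteq> sets lebesgue" "\<Union>A = space lebesgue" "\<forall>a\<in>A. emeasure lebesgue a \<noteq> \<infinity>"
    by (auto simp: subset_iff)
  then show "\<exists>A. countable A \<and> A \<subseteq> sets (lebesgue :: 'a measure) \<and> \<Union>A = space lebesgue \<and> (\<forall>a\<in>A. emeasure lebesgue a \<noteq> \<infinity>)"
    using A(1) by blast
qed

text \<open>Any extended nonnegative number, infinity included, is the length of an initial interval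
  of the half line. This turns a function value into an integral over levels, and the measure of a
  level set into a set of arguments of the rearrangement.\<close>

lemma emeasure_Ioo_ennreal:
  "emeasure lborel {t::real. 0 < t \<and> ennreal t < m} = m"
proof (cases m)
  case (real r)
  then have "{t. 0 < t \<and> ennreal t < m} = {0<..<r}" by (auto simp: ennreal_less_iff)
  then show ?thesis using real by simp
next
  case top
  have "of_nat n \<le> emeasure lborel {0::real<..}" for n :: nat
    using emeasure_mono[of "{0<..<real n}" "{0<..}" lborel]
    by (simp add: subset_iff ennreal_of_nat_eq_real_of_nat)
  then have "emeasure lborel {0::real<..} = top"
    by (metis ennreal_Ex_less_of_nat infinity_ennreal_def linorder_not_le top.not_eq_extremum)
  moreover have "{t::real. 0 < t \<and> ennreal t < m} = {0<..}" using top by auto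
  ultimately show ?thesis using top by simp
qed

text \<open>Tonelli, after \<open>f x\<close> has been written as the length of the set of levels
  below it. The extra factor \<open>H\<close> lets one formula serve for weights on the whole space
  and for restriction to an interval of the half line.\<close>

lemma nn_integral_layer_cake:
  fixes f H :: "'a \<Rightarrow> ennreal"
  assumes "sigma_finite_measure M"
    and [measurable]: "f \<in> borel_measurable M" "H \<in> borel_measurable M"
  shows "(\<integral>\<^sup>+x. f x * H x \<partial>M) =
    (\<integral>\<^sup>+s\<in>{0<..}. (\<integral>\<^sup>+x. H x * indicator {x. ennreal s < f x} x \<partial>M) \<partial>lborel)"
proof -
  interpret M: sigma_finite_measure M by fact
  interpret pair_sigma_finite M "lborel :: real measure" ..
  have eq: "f x = (\<integral>\<^sup>+s. indicator {0<..} s * indicator {x. ennreal s < f x} x \<partial>lborel)" for x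
  proof -
    have "(\<integral>\<^sup>+s. indicator {0<..} s * indicator {x. ennreal s < f x} x \<partial>lborel)
      = (\<integral>\<^sup>+s. indicator {s. 0 < s \<and> ennreal s < f x} s \<partial>lborel)"
      by (intro nn_integral_cong) (auto simp: indicator_def)
    also have "\<dots> = emeasure lborel {s. 0 < s \<and> ennreal s < f x}"
      by (subst nn_integral_indicator) measurable
    also have "\<dots> = f x" by (rule emeasure_Ioo_ennreal)
    finally show ?thesis by simp
  qed
  have "(\<integral>\<^sup>+x. f x * H x \<partial>M) = (\<integral>\<^sup>+x. (\<integral>\<^sup>+s. indicator {0<..} s * indicator {x. ennreal s < f x} x * H x \<partial>lborel) \<partial>M)"
    by (subst eq, subst nn_integral_multc[symmetric]) auto
  also have "\<dots> = (\<integral>\<^sup>+s. (\<integral>\<^sup>+x. indicator {0<..} s * indicator {x. ennreal s < f x} x * H x \<partial>M) \<partial>lborel)"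
    by (rule Fubini'[symmetric]) measurable
  also have "\<dots> = (\<integral>\<^sup>+s\<in>{0<..}. (\<integral>\<^sup>+x. H x * indicator {x. ennreal s < f x} x \<partial>M) \<partial>lborel)"
    by (intro nn_integral_cong) (auto simp: indicator_def mult.commute intro!: nn_integral_cong)
  finally show ?thesis .
qed

lemma divide_left_mono_ennreal:
  assumes "0 < a" "a \<le> b" shows "x / ennreal b \<le> x / ennreal a"
  using assms unfolding divide_ennreal_def
  by (intro mult_left_mono) (auto simp: inverse_ennreal intro!: ennreal_leI le_imp_inverse_le)

lemma luxemburg_norm_le:
  assumes "r > 0" "(\<integral>\<^sup>+ x. young_ext A (f x / ennreal r) \<partial>M) \<le> 1"
  shows "luxemburg_norm A M f \<le> ennreal r"
  unfolding luxemburg_norm_def using assms by (intro Inf_lower) auto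

lemma antimono_ennreal_borel:
  fixes f :: "real \<Rightarrow> ennreal"
  assumes "\<And>x y. x \<le> y \<Longrightarrow> f y \<le> f x"
  shows "f \<in> borel_measurable borel"
proof (rule borel_measurableI_ge)
  fix a
  have "is_interval {w. a \<le> f w}"
    unfolding is_interval_1 using assms by (auto intro: order_trans)
  then show "{w \<in> space borel. a \<le> f w} \<in> sets borel"
    by (simp add: real_interval_borel_measurable)
qed

lemma mono_ennreal_borel:
  fixes f :: "real \<Rightarrow> ennreal"
  assumes "\<And>x y. x \<le> y \<Longrightarrow> f x \<le> f y"
  shows "f \<in> borel_measurable borel"
proof (rule borel_measurableI_ge)
  fix a
  have "is_interval {w. a \<le> f w}"
    unfolding is_interval_1 using assms by (auto intro: order_trans)
  then show "{w \<in> space borel. a \<le> f w} \<in> sets borel"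
    by (simp add: real_interval_borel_measurable)
qed

section \<open>Order, convexity and inverse of a Young function\<close>

context fixes A assumes A: "young_function A"
begin

lemma young_less: "0 \<le> x \<Longrightarrow> x < y \<Longrightarrow> A x < A y"
  using A unfolding young_function_def strict_mono_on_def by auto

lemma young_mono: "0 \<le> x \<Longrightarrow> x \<le> y \<Longrightarrow> A x \<le> A y"
  using young_less[of x y] by (cases "x = y") auto

lemma young_nonneg: "0 \<le> x \<Longrightarrow> 0 \<le> A x"
  using A unfolding young_function_def by auto

lemma young_zero: "A 0 = 0"
proof -
  have *: "((\<lambda>t. A t / t * t) \<longlongrightarrow> 0 * 0) (at_right 0)"
    using A unfolding young_function_def by (intro tendsto_intros) auto
  have "A 0 \<le> 0 * 0"
  proof (rule tendsto_lowerbound[OF *])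
    show "\<forall>\<^sub>F t in at_right 0. A 0 \<le> A t / t * t"
      by (auto simp: eventually_at_filter less_imp_le young_less)
  qed simp
  then show ?thesis using young_nonneg[of 0] by simp
qed

lemma young_scale:
  assumes "0 \<le> a" "a \<le> 1" "0 \<le> x" shows "A (a * x) \<le> a * A x"
proof -
  have "convex_on {0..} A" using A unfolding young_function_def by auto
  from convex_onD[OF this, of a 0 x] assms show ?thesis
    by (simp add: young_zero)
qed

lemma young_continuous: "continuous_on {0..} A"
proof -
  have "convex_on {0<..} A"
    using A unfolding young_function_def by (auto intro: convex_on_subset)
  then have c: "continuous_on {0<..} A"
    by (intro convex_on_continuous) auto
  have *: "((\<lambda>t. A t / t * t) \<longlongrightarrow> 0 * 0) (at_right 0)"
    using A unfolding young_function_def by (intro tendsto_intros) auto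
  have z: "(A \<longlongrightarrow> A 0) (at_right 0)"
    unfolding young_zero using *
    by (subst tendsto_cong[of _ "\<lambda>t. A t / t * t"]) (auto simp: eventually_at_filter)
  show ?thesis
    unfolding continuous_on
  proof
    fix x :: real assume "x \<in> {0..}"
    show "(A \<longlongrightarrow> A x) (at x within {0..})"
    proof (cases "x = 0")
      case True then show ?thesis using z by (simp add: at_within_Ici_at_right)
    next
      case False
      then have "x > 0" using \<open>x \<in> {0..}\<close> by auto
      then have "isCont A x" using c by (simp add: continuous_on_eq_continuous_at)
      then show ?thesis by (simp add: isCont_def tendsto_within_subset[of _ _ _ UNIV])
    qed
  qed
qed

text \<open>Surjectivity makes \<open>young_inv A\<close> a genuine inverse on the half line.
  Superlinear growth provides a value above t, and continuity gives t itself.\<close>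

lemma young_image: "A ` {0..} = {0..}"
proof (intro equalityI subsetI)
  fix t :: real assume "t \<in> {0..}"
  then have t: "0 \<le> t" by auto
  have "filterlim (\<lambda>t. A t / t) at_top at_top" using A unfolding young_function_def by auto
  then have "\<forall>\<^sub>F x in at_top. A x / x \<ge> 1" by (simp add: filterlim_at_top)
  then have "\<forall>\<^sub>F x in at_top. A x / x \<ge> 1 \<and> x \<ge> max 1 t"
    by (intro eventually_conj eventually_ge_at_top)
  then obtain x where x: "A x / x \<ge> 1" "x \<ge> max 1 t"
    using eventually_happens'[OF trivial_limit_at_top_linorder] by blast
  then have "t \<le> A x" by (auto simp: divide_simps split: if_splits)
  then have "\<exists>z\<ge>0. z \<le> x \<and> A z = t"
    using x t young_zero by (intro IVT') (auto intro: continuous_on_subset[OF young_continuous])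
  then show "t \<in> A ` {0..}" by auto
qed (auto intro: young_nonneg)

lemma young_inv_nonneg: "0 \<le> t \<Longrightarrow> 0 \<le> young_inv A t"
  using inv_into_into[of t A "{0..}"] young_image by auto

lemma young_young_inv: "0 \<le> t \<Longrightarrow> A (young_inv A t) = t"
  using f_inv_into_f[of t A "{0..}"] young_image by auto

lemma young_le_iff: "0 \<le> x \<Longrightarrow> 0 \<le> t \<Longrightarrow> A x \<le> t \<longleftrightarrow> x \<le> young_inv A t"
  using young_young_inv[of t] young_inv_nonneg[of t] young_less[of "young_inv A t" x] young_mono[of x "young_inv A t"]
  by force

lemma young_inv_pos: "0 < t \<Longrightarrow> 0 < young_inv A t"
  using young_young_inv[of t] young_inv_nonneg[of t] young_zero by (cases "young_inv A t = 0") auto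

lemma young_inv_scale:
  assumes "0 \<le> a" "a \<le> 1" "0 \<le> t" shows "a * young_inv A t \<le> young_inv A (a * t)"
  using young_scale[OF assms(1,2) young_inv_nonneg[OF assms(3)]] assms
    young_le_iff[of "a * young_inv A t" "a * t"] young_inv_nonneg[OF assms(3)]
  by (auto simp: young_young_inv)

lemma young_ext_ennreal: "0 \<le> x \<Longrightarrow> young_ext A (ennreal x) = ennreal (A x)"
  by (simp add: young_ext_def)

text \<open>A Galois connection that includes the value infinity. It makes sublevel sets initial
  segments, which yields measurability, the level sets needed for rearrangements, and the passage
  from partial sums to series.\<close>

lemma young_ext_le_iff:
  assumes "0 \<le> t" shows "young_ext A x \<le> ennreal t \<longleftrightarrow> x \<le> ennreal (young_inv A t)"
  using assms by (cases x) (auto simp: young_ext_def young_le_iff young_inv_nonneg top_unique)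

lemma young_ext_mono: "x \<le> y \<Longrightarrow> young_ext A x \<le> young_ext A y"
  by (cases x; cases y) (auto simp: young_ext_def top_unique intro!: ennreal_leI young_mono)

lemma young_ext_zero [simp]: "young_ext A 0 = 0"
  by (simp add: young_ext_def young_zero)

lemma young_ext_measurable [measurable]: "young_ext A \<in> borel_measurable borel"
proof (rule borel_measurableI_le)
  fix a
  show "{w \<in> space borel. young_ext A w \<le> a} \<in> sets borel"
  proof (cases a)
    case (real t)
    then have "{w \<in> space borel. young_ext A w \<le> a} = {.. ennreal (young_inv A t)}"
      by (auto simp: young_ext_le_iff)
    then show ?thesis by simp
  qed auto
qed

lemma young_ext_scale:
  assumes "0 \<le> a" "a \<le> 1" shows "young_ext A (ennreal a * x) \<le> ennreal a * young_ext A x"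
proof (cases x)
  case (real r)
  then show ?thesis using assms young_scale[of a r]
    by (simp add: ennreal_mult'[symmetric] young_ext_ennreal young_nonneg)
next
  case top
  then show ?thesis using assms
    by (cases "a = 0") (auto simp: young_ext_def ennreal_mult_top young_zero)
qed

text \<open>With a strict inequality, attainment of the infimum never has to be discussed. Later
  bounds are proved for all radii above the norm and then passed to the limit.\<close>

lemma luxemburg_normD:
  assumes "luxemburg_norm A M f < ennreal r"
  shows "(\<integral>\<^sup>+ x. young_ext A (f x / ennreal r) \<partial>M) \<le> 1"
proof -
  obtain s where s: "s > 0" "(\<integral>\<^sup>+ x. young_ext A (f x / ennreal s) \<partial>M) \<le> 1" "ennreal s < ennreal r"
    using assms unfolding luxemburg_norm_def Inf_less_iff by auto
  have "(\<integral>\<^sup>+ x. young_ext A (f x / ennreal r) \<partial>M) \<le> (\<integral>\<^sup>+ x. young_ext A (f x / ennreal s) \<partial>M)"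
    using s by (intro nn_integral_mono young_ext_mono divide_left_mono_ennreal) (auto simp: ennreal_less_iff)
  also have "\<dots> \<le> 1" by fact
  finally show ?thesis .
qed

end

section \<open>Rearrangements\<close>

lemma decr_rearr_antimono: "s \<le> t \<Longrightarrow> decr_rearr u t \<le> decr_rearr u s"
  unfolding decr_rearr_def
  by (rule Inf_superset_mono, clarify) (metis ennreal_leI order_trans)

lemma abs_level_set:
  fixes u :: "'a::euclidean_space \<Rightarrow> real"
  assumes [measurable]: "u \<in> borel_measurable lebesgue"
  shows "{x. s < \<bar>u x\<bar>} \<in> sets lebesgue"
proof -
  have "{x \<in> space lebesgue. s < \<bar>u x\<bar>} \<in> sets lebesgue" by measurable
  then show ?thesis by simp
qed

lemma decr_rearr_measurable [measurable]: "decr_rearr u \<in> borel_measurable borel"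
  by (rule antimono_ennreal_borel) (rule decr_rearr_antimono)

text \<open>The level sets at \<open>y + 1 / (n + 1)\<close> increase to the level set at y, so
  continuity of the measure from below leaves room above y. Conversely, if the level set at y is
  small, \<open>y + e\<close> is admissible in the infimum for every \<open>e > 0\<close>; y itself
  may be 0, which the infimum excludes.\<close>

lemma less_decr_rearr_iff:
  fixes u :: "real ^ 'n \<Rightarrow> real"
  assumes [measurable]: "u \<in> borel_measurable lebesgue" and "0 \<le> y"
  shows "ennreal y < decr_rearr u t \<longleftrightarrow> ennreal t < emeasure lebesgue {x. \<bar>u x\<bar> > y}"
proof
  assume *: "ennreal y < decr_rearr u t"
  show "ennreal t < emeasure lebesgue {x. \<bar>u x\<bar> > y}"
  proof (rule ccontr)
    assume "\<not> ?thesis"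
    then have le: "emeasure lebesgue {x. \<bar>u x\<bar> > s} \<le> ennreal t" if "s \<ge> y" for s
      using that by (intro order_trans[OF emeasure_mono[of "{x. \<bar>u x\<bar> > s}" "{x. \<bar>u x\<bar> > y}"]]) (auto simp: abs_level_set)
    have "decr_rearr u t \<le> ennreal y + ennreal e" if "e > 0" for e
      unfolding decr_rearr_def using le[of "y + e"] that assms(2)
      by (intro Inf_lower) (auto simp: ennreal_plus[symmetric] simp del: ennreal_plus intro!: exI[of _ "y + e"])
    then have "decr_rearr u t \<le> ennreal y"
      by (rule ennreal_le_epsilon)
    then show False using * by (simp add: not_le[symmetric])
  qed
next
  assume *: "ennreal t < emeasure lebesgue {x. \<bar>u x\<bar> > y}"
  define S where "S n = {x. \<bar>u x\<bar> > y + inverse (real (Suc n))}" for n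
  have [measurable]: "S n \<in> sets lebesgue" for n
    unfolding S_def by (rule abs_level_set) fact
  have "(SUP n. emeasure lebesgue (S n)) = emeasure lebesgue (\<Union>n. S n)"
  proof (rule SUP_emeasure_incseq)
    show "incseq S"
      unfolding incseq_Suc_iff S_def
    proof safe
      fix n x assume "y + inverse (real (Suc n)) < \<bar>u x\<bar>"
      moreover have "inverse (real (Suc (Suc n))) \<le> inverse (real (Suc n))" by (simp add: divide_simps)
      ultimately show "y + inverse (real (Suc (Suc n))) < \<bar>u x\<bar>" by linarith
    qed
  qed auto
  also have "(\<Union>n. S n) = {x. \<bar>u x\<bar> > y}"
  proof (intro equalityI subsetI)
    fix x assume "x \<in> {x. \<bar>u x\<bar> > y}"
    then obtain n where "inverse (real (Suc n)) < \<bar>u x\<bar> - y"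
      using reals_Archimedean[of "\<bar>u x\<bar> - y"] by auto
    then show "x \<in> (\<Union>n. S n)" by (auto simp: S_def intro!: exI[of _ n])
  next
    fix x assume "x \<in> (\<Union>n. S n)"
    then obtain n where "y + inverse (real (Suc n)) < \<bar>u x\<bar>" by (auto simp: S_def)
    moreover have "0 < inverse (real (Suc n))" by simp
    ultimately show "x \<in> {x. \<bar>u x\<bar> > y}" unfolding mem_Collect_eq by linarith
  qed
  finally have "ennreal t < (SUP n. emeasure lebesgue (S n))"
    using * by (simp only:)
  then obtain n where n: "ennreal t < emeasure lebesgue (S n)"
    unfolding less_SUP_iff by blast
  let ?z = "y + inverse (real (Suc n))"
  have "ennreal ?z \<le> decr_rearr u t"
    unfolding decr_rearr_def
  proof (rule Inf_greatest, clarify)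
    fix s :: real assume s: "0 < s" "emeasure lebesgue {x. s < \<bar>u x\<bar>} \<le> ennreal t"
    show "ennreal ?z \<le> ennreal s"
    proof (rule ccontr)
      assume "\<not> ?thesis"
      then have "s < ?z" using s(1) by (meson ennreal_leI not_le)
      then have "emeasure lebesgue (S n) \<le> emeasure lebesgue {x. s < \<bar>u x\<bar>}"
        by (intro emeasure_mono abs_level_set assms(1)) (auto simp: S_def)
      also note s(2)
      finally show False using n by (simp add: not_le[symmetric])
    qed
  qed
  moreover have "y < ?z" by simp
  then have "ennreal y < ennreal ?z" using assms(2) by (subst ennreal_less_iff) auto
  ultimately show "ennreal y < decr_rearr u t" by (rule order_less_le_trans[rotated])
qed

lemma nn_integral_lebesgue_on_halfline:
  fixes f :: "real \<Rightarrow> ennreal"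
  shows   "(\<integral>\<^sup>+t. f t \<partial>lebesgue_on {0<..}) = (\<integral>\<^sup>+t\<in>{0<..}. f t \<partial>lborel)"
proof -
  have *: "{0::real<..} \<in> sets lebesgue"
    by (rule sets_completionI_sets) simp
  show ?thesis
    by (subst nn_integral_restrict_space) (simp_all add: nn_integral_completion *)
qed

text \<open>Equimeasurability, reduced by the layer cake formula to a single level. By
  \<open>level\<close>, superlevel sets of \<open>\<Psi>\<close> are open rays, and there
  \<open>less_decr_rearr_iff\<close> exchanges the level set of \<open>u\<close> for an initial
  interval of the same measure.\<close>

lemma nn_integral_decr_rearr_eq:
  fixes u :: "real ^ 'n \<Rightarrow> real"
  assumes [measurable]: "u \<in> borel_measurable lebesgue" "\<Psi> \<in> borel_measurable borel"
    and level: "\<And>s. 0 < s \<Longrightarrow> \<exists>y\<ge>0. \<forall>x. ennreal s < \<Psi> x \<longleftrightarrow> ennreal y < x"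
  shows "(\<integral>\<^sup>+x. \<Psi> (ennreal \<bar>u x\<bar>) \<partial>lebesgue) = (\<integral>\<^sup>+t. \<Psi> (decr_rearr u t) \<partial>lebesgue_on {0<..})"
proof -
  have "(\<integral>\<^sup>+x. \<Psi> (ennreal \<bar>u x\<bar>) * 1 \<partial>lebesgue) =
    (\<integral>\<^sup>+s\<in>{0<..}. (\<integral>\<^sup>+x. 1 * indicator {x. ennreal s < \<Psi> (ennreal \<bar>u x\<bar>)} x \<partial>lebesgue) \<partial>lborel)"
    by (rule nn_integral_layer_cake[OF sigma_finite_lebesgue]) measurable
  also have "\<dots> = (\<integral>\<^sup>+s\<in>{0<..}. (\<integral>\<^sup>+t. indicator {0<..} t * indicator {t. ennreal s < \<Psi> (decr_rearr u t)} t \<partial>lborel) \<partial>lborel)"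
  proof (intro nn_integral_cong)
    fix s :: real
    show "(\<integral>\<^sup>+x. 1 * indicator {x. ennreal s < \<Psi> (ennreal \<bar>u x\<bar>)} x \<partial>lebesgue) * indicator {0<..} s =
      (\<integral>\<^sup>+t. indicator {0<..} t * indicator {t. ennreal s < \<Psi> (decr_rearr u t)} t \<partial>lborel) * indicator {0<..} s"
    proof (cases "0 < s")
      case True
      then obtain y where y: "y \<ge> 0" "\<And>x. ennreal s < \<Psi> x \<longleftrightarrow> ennreal y < x"
        using level by blast
      have "(\<integral>\<^sup>+x. 1 * indicator {x. ennreal s < \<Psi> (ennreal \<bar>u x\<bar>)} x \<partial>lebesgue) = emeasure lebesgue {x. \<bar>u x\<bar> > y}"
        using y by (simp add: ennreal_less_iff abs_level_set)
      also have "\<dots> = emeasure lborel {t. 0 < t \<and> ennreal t < emeasure lebesgue {x. \<bar>u x\<bar> > y}}"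
        by (rule emeasure_Ioo_ennreal[symmetric])
      also have "{t. 0 < t \<and> ennreal t < emeasure lebesgue {x. \<bar>u x\<bar> > y}} = {0<..} \<inter> {t. ennreal s < \<Psi> (decr_rearr u t)}"
        using y less_decr_rearr_iff[of u y] by auto
      also have "emeasure lborel \<dots> = (\<integral>\<^sup>+t. indicator ({0<..} \<inter> {t. ennreal s < \<Psi> (decr_rearr u t)}) t \<partial>lborel)"
        by (rule nn_integral_indicator[symmetric]) measurable
      also have "\<dots> = (\<integral>\<^sup>+t. indicator {0<..} t * indicator {t. ennreal s < \<Psi> (decr_rearr u t)} t \<partial>lborel)"
        by (intro nn_integral_cong) (auto simp: indicator_def)
      finally show ?thesis by simp
    qed simp
  qed
  also have "\<dots> = (\<integral>\<^sup>+t. \<Psi> (decr_rearr u t) * indicator {0<..} t \<partial>lborel)"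
    by (rule nn_integral_layer_cake[OF lborel.sigma_finite_measure_axioms, symmetric]) measurable
  finally show ?thesis by (simp add: nn_integral_lebesgue_on_halfline)
qed

lemma young_modular_decr_rearr:
  fixes u :: "real ^ 'n \<Rightarrow> real"
  assumes "young_function A" and "u \<in> borel_measurable lebesgue" "0 < r"
  shows "(\<integral>\<^sup>+x. young_ext A (ennreal \<bar>u x\<bar> / ennreal r) \<partial>lebesgue) =
    (\<integral>\<^sup>+t. young_ext A (decr_rearr u t / ennreal r) \<partial>lebesgue_on {0<..})"
proof (rule nn_integral_decr_rearr_eq[OF assms(2), where \<Psi> = "\<lambda>x. young_ext A (x / ennreal r)"])
  note young_ext_measurable[OF assms(1), measurable]
  show "(\<lambda>x. young_ext A (x / ennreal r)) \<in> borel_measurable borel" by measurable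
  fix s :: real assume s: "0 < s"
  have "ennreal s < young_ext A (x / ennreal r) \<longleftrightarrow> ennreal (young_inv A s * r) < x" for x
  proof -
    have "ennreal s < young_ext A (x / ennreal r) \<longleftrightarrow> ennreal (young_inv A s) < x / ennreal r"
      using young_ext_le_iff[OF assms(1), of s] s by (auto simp: not_le[symmetric])
    also have "\<dots> \<longleftrightarrow> ennreal (young_inv A s * r) < x"
      using assms(3) young_inv_nonneg[OF assms(1), of s] s
      by (cases x) (auto simp: divide_ennreal ennreal_less_iff field_simps ennreal_top_divide)
    finally show ?thesis .
  qed
  then show "\<exists>y\<ge>0. \<forall>x. ennreal s < young_ext A (x / ennreal r) \<longleftrightarrow> ennreal y < x"
    using young_inv_nonneg[OF assms(1), of s] s assms(3) by (intro exI[of _ "young_inv A s * r"]) auto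
qed

text \<open>The Hardy-Littlewood inequality with weights in place of sets. On the level set at s the
  weight has mass at most t and at most the measure of that set; the smaller of the two is the
  length of the part of (0, t) where the rearrangement exceeds s.\<close>

lemma nn_integral_le_max_rearr:
  fixes u :: "real ^ 'n \<Rightarrow> real"
  assumes [measurable]: "u \<in> borel_measurable lebesgue" "H \<in> borel_measurable lebesgue"
    and H: "\<And>x. H x \<le> 1" "(\<integral>\<^sup>+x. H x \<partial>lebesgue) \<le> ennreal t" and t: "0 < t"
  shows "(\<integral>\<^sup>+x. ennreal \<bar>u x\<bar> * H x \<partial>lebesgue) \<le> ennreal t * max_rearr u t"
proof -
  have "(\<integral>\<^sup>+x. ennreal \<bar>u x\<bar> * H x \<partial>lebesgue) =
    (\<integral>\<^sup>+s\<in>{0<..}. (\<integral>\<^sup>+x. H x * indicator {x. ennreal s < ennreal \<bar>u x\<bar>} x \<partial>lebesgue) \<partial>lborel)"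
    by (rule nn_integral_layer_cake[OF sigma_finite_lebesgue]) measurable
  also have "\<dots> \<le> (\<integral>\<^sup>+s\<in>{0<..}. (\<integral>\<^sup>+q. indicator {0<..<t} q * indicator {q. ennreal s < decr_rearr u q} q \<partial>lborel) \<partial>lborel)"
  proof (intro nn_integral_mono)
    fix s :: real
    show "(\<integral>\<^sup>+x. H x * indicator {x. ennreal s < ennreal \<bar>u x\<bar>} x \<partial>lebesgue) * indicator {0<..} s \<le>
      (\<integral>\<^sup>+q. indicator {0<..<t} q * indicator {q. ennreal s < decr_rearr u q} q \<partial>lborel) * indicator {0<..} s"
    proof (cases "0 < s")
      case True
      let ?m = "emeasure lebesgue {x. \<bar>u x\<bar> > s}"
      have 1: "(\<integral>\<^sup>+x. H x * indicator {x. ennreal s < ennreal \<bar>u x\<bar>} x \<partial>lebesgue) \<le> ennreal t"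
        by (rule order_trans[OF nn_integral_mono H(2)]) (auto simp: indicator_def)
      have "(\<integral>\<^sup>+x. H x * indicator {x. ennreal s < ennreal \<bar>u x\<bar>} x \<partial>lebesgue) \<le>
         (\<integral>\<^sup>+x. indicator {x. s < \<bar>u x\<bar>} x \<partial>lebesgue)"
        using H(1) True by (intro nn_integral_mono) (auto simp: indicator_def ennreal_less_iff)
      also have "\<dots> = ?m" by (rule nn_integral_indicator) (simp add: abs_level_set)
      finally have "(\<integral>\<^sup>+x. H x * indicator {x. ennreal s < ennreal \<bar>u x\<bar>} x \<partial>lebesgue) \<le> min (ennreal t) ?m"
        using 1 by simp
      also have "\<dots> = emeasure lborel {q. 0 < q \<and> ennreal q < min (ennreal t) ?m}"
        by (rule emeasure_Ioo_ennreal[symmetric])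
      also have "{q. 0 < q \<and> ennreal q < min (ennreal t) ?m} = {0<..<t} \<inter> {q. ennreal s < decr_rearr u q}"
        using True less_decr_rearr_iff[of u s] by (auto simp: ennreal_less_iff)
      also have "emeasure lborel \<dots> = (\<integral>\<^sup>+q. indicator ({0<..<t} \<inter> {q. ennreal s < decr_rearr u q}) q \<partial>lborel)"
        by (rule nn_integral_indicator[symmetric]) measurable
      also have "\<dots> = (\<integral>\<^sup>+q. indicator {0<..<t} q * indicator {q. ennreal s < decr_rearr u q} q \<partial>lborel)"
        by (intro nn_integral_cong) (auto simp: indicator_def)
      finally show ?thesis using True by simp
    qed simp
  qed
  also have "\<dots> = (\<integral>\<^sup>+q. decr_rearr u q * indicator {0<..<t} q \<partial>lborel)"
    by (rule nn_integral_layer_cake[OF lborel.sigma_finite_measure_axioms, symmetric]) measurable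
  also have "\<dots> = (\<integral>\<^sup>+q\<in>{0<..<t}. decr_rearr u q \<partial>lebesgue)"
    by (simp add: nn_integral_completion)
  also have "\<dots> = ennreal t * max_rearr u t"
    unfolding max_rearr_def using t by (simp add: ennreal_times_divide mult.commute[of "ennreal t"] ennreal_mult_divide_eq)
  finally show ?thesis .
qed

lemma max_rearr_measurable [measurable]: "max_rearr u \<in> borel_measurable borel"
proof -
  have "(\<lambda>t. \<integral>\<^sup>+ s \<in> {0<..<t}. decr_rearr u s \<partial>lebesgue) \<in> borel_measurable borel"
    by (rule mono_ennreal_borel) (auto intro!: nn_integral_mono simp: indicator_def)
  then show ?thesis unfolding max_rearr_def[abs_def] by measurable
qed

section \<open>Smooth functions\<close>

definition smooth_function :: "(real ^ 'n \<Rightarrow> real) \<Rightarrow> bool" where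
  "smooth_function f \<longleftrightarrow> (\<forall>is. partial_deriv is f differentiable_on UNIV)"

lemma partial_deriv_append: "partial_deriv (is @ js) f = partial_deriv is (partial_deriv js f)"
  by (induction "is") auto

lemma smooth_partial_deriv: "smooth_function f \<Longrightarrow> smooth_function (partial_deriv is f)"
  unfolding smooth_function_def by (metis partial_deriv_append)

lemma smooth_differentiable: "smooth_function f \<Longrightarrow> f differentiable (at x)"
  unfolding smooth_function_def by (metis UNIV_I differentiable_on_def partial_deriv.simps(1))

lemma smooth_continuous: "smooth_function f \<Longrightarrow> continuous_on UNIV f"
  by (simp add: continuous_at_imp_continuous_on differentiable_imp_continuous_within smooth_differentiable)

lemma smooth_measurable [measurable_dest]: "smooth_function f \<Longrightarrow> f \<in> borel_measurable borel"
  by (rule borel_measurable_continuous_onI) (rule smooth_continuous)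

text \<open>A coinductive principle: an explicit class closed under first partial derivatives spares
  formulas for the iterated ones.\<close>

lemma smooth_functionI:
  assumes "f \<in> S" "\<And>f x. f \<in> S \<Longrightarrow> f differentiable (at x)" "\<And>f i. f \<in> S \<Longrightarrow> partial_deriv [i] f \<in> S"
  shows "smooth_function f"
proof -
  have "partial_deriv is f \<in> S" for "is"
  proof (induction "is")
    case Nil then show ?case using assms(1) by simp
  next
    case (Cons i "is")
    then show ?case using assms(3)[of "partial_deriv is f" i] by simp
  qed
  then show ?thesis
    unfolding smooth_function_def using assms(2) by (simp add: differentiable_on_def)
qed

lemma has_derivative_partial_deriv:
  "(f has_derivative f') (at x) \<Longrightarrow> partial_deriv [i] f x = f' (axis i 1)"
  by (simp add: frechet_derivative_at[symmetric])

lemma partial_deriv_along_line: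
  assumes "f differentiable (at (x + t *\<^sub>R axis i 1))"
  shows "((\<lambda>t. f (x + t *\<^sub>R axis i 1)) has_real_derivative partial_deriv [i] f (x + t *\<^sub>R axis i 1)) (at t)"
proof -
  have 1: "(f has_derivative frechet_derivative f (at (x + t *\<^sub>R axis i 1))) (at (x + t *\<^sub>R axis i 1))"
    using assms by (simp add: frechet_derivative_works)
  have "((\<lambda>t. x + t *\<^sub>R axis i 1) has_derivative (\<lambda>t. t *\<^sub>R axis i 1)) (at t)"
    by (auto intro!: derivative_eq_intros)
  from has_derivative_compose[OF this 1]
  have "((\<lambda>t. f (x + t *\<^sub>R axis i 1)) has_derivative
      (\<lambda>s. frechet_derivative f (at (x + t *\<^sub>R axis i 1)) (s *\<^sub>R axis i 1))) (at t)" .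
  moreover have "frechet_derivative f (at (x + t *\<^sub>R axis i 1)) (s *\<^sub>R axis i 1) =
     partial_deriv [i] f (x + t *\<^sub>R axis i 1) * s" for s
    using linear_frechet_derivative[OF assms] by (simp add: linear_cmul mult.commute)
  ultimately show ?thesis by (simp add: has_field_derivative_def)
qed

lemma partial_deriv_eqI:
  assumes "f differentiable (at x)" "((\<lambda>t. f (x + t *\<^sub>R axis i 1)) has_real_derivative d) (at 0)"
  shows "partial_deriv [i] f x = d"
  using partial_deriv_along_line[of f x 0 i] assms DERIV_unique by force

lemma smooth_affine:
  assumes "smooth_function f"
  shows "partial_deriv is (\<lambda>x. f (a + b *\<^sub>R x)) = (\<lambda>x. b ^ length is * partial_deriv is f (a + b *\<^sub>R x))"
    and "smooth_function (\<lambda>x. f (a + b *\<^sub>R x))"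
proof -
  have d: "((\<lambda>x. b ^ m * partial_deriv js f (a + b *\<^sub>R x)) has_derivative
      (\<lambda>h. b ^ m * (frechet_derivative (partial_deriv js f) (at (a + b *\<^sub>R x)) (b *\<^sub>R h)))) (at x)" for js m x
  proof -
    have 1: "(partial_deriv js f has_derivative frechet_derivative (partial_deriv js f) (at (a + b *\<^sub>R x))) (at (a + b *\<^sub>R x))"
      using smooth_differentiable[OF smooth_partial_deriv[OF assms]] by (simp add: frechet_derivative_works)
    have "((\<lambda>x. a + b *\<^sub>R x) has_derivative (\<lambda>h. b *\<^sub>R h)) (at x)"
      by (auto intro!: derivative_eq_intros)
    from has_derivative_compose[OF this 1] show ?thesis
      by (intro has_derivative_mult_right)
  qed
  have eq: "partial_deriv is (\<lambda>x. f (a + b *\<^sub>R x)) = (\<lambda>x. b ^ length is * partial_deriv is f (a + b *\<^sub>R x))" for "is"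
  proof (induction "is")
    case (Cons i "is")
    have "linear (frechet_derivative (partial_deriv is f) (at y))" for y
      using linear_frechet_derivative smooth_differentiable[OF smooth_partial_deriv[OF assms]] by blast
    then show ?case
      by (simp add: Cons.IH frechet_derivative_at[OF d, symmetric] linear_cmul mult_ac)
  qed simp
  then show "partial_deriv is (\<lambda>x. f (a + b *\<^sub>R x)) = (\<lambda>x. b ^ length is * partial_deriv is f (a + b *\<^sub>R x))" .
  show "smooth_function (\<lambda>x. f (a + b *\<^sub>R x))"
    unfolding smooth_function_def differentiable_on_def eq using d differentiable_def by blast
qed

section \<open>Test functions and the operations that preserve them\<close>

lemma test_function_smooth: "test_function f \<Longrightarrow> smooth_function f"
  by (simp add: test_function_def smooth_function_def)

lemma test_functionI:
  assumes "smooth_function f" "\<And>x. f x \<noteq> 0 \<Longrightarrow> norm x \<le> r"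
  shows "test_function f"
proof -
  have "bounded {x. f x \<noteq> 0}" using assms(2) by (auto simp: bounded_iff)
  then show ?thesis
    using assms(1) by (simp add: test_function_def smooth_function_def compact_closure)
qed

lemma test_function_support:
  assumes "test_function f" obtains r where "r > 0" "\<And>x. norm x > r \<Longrightarrow> f x = 0"
proof -
  have "bounded (closure {x. f x \<noteq> 0})"
    using assms by (auto simp: test_function_def compact_imp_bounded)
  then obtain r where "r > 0" "\<And>x. x \<in> closure {x. f x \<noteq> 0} \<Longrightarrow> norm x \<le> r"
    by (auto simp: bounded_pos)
  then show ?thesis
    using that[of r] closure_subset[of "{x. f x \<noteq> 0}"] by force
qed

lemma test_function_affine:
  assumes "test_function f" "b \<noteq> 0" shows "test_function (\<lambda>x. f (a + b *\<^sub>R x))"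
proof -
  obtain r where r: "r > 0" "\<And>x. norm x > r \<Longrightarrow> f x = 0" using test_function_support[OF assms(1)] by blast
  show ?thesis
  proof (rule test_functionI)
    show "smooth_function (\<lambda>x. f (a + b *\<^sub>R x))" by (rule smooth_affine(2)[OF test_function_smooth[OF assms(1)]])
    fix x assume "f (a + b *\<^sub>R x) \<noteq> 0"
    then have "norm (a + b *\<^sub>R x) \<le> r" using r(2) by force
    moreover have "norm (b *\<^sub>R x) \<le> norm (a + b *\<^sub>R x) + norm a"
      by (metis add_diff_cancel_left' norm_triangle_sub add.commute norm_triangle_ineq4)
    ultimately have "\<bar>b\<bar> * norm x \<le> r + norm a" by simp
    then show "norm x \<le> (r + norm a) / \<bar>b\<bar>" using assms(2) by (simp add: field_simps)
  qed
qed

lemma partial_deriv_eq_0_outside: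
  fixes f :: "real ^ 'n \<Rightarrow> real"
  assumes "\<And>x. norm x > r \<Longrightarrow> f x = 0" "norm x > r"
  shows "partial_deriv is f x = 0"
  using assms(2)
proof (induction "is" arbitrary: x)
  case Nil then show ?case using assms(1) by simp
next
  case (Cons i "is")
  have "open {x::real^'n. norm x > r}"
    by (intro open_Collect_less continuous_intros)
  then have "(partial_deriv is f has_derivative (\<lambda>_. 0)) (at x)"
    by (rule has_derivative_transform_within_open[of "\<lambda>_. 0", rotated]) (use Cons in auto)
  then show ?case by (simp add: frechet_derivative_at[symmetric])
qed

lemma test_function_partial_deriv:
  assumes "test_function f" shows "test_function (partial_deriv is f)"
proof -
  obtain r where r: "r > 0" "\<And>x. norm x > r \<Longrightarrow> f x = 0" using test_function_support[OF assms] by blast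
  show ?thesis
    by (rule test_functionI[OF smooth_partial_deriv[OF test_function_smooth[OF assms]], of _ r])
      (use partial_deriv_eq_0_outside[of r f] r(2) in force)
qed

lemma test_function_cmult:
  assumes "test_function f" shows "test_function (\<lambda>x. c * f x)"
    and "partial_deriv is (\<lambda>x. c * f x) = (\<lambda>x. c * partial_deriv is f x)"
proof -
  have d: "((\<lambda>x. c * partial_deriv js f x) has_derivative
      (\<lambda>h. c * frechet_derivative (partial_deriv js f) (at x) h)) (at x)" for js x
    using smooth_differentiable[OF smooth_partial_deriv[OF test_function_smooth[OF assms]]]
    by (intro has_derivative_mult_right) (simp add: frechet_derivative_works)
  have eq: "partial_deriv is (\<lambda>x. c * f x) = (\<lambda>x. c * partial_deriv is f x)" for "is"
  proof (induction "is")
    case (Cons i "is")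
    then show ?case
      by (simp add: frechet_derivative_at[OF d, symmetric])
  qed simp
  then show "partial_deriv is (\<lambda>x. c * f x) = (\<lambda>x. c * partial_deriv is f x)" .
  obtain r where r: "r > 0" "\<And>x. norm x > r \<Longrightarrow> f x = 0" using test_function_support[OF assms] by blast
  have "smooth_function (\<lambda>x. c * f x)"
    unfolding smooth_function_def differentiable_on_def eq using d differentiable_def by blast
  then show "test_function (\<lambda>x. c * f x)"
    by (rule test_functionI[of _ r]) (use r in force)
qed

lemma integrable_bounded_support:
  fixes f :: "real ^ 'n \<Rightarrow> real"
  assumes "continuous_on UNIV f" "\<And>x. norm x > r \<Longrightarrow> f x = 0"
  shows "integrable lborel f"
proof -
  have "integrable lborel (\<lambda>x. indicator (cball 0 r) x *\<^sub>R f x)"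
    by (intro borel_integrable_compact continuous_on_subset[OF assms(1)]) auto
  also have "(\<lambda>x. indicator (cball 0 r) x *\<^sub>R f x) = f"
    using assms(2) by (auto simp: fun_eq_iff indicator_def)
  finally show ?thesis .
qed

lemma test_function_integrable:
  assumes "test_function f" shows "integrable lborel f"
  using integrable_bounded_support test_function_support[OF assms] smooth_continuous[OF test_function_smooth[OF assms]]
  by metis

lemma test_function_bounded:
  assumes "test_function f" obtains b where "b > 0" "\<And>x. \<bar>f x\<bar> \<le> b"
proof -
  obtain r where r: "r > 0" "\<And>x. norm x > r \<Longrightarrow> f x = 0" using test_function_support[OF assms] by blast
  have "compact (f ` cball 0 r)"
    by (intro compact_continuous_image continuous_on_subset[OF smooth_continuous[OF test_function_smooth[OF assms]]]) auto
  then obtain b where b: "b > 0" "\<forall>y\<in>f ` cball 0 r. norm y \<le> b"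
    using compact_imp_bounded bounded_pos by metis
  have "\<bar>f x\<bar> \<le> b" for x
    using b r(2)[of x] by (cases "norm x \<le> r") auto
  then show ?thesis using b(1) that by blast
qed

section \<open>A smoothing kernel\<close>

text \<open>The exponent m is carried along because differentiation raises it: the span of the whole
  family is closed under derivatives, while the function for \<open>m = 0\<close> alone is
  not.\<close>

definition flat_exp :: "nat \<Rightarrow> real \<Rightarrow> real" where
  "flat_exp m t = (if 0 < t then exp (- inverse t) * inverse t ^ m else 0)"

lemma flat_exp_deriv:
  "(flat_exp m has_real_derivative (flat_exp (m + 2) t - real m * flat_exp (m + 1) t)) (at t)"
proof (cases "t = 0")
  case False
  show ?thesis
  proof (cases "t > 0")
    case True
    have "((\<lambda>t. exp (- inverse t) * inverse t ^ m) has_real_derivative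
       (flat_exp (m + 2) t - real m * flat_exp (m + 1) t)) (at t)"
      using True by (auto intro!: derivative_eq_intros simp: flat_exp_def field_simps power2_eq_square)
         (cases m; simp add: field_simps)
    then show ?thesis
      by (rule has_field_derivative_transform_within_open[of _ _ _ "{0<..}"]) (use True in \<open>auto simp: flat_exp_def\<close>)
  next
    case nt: False
    have "((\<lambda>t. 0) has_real_derivative (flat_exp (m + 2) t - real m * flat_exp (m + 1) t)) (at t)"
      using nt by (simp add: flat_exp_def)
    then show ?thesis
      by (rule has_field_derivative_transform_within_open[of _ _ _ "{..<0}"]) (use nt False in \<open>auto simp: flat_exp_def\<close>)
  qed
next
  case True
  have "((\<lambda>h. flat_exp m h / h) \<longlongrightarrow> 0) (at 0)"
  proof (rule filterlim_split_at)
    show "((\<lambda>h. flat_exp m h / h) \<longlongrightarrow> 0) (at_left 0)"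
      by (rule tendsto_eventually) (auto simp: eventually_at_filter flat_exp_def)
    \<comment> \<open>With \<open>x = 1 / h\<close>, the right-hand difference quotient at 0 becomes
      a power of x divided by \<open>exp x\<close>.\<close>
    have "((\<lambda>x::real. x ^ Suc m / exp x) \<longlongrightarrow> 0) at_top"
      by (rule tendsto_power_div_exp_0)
    then have "((\<lambda>h::real. inverse h ^ Suc m / exp (inverse h)) \<longlongrightarrow> 0) (at_right 0)"
      using filterlim_inverse_at_top_right by (rule filterlim_compose)
    then show "((\<lambda>h. flat_exp m h / h) \<longlongrightarrow> 0) (at_right 0)"
      by (rule Lim_transform_eventually) (auto simp: eventually_at_filter flat_exp_def exp_minus field_simps)
  qed
  then show ?thesis using True by (simp add: has_field_derivative_iff flat_exp_def)
qed


text \<open>The algebra is closed under partial derivatives as long as \<open>R' t = flat_exp 0 t * flat_exp 0 (1 - t)\<close>.\<close>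

inductive_set step_algebra :: "(real \<Rightarrow> real) \<Rightarrow> (real ^ 'n \<Rightarrow> real) set" for R where
  const: "(\<lambda>x. c) \<in> step_algebra R"
| flat: "(\<lambda>x. flat_exp m (a + b * x $ i)) \<in> step_algebra R"
| step: "(\<lambda>x. R (b * x $ i)) \<in> step_algebra R"
| add: "f \<in> step_algebra R \<Longrightarrow> g \<in> step_algebra R \<Longrightarrow> (\<lambda>x. f x + g x) \<in> step_algebra R"
| mult: "f \<in> step_algebra R \<Longrightarrow> g \<in> step_algebra R \<Longrightarrow> (\<lambda>x. f x * g x) \<in> step_algebra R"

lemma step_algebra_prod:
  "finite S \<Longrightarrow> (\<And>i. i \<in> S \<Longrightarrow> f i \<in> step_algebra R) \<Longrightarrow> (\<lambda>x. \<Prod>i\<in>S. f i x) \<in> step_algebra R"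
  by (induction S rule: finite_induct) (auto intro: step_algebra.intros)

lemma step_algebra_diff:
  "f \<in> step_algebra R \<Longrightarrow> g \<in> step_algebra R \<Longrightarrow> (\<lambda>x. f x - g x) \<in> step_algebra R"
  using step_algebra.add[OF _ step_algebra.mult[OF step_algebra.const[of "-1"]], of f R g] by simp

lemma step_algebra_derivative:
  fixes f :: "real ^ 'n \<Rightarrow> real"
  assumes R: "\<And>t. (R has_real_derivative flat_exp 0 t * flat_exp 0 (1 - t)) (at t)"
    and "f \<in> step_algebra R"
  shows "\<exists>f'. (\<forall>x. (f has_derivative f' x) (at x)) \<and> (\<forall>i. (\<lambda>x. f' x (axis i 1)) \<in> step_algebra R)"
  using assms(2)
proof induction
  case (const c)
  show ?case
    by (rule exI[of _ "\<lambda>_ _. 0"]) (auto intro: step_algebra.const)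
next
  case (flat m a b i)
  let ?h = "\<lambda>x::real^'n. flat_exp (m + 2) (a + b * x $ i) + (- real m) * flat_exp (m + 1) (a + b * x $ i)"
  have "((\<lambda>x. flat_exp m (a + b * x $ i)) has_derivative (\<lambda>h. ?h x * (b * h $ i))) (at x)" for x
    by (rule has_derivative_eq_rhs, rule has_derivative_compose[OF _ flat_exp_deriv[unfolded has_field_derivative_def]])
      (auto intro!: derivative_eq_intros bounded_linear_imp_has_derivative bounded_linear_vec_nth simp: algebra_simps)
  moreover have "(\<lambda>x. ?h x * (b * axis l 1 $ i)) \<in> step_algebra R" for l
    by (intro step_algebra.intros)
  ultimately show ?case by (intro exI[of _ "\<lambda>x h. ?h x * (b * h $ i)"]) auto
next
  case (step b i)
  \<comment> \<open>The forms \<open>0 + b * _\<close> and \<open>1 + (-b) * _\<close> match the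
    rule \<open>flat\<close> literally, which shows that the derivative stays in the
    algebra.\<close>
  let ?h = "\<lambda>x::real^'n. flat_exp 0 (0 + b * x $ i) * flat_exp 0 (1 + (-b) * x $ i)"
  have "((\<lambda>x. R (b * x $ i)) has_derivative (\<lambda>h. ?h x * (b * h $ i))) (at x)" for x
    by (rule has_derivative_eq_rhs, rule has_derivative_compose[OF _ R[unfolded has_field_derivative_def]])
      (auto intro!: derivative_eq_intros bounded_linear_imp_has_derivative bounded_linear_vec_nth simp: algebra_simps)
  moreover have "(\<lambda>x. ?h x * (b * axis l 1 $ i)) \<in> step_algebra R" for l
    by (intro step_algebra.intros)
  ultimately show ?case by (intro exI[of _ "\<lambda>x h. ?h x * (b * h $ i)"]) auto
next
  case (add f g)
  then obtain f' g' where "\<forall>x. (f has_derivative f' x) (at x)" "\<forall>i. (\<lambda>x. f' x (axis i 1)) \<in> step_algebra R"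
    "\<forall>x. (g has_derivative g' x) (at x)" "\<forall>i. (\<lambda>x. g' x (axis i 1)) \<in> step_algebra R" by blast
  then show ?case
    by (intro exI[of _ "\<lambda>x h. f' x h + g' x h"]) (auto intro!: has_derivative_add step_algebra.intros)
next
  case (mult f g)
  then obtain f' g' where "\<forall>x. (f has_derivative f' x) (at x)" "\<forall>i. (\<lambda>x. f' x (axis i 1)) \<in> step_algebra R"
    "\<forall>x. (g has_derivative g' x) (at x)" "\<forall>i. (\<lambda>x. g' x (axis i 1)) \<in> step_algebra R" by blast
  then show ?case using mult
    by (intro exI[of _ "\<lambda>x h. f x * g' x h + f' x h * g x"]) (auto intro!: has_derivative_mult step_algebra.intros)
qed

lemma step_algebra_smooth:
  assumes R: "\<And>t. (R has_real_derivative flat_exp 0 t * flat_exp 0 (1 - t)) (at t)"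
    and "f \<in> step_algebra R"
  shows "smooth_function f"
proof (rule smooth_functionI[OF assms(2)])
  fix f :: "real ^ 'a \<Rightarrow> real" and x assume "f \<in> step_algebra R"
  then show "f differentiable (at x)"
    using step_algebra_derivative[OF R] differentiable_def by blast
next
  fix f :: "real ^ 'a \<Rightarrow> real" and i assume "f \<in> step_algebra R"
  then obtain f' where f': "\<And>x. (f has_derivative f' x) (at x)" "(\<lambda>x. f' x (axis i 1)) \<in> step_algebra R"
    using step_algebra_derivative[OF R] by blast
  then have "partial_deriv [i] f = (\<lambda>x. f' x (axis i 1))"
    using has_derivative_partial_deriv by blast
  then show "partial_deriv [i] f \<in> step_algebra R" using f' by simp
qed

text \<open>
  The kernel is a tensor power; halving its scale one coordinate at a time changes it by a pure
  derivative at each step, with primitive \<open>R (2 * t) - R t\<close> in the current coordinate.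
\<close>

lemma smoothing_kernel_exists:
  obtains \<phi> :: "real ^ 'n \<Rightarrow> real" and \<psi> :: "'n \<Rightarrow> real ^ 'n \<Rightarrow> real"
  where "test_function \<phi>" "\<And>x. 0 \<le> \<phi> x" "\<exists>x. 0 < \<phi> x" "\<And>i. test_function (\<psi> i)"
    "\<And>x. 2 ^ CARD('n) * \<phi> (2 *\<^sub>R x) - \<phi> x = (\<Sum>i\<in>UNIV. partial_deriv [i] (\<psi> i) x)"
proof -
  define \<rho> where "\<rho> t = flat_exp 0 t * flat_exp 0 (1 - t)" for t
  have \<rho>_nonneg: "0 \<le> \<rho> t" for t by (auto simp: \<rho>_def flat_exp_def)
  have \<rho>_pos: "0 < \<rho> (1/2)" by (auto simp: \<rho>_def flat_exp_def)
  have \<rho>_zero: "\<rho> t = 0" if "t \<le> 0 \<or> 1 \<le> t" for t using that by (auto simp: \<rho>_def flat_exp_def)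
  have cont: "isCont (flat_exp 0) t" for t
    using flat_exp_deriv DERIV_isCont by blast
  have "isCont \<rho> t" for t
    unfolding \<rho>_def[abs_def] by (intro continuous_intros isCont_o2[OF _ cont] cont)
  then obtain R where R: "\<And>t. (R has_real_derivative \<rho> t) (at t)"
    using einterval_antiderivative[of "-\<infinity>" \<infinity> \<rho>] by (auto simp: has_real_derivative_iff_has_vector_derivative)
  have R_left: "R t = R 0" if "t \<le> 0" for t
  proof -
    have "(R has_real_derivative 0) (at s within {..0})" if "s \<in> {..0}" for s
      using R[of s] \<rho>_zero[of s] that by (simp add: has_field_derivative_at_within)
    then obtain c where "\<And>s. s \<in> {..0} \<Longrightarrow> R s = c"
      using has_field_derivative_zero_constant[of "{..0::real}" R] by auto
    then show ?thesis using that by simp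
  qed
  have R_right: "R t = R 1" if "1 \<le> t" for t
  proof -
    have "(R has_real_derivative 0) (at s within {1..})" if "s \<in> {1..}" for s
      using R[of s] \<rho>_zero[of s] that by (simp add: has_field_derivative_at_within)
    then obtain c where "\<And>s. s \<in> {1..} \<Longrightarrow> R s = c"
      using has_field_derivative_zero_constant[of "{1::real..}" R] by auto
    then show ?thesis using that by simp
  qed
  \<comment> \<open>\<open>R\<close> is constant on each side of (0, 1), but with different
    constants, so it is not compactly supported itself. In the difference of the two scales the
    constants cancel.\<close>
  have R_zero: "R t - R (2 * t) = 0" if "t \<le> 0 \<or> 1 \<le> t" for t
    using that R_left[of t] R_left[of "2 * t"] R_right[of t] R_right[of "2 * t"] by auto
  note smooth = step_algebra_smooth[OF R[unfolded \<rho>_def]]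
  \<comment> \<open>\<open>S\<close> collects the coordinates already moved to half scale; the
    factor 2 preserves the integral in such a coordinate.\<close>
  define q where "q S l t = (if l \<in> S then 2 * \<rho> (2 * t) else \<rho> t)" for S :: "'n set" and l t
  have q_zero: "q S l t = 0" if "t \<le> 0 \<or> 1 \<le> t" for S l t
    unfolding q_def using that \<rho>_zero[of t] \<rho>_zero[of "2 * t"] by auto
  have q_alg: "(\<lambda>x. q S l (x $ l)) \<in> step_algebra R" for S l
  proof -
    have "(\<lambda>x. 2 * (flat_exp 0 (0 + 2 * x $ l) * flat_exp 0 (1 + (-2) * x $ l))) \<in> step_algebra R"
      "(\<lambda>x. flat_exp 0 (0 + 1 * x $ l) * flat_exp 0 (1 + (-1) * x $ l)) \<in> step_algebra R"
      by (intro step_algebra.intros)+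
    then show ?thesis by (cases "l \<in> S") (simp_all add: q_def \<rho>_def)
  qed
  define P where "P S x = (\<Prod>l\<in>UNIV. q S l (x $ l))" for S and x :: "real ^ 'n"
  \<comment> \<open>Differentiation in direction j turns the last factor into
    \<open>2 * \<rho> (2 * t) - \<rho> t\<close>, the change of one coordinate factor when j joins
    \<open>S\<close>.\<close>
  define X where "X S j x = (\<Prod>l\<in>UNIV - {j}. q S l (x $ l)) * (R (2 * x $ j) - R (x $ j))" for S j and x :: "real ^ 'n"
  have supp: "norm x \<le> real CARD('n)" if "\<And>l. 0 < x $ l \<and> x $ l < 1" for x :: "real ^ 'n"
  proof -
    have "norm x \<le> (\<Sum>l\<in>UNIV. \<bar>x $ l\<bar>)" by (rule norm_le_l1_cart)
    also have "\<dots> \<le> (\<Sum>l\<in>(UNIV::'n set). 1)" by (intro sum_mono) (use that less_imp_le in \<open>auto simp: abs_le_iff\<close>, smt (verit) that)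
    finally show ?thesis by simp
  qed
  have P_test: "test_function (P S)" for S
  proof (rule test_functionI)
    have "(\<lambda>x. \<Prod>l\<in>UNIV. q S l (x $ l)) \<in> step_algebra R"
      by (intro step_algebra_prod q_alg) auto
    then show "smooth_function (P S)" unfolding P_def[abs_def] by (rule smooth)
    fix x assume "P S x \<noteq> 0"
    then have "q S l (x $ l) \<noteq> 0" for l by (auto simp: P_def)
    then show "norm x \<le> real CARD('n)" by (intro supp) (meson q_zero not_le)
  qed
  have X_test: "test_function (X S j)" for S j
  proof (rule test_functionI)
    have "(\<lambda>x. R (1 * x $ j)) \<in> step_algebra R" by (intro step_algebra.intros)
    then have "(\<lambda>x. (\<Prod>l\<in>UNIV - {j}. q S l (x $ l)) * (R (2 * x $ j) - R (x $ j))) \<in> step_algebra R"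
      by (intro step_algebra.mult step_algebra_prod q_alg step_algebra_diff step_algebra.step) auto
    then show "smooth_function (X S j)" unfolding X_def[abs_def] by (rule smooth)
    fix x assume "X S j x \<noteq> 0"
    then have "R (2 * x $ j) - R (x $ j) \<noteq> 0" "\<And>l. l \<noteq> j \<Longrightarrow> q S l (x $ l) \<noteq> 0" by (auto simp: X_def)
    then have "0 < x $ l \<and> x $ l < 1" for l
      using R_zero[of "x $ j"] q_zero[of "x $ l" S l] by (cases "l = j") force+
    then show "norm x \<le> real CARD('n)" by (rule supp)
  qed
  have X_deriv: "partial_deriv [j] (X S j) x = P (insert j S) x - P S x" if "j \<notin> S" for S j x
  proof (rule partial_deriv_eqI)
    show "X S j differentiable (at x)"
      by (rule smooth_differentiable[OF test_function_smooth[OF X_test]])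
    let ?h = "\<Prod>l\<in>UNIV - {j}. q S l (x $ l)"
    have line: "(\<lambda>t. X S j (x + t *\<^sub>R axis j 1)) = (\<lambda>t. ?h * (R (2 * (x $ j + t)) - R (x $ j + t)))"
      unfolding X_def by (auto simp: axis_def fun_eq_iff intro!: prod.cong)
    have "P T x = q T j (x $ j) * (\<Prod>l\<in>UNIV - {j}. q T l (x $ l))" for T
      unfolding P_def by (subst prod.remove[of UNIV j]) auto
    moreover have "(\<Prod>l\<in>UNIV - {j}. q (insert j S) l (x $ l)) = ?h"
      by (intro prod.cong) (auto simp: q_def)
    ultimately have *: "P (insert j S) x - P S x = ?h * (\<rho> (2 * (x $ j + 0)) * 2 - \<rho> (x $ j + 0) * 1)"
      using that by (simp add: q_def[of _ j] algebra_simps)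
    show "((\<lambda>t. X S j (x + t *\<^sub>R axis j 1)) has_real_derivative P (insert j S) x - P S x) (at 0)"
      unfolding line * by (intro DERIV_cmult DERIV_diff DERIV_chain2[OF R]) (auto intro!: derivative_eq_intros)
  qed
  have "\<exists>\<psi>. (\<forall>i. test_function (\<psi> i)) \<and> (\<forall>x. P S x - P {} x = (\<Sum>i\<in>S. partial_deriv [i] (\<psi> i) x))" for S
    using finite[of S]
  proof (induction S rule: finite_induct)
    case empty
    then show ?case using P_test by auto
  next
    case (insert j S)
    then obtain \<psi> where \<psi>: "\<And>i. test_function (\<psi> i)" "\<And>x. P S x - P {} x = (\<Sum>i\<in>S. partial_deriv [i] (\<psi> i) x)"
      by blast
    have "P (insert j S) x - P {} x = (\<Sum>i\<in>insert j S. partial_deriv [i] ((\<psi>(j := X S j)) i) x)" for x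
    proof -
      have "(\<Sum>i\<in>S. partial_deriv [i] ((\<psi>(j := X S j)) i) x) = P S x - P {} x"
        unfolding \<psi> by (intro sum.cong) (use insert.hyps in auto)
      then show ?thesis
        using insert.hyps X_deriv[OF insert.hyps(2), of x] by (simp del: partial_deriv.simps)
    qed
    then show ?case using \<psi>(1) X_test by (intro exI[of _ "\<psi>(j := X S j)"]) (auto simp del: partial_deriv.simps)
  qed
  then obtain \<psi> where \<psi>: "\<And>i. test_function (\<psi> i)" "\<And>x. P UNIV x - P {} x = (\<Sum>i\<in>UNIV. partial_deriv [i] (\<psi> i) x)"
    by blast
  moreover have "P UNIV x = 2 ^ CARD('n) * P {} (2 *\<^sub>R x)" for x
    by (simp add: P_def q_def prod.distrib)
  moreover have "0 \<le> P {} x" for x by (auto simp: P_def q_def \<rho>_nonneg intro!: prod_nonneg)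
  moreover have "0 < P {} (\<chi> i. 1/2)" using \<rho>_pos by (auto simp: P_def q_def intro!: prod_pos)
  ultimately show ?thesis using that[of "P {}" \<psi>] P_test by metis
qed

section \<open>Mollification\<close>

lemma nn_integral_affine:
  fixes f :: "'a::euclidean_space \<Rightarrow> ennreal"
  assumes [measurable]: "f \<in> borel_measurable borel" and "c \<noteq> 0"
  shows "(\<integral>\<^sup>+x. f x \<partial>lborel) = ennreal (\<bar>c\<bar> ^ DIM('a)) * (\<integral>\<^sup>+x. f (t + c *\<^sub>R x) \<partial>lborel)"
  by (subst lborel_affine[OF assms(2), of t])
    (simp add: nn_integral_density nn_integral_distr nn_integral_cmult)

lemma integral_affine:
  fixes f :: "'a::euclidean_space \<Rightarrow> real"
  assumes [measurable]: "f \<in> borel_measurable borel" and "c \<noteq> 0"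
  shows "(\<integral>x. f x \<partial>lborel) = \<bar>c\<bar> ^ DIM('a) * (\<integral>x. f (t + c *\<^sub>R x) \<partial>lborel)"
  by (subst lborel_affine[OF assms(2), of t])
    (simp add: integral_density integral_distr)

lemma measurable_ident_lebesgue: "(\<lambda>x. x) \<in> (lebesgue :: 'a::euclidean_space measure) \<rightarrow>\<^sub>M borel"
  by (rule measurable_completion) simp

lemma borel_measurable_imp_lebesgue: "f \<in> borel_measurable borel \<Longrightarrow> f \<in> borel_measurable (lebesgue :: 'a::euclidean_space measure)"
  by (rule measurable_completion) simp

definition dilate_kernel :: "real \<Rightarrow> (real ^ 'n \<Rightarrow> real) \<Rightarrow> real ^ 'n \<Rightarrow> real" where
  "dilate_kernel \<rho> K w = K (w /\<^sub>R \<rho>) / \<rho> ^ CARD('n)"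

text \<open>Convolution with the reflected kernel. In this form x enters as the translation of a
  test function of the integration variable, so the definition of a weak derivative applies to it
  directly.\<close>

definition correlate :: "(real ^ 'n \<Rightarrow> real) \<Rightarrow> (real ^ 'n \<Rightarrow> real) \<Rightarrow> real ^ 'n \<Rightarrow> real" where
  "correlate K v x = (\<integral>z. v z * K (z - x) \<partial>lebesgue)"

definition l1_norm :: "(real ^ 'n \<Rightarrow> real) \<Rightarrow> ennreal" where
  "l1_norm K = (\<integral>\<^sup>+x. ennreal \<bar>K x\<bar> \<partial>lborel)"

lemma dilate_kernel_measurable [measurable]:
  assumes [measurable]: "K \<in> borel_measurable borel"
  shows "dilate_kernel \<rho> K \<in> borel_measurable borel"
  unfolding dilate_kernel_def[abs_def] by measurable

lemma l1_norm_dilate_kernel: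
  fixes K :: "real ^ 'n \<Rightarrow> real"
  assumes [measurable]: "K \<in> borel_measurable borel" and "0 < \<rho>"
  shows "l1_norm (dilate_kernel \<rho> K) = l1_norm K"
proof -
  have "l1_norm (dilate_kernel \<rho> K) =
      ennreal (\<rho> ^ CARD('n)) * (\<integral>\<^sup>+x. ennreal \<bar>dilate_kernel \<rho> K (\<rho> *\<^sub>R x)\<bar> \<partial>lborel)"
    unfolding l1_norm_def using nn_integral_affine[of "\<lambda>x. ennreal \<bar>dilate_kernel \<rho> K x\<bar>" \<rho> 0] assms(2) by simp
  also have "\<dots> = (\<integral>\<^sup>+x. ennreal (\<rho> ^ CARD('n)) * ennreal \<bar>dilate_kernel \<rho> K (\<rho> *\<^sub>R x)\<bar> \<partial>lborel)"
    by (rule nn_integral_cmult[symmetric]) measurable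
  also have "\<dots> = l1_norm K"
    unfolding l1_norm_def using assms(2)
    by (intro nn_integral_cong) (simp add: dilate_kernel_def ennreal_mult[symmetric])
  finally show ?thesis .
qed

lemma nn_integral_kernel_shift:
  assumes [measurable]: "K \<in> borel_measurable borel"
  shows "(\<integral>\<^sup>+x. ennreal \<bar>K (z - x)\<bar> \<partial>lebesgue) = l1_norm K"
    and "(\<integral>\<^sup>+x. ennreal \<bar>K (x - z)\<bar> \<partial>lebesgue) = l1_norm K"
  using nn_integral_affine[of "\<lambda>x. ennreal \<bar>K x\<bar>" "-1" z] nn_integral_affine[of "\<lambda>x. ennreal \<bar>K x\<bar>" "1" "-z"]
  by (simp_all add: l1_norm_def nn_integral_completion)

lemma measurable_kernel_diff:
  fixes K :: "'a::euclidean_space \<Rightarrow> real"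
  assumes [measurable]: "K \<in> borel_measurable borel"
  shows "(\<lambda>p. K (snd p - fst p)) \<in> borel_measurable (lebesgue \<Otimes>\<^sub>M lebesgue)"
proof -
  have [measurable]: "fst \<in> borel_measurable (lebesgue \<Otimes>\<^sub>M lebesgue)" "snd \<in> borel_measurable (lebesgue \<Otimes>\<^sub>M lebesgue)"
    using measurable_compose[OF measurable_fst measurable_ident_lebesgue]
      measurable_compose[OF measurable_snd measurable_ident_lebesgue] by auto
  show ?thesis by measurable
qed

text \<open>Tonelli moves the kernel from \<open>v\<close> to the weight \<open>H\<close>. Where the
  product is not integrable, \<open>correlate\<close> has the default value 0 and the pointwise
  bound is trivial.\<close>

lemma nn_integral_correlate_le:
  fixes v K :: "real ^ 'n \<Rightarrow> real"
  assumes [measurable]: "v \<in> borel_measurable lebesgue" "K \<in> borel_measurable borel" "H \<in> borel_measurable lebesgue"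
  shows "(\<integral>\<^sup>+x. ennreal \<bar>correlate K v x\<bar> * H x \<partial>lebesgue) \<le>
    (\<integral>\<^sup>+z. ennreal \<bar>v z\<bar> * (\<integral>\<^sup>+x. ennreal \<bar>K (z - x)\<bar> * H x \<partial>lebesgue) \<partial>lebesgue)"
proof -
  interpret L: sigma_finite_measure "lebesgue :: (real ^ 'n) measure" by (rule sigma_finite_lebesgue)
  interpret P: pair_sigma_finite "lebesgue :: (real ^ 'n) measure" "lebesgue :: (real ^ 'n) measure" ..
  note measurable_kernel_diff[OF assms(2), measurable]
  have [measurable]: "(\<lambda>z. K (z - x)) \<in> borel_measurable lebesgue" "(\<lambda>x. K (z - x)) \<in> borel_measurable lebesgue" for x z
    by (auto intro!: borel_measurable_imp_lebesgue)
  have "ennreal \<bar>correlate K v x\<bar> \<le> (\<integral>\<^sup>+z. ennreal \<bar>v z * K (z - x)\<bar> \<partial>lebesgue)" for x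
  proof (cases "integrable lebesgue (\<lambda>z. v z * K (z - x))")
    case True
    from integral_norm_bound_ennreal[OF this] show ?thesis by (simp add: correlate_def)
  qed (simp add: correlate_def not_integrable_integral_eq)
  then have "(\<integral>\<^sup>+x. ennreal \<bar>correlate K v x\<bar> * H x \<partial>lebesgue) \<le>
    (\<integral>\<^sup>+x. (\<integral>\<^sup>+z. ennreal \<bar>v z * K (z - x)\<bar> \<partial>lebesgue) * H x \<partial>lebesgue)"
    by (intro nn_integral_mono mult_right_mono) auto
  also have "\<dots> = (\<integral>\<^sup>+x. (\<integral>\<^sup>+z. ennreal \<bar>v z\<bar> * ennreal \<bar>K (z - x)\<bar> * H x \<partial>lebesgue) \<partial>lebesgue)"
    by (intro nn_integral_cong) (simp add: nn_integral_multc abs_mult ennreal_mult)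
  also have "\<dots> = (\<integral>\<^sup>+z. (\<integral>\<^sup>+x. ennreal \<bar>v z\<bar> * ennreal \<bar>K (z - x)\<bar> * H x \<partial>lebesgue) \<partial>lebesgue)"
    by (rule P.Fubini'[symmetric]) (simp add: split_beta')
  also have "\<dots> = (\<integral>\<^sup>+z. ennreal \<bar>v z\<bar> * (\<integral>\<^sup>+x. ennreal \<bar>K (z - x)\<bar> * H x \<partial>lebesgue) \<partial>lebesgue)"
    by (intro nn_integral_cong) (simp add: nn_integral_cmult mult.assoc)
  finally show ?thesis .
qed

text \<open>Density of continuous functions in L^1, by induction on the construction of integrable
  functions. A measurable set lies between a closed and an open set with small differences, and a
  Urysohn function for the two replaces its indicator.\<close>

lemma integrable_approx_continuous:
  fixes f :: "'a::euclidean_space \<Rightarrow> real"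
  assumes "integrable lebesgue f" "0 < e"
  shows "\<exists>g. continuous_on UNIV g \<and> (\<integral>\<^sup>+x. ennreal \<bar>f x - g x\<bar> \<partial>lebesgue) < ennreal e"
  using assms
proof (induction arbitrary: e rule: integrable_induct)
  case (base A c)
  \<comment> \<open>The summand 1 avoids division by zero and makes the total error
    \<open>2 * \<bar>c\<bar> * ?d\<close> strictly smaller than \<open>e\<close>.\<close>
  let ?d = "e / (2 * (\<bar>c\<bar> + 1))"
  have d: "?d > 0" using base.prems by simp
  obtain T where T: "closed T" "T \<subseteq> A" "A - T \<in> lmeasurable" "emeasure lebesgue (A - T) < ennreal ?d"
    using sets_lebesgue_inner_closed[OF base.hyps(1) d] by blast
  obtain U where U: "open U" "A \<subseteq> U" "U - A \<in> lmeasurable" "emeasure lebesgue (U - A) < ennreal ?d"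
    using sets_lebesgue_outer_open[OF base.hyps(1) d] by blast
  have "T \<inter> - U = {}" using T U by auto
  then obtain g where g: "continuous_on UNIV g" "\<And>x. g x \<in> closed_segment c 0" "\<And>x. x \<in> T \<Longrightarrow> g x = c" "\<And>x. x \<in> -U \<Longrightarrow> g x = 0"
    using Urysohn[of T "-U" c 0] T(1) U(1) by (auto simp: closed_Compl)
  have sets: "A - T \<in> sets lebesgue" "U - A \<in> sets lebesgue" using T U by auto
  have "ennreal \<bar>indicator A x *\<^sub>R c - g x\<bar> \<le> ennreal \<bar>c\<bar> * (indicator (A - T) x + indicator (U - A) x)" for x
  proof -
    have "\<bar>g x\<bar> \<le> \<bar>c\<bar> \<and> \<bar>c - g x\<bar> \<le> \<bar>c\<bar>"
      using g(2)[of x] by (auto simp: closed_segment_eq_real_ivl split: if_splits)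
    then show ?thesis using g(3,4)[of x] T(2) U(2) by (auto simp: indicator_def intro!: ennreal_leI)
  qed
  then have "(\<integral>\<^sup>+x. ennreal \<bar>indicator A x *\<^sub>R c - g x\<bar> \<partial>lebesgue) \<le>
     (\<integral>\<^sup>+x. ennreal \<bar>c\<bar> * (indicator (A - T) x + indicator (U - A) x) \<partial>lebesgue)"
    by (rule nn_integral_mono)
  also have "\<dots> = ennreal \<bar>c\<bar> * (emeasure lebesgue (A - T) + emeasure lebesgue (U - A))"
    using sets by (simp add: nn_integral_cmult nn_integral_add)
  also have "\<dots> \<le> ennreal \<bar>c\<bar> * (ennreal ?d + ennreal ?d)"
    using T U by (intro mult_left_mono add_mono) auto
  also have "\<dots> = ennreal (\<bar>c\<bar> * (?d + ?d))"
    using d less_imp_le[OF d] by (simp only: ennreal_plus[symmetric] ennreal_mult[symmetric] abs_ge_zero add_nonneg_nonneg)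
  also have "?d + ?d = e / (\<bar>c\<bar> + 1)"
    by (simp add: divide_simps)
  also have "\<bar>c\<bar> * (e / (\<bar>c\<bar> + 1)) = e * (\<bar>c\<bar> / (\<bar>c\<bar> + 1))" by simp
  also have "\<dots> < ennreal e"
    using base.prems by (subst ennreal_less_iff) (auto simp: field_simps)
  finally show ?case using g(1) by blast
next
  case (add f f')
  obtain g where g: "continuous_on UNIV g" "(\<integral>\<^sup>+x. ennreal \<bar>f x - g x\<bar> \<partial>lebesgue) < ennreal (e / 2)"
    using add(3)[of "e/2"] add.prems by auto
  obtain g' where g': "continuous_on UNIV g'" "(\<integral>\<^sup>+x. ennreal \<bar>f' x - g' x\<bar> \<partial>lebesgue) < ennreal (e / 2)"
    using add(4)[of "e/2"] add.prems by auto
  have [measurable]: "g \<in> borel_measurable lebesgue" "g' \<in> borel_measurable lebesgue"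
    "f \<in> borel_measurable lebesgue" "f' \<in> borel_measurable lebesgue"
    using g(1) g'(1) add(1,2) by (auto intro!: borel_measurable_imp_lebesgue borel_measurable_continuous_onI)
  have "(\<integral>\<^sup>+x. ennreal \<bar>f x + f' x - (g x + g' x)\<bar> \<partial>lebesgue) \<le>
     (\<integral>\<^sup>+x. ennreal \<bar>f x - g x\<bar> + ennreal \<bar>f' x - g' x\<bar> \<partial>lebesgue)"
    by (intro nn_integral_mono) (auto simp: ennreal_plus[symmetric] simp del: ennreal_plus intro!: ennreal_leI)
  also have "\<dots> = (\<integral>\<^sup>+x. ennreal \<bar>f x - g x\<bar> \<partial>lebesgue) + (\<integral>\<^sup>+x. ennreal \<bar>f' x - g' x\<bar> \<partial>lebesgue)"
    by (rule nn_integral_add) measurable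
  also have "\<dots> < ennreal (e/2) + ennreal (e/2)"
    using g(2) g'(2) by (rule add_strict_mono)
  also have "\<dots> = ennreal e" using add.prems by (simp add: ennreal_plus[symmetric] del: ennreal_plus)
  finally show ?case using g(1) g'(1) by (intro exI[of _ "\<lambda>x. g x + g' x"]) (auto intro: continuous_intros)
next
  case (lim f s)
  have [measurable]: "s i \<in> borel_measurable lebesgue" "f \<in> borel_measurable lebesgue" for i
    using lim.hyps by auto
  have "(\<lambda>i. (\<integral>\<^sup>+x. norm (f x - s i x) \<partial>lebesgue)) \<longlonglongrightarrow> 0"
  \<comment> \<open>The induction principle supplies the domination of the approximants by twice the
    absolute value of \<open>f\<close>.\<close>
  proof (rule nn_integral_dominated_convergence_norm[where w = "\<lambda>x. 2 * norm (f x)"])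
    have "integrable lebesgue (\<lambda>x. 2 * norm (f x))" using lim.hyps by auto
    then show "(\<integral>\<^sup>+x. ennreal (2 * norm (f x)) \<partial>lebesgue) < \<infinity>"
      unfolding integrable_iff_bounded by (simp only: abs_mult abs_numeral real_norm_def abs_abs)
  qed (use lim.hyps in auto)
  then have "\<forall>\<^sub>F i in sequentially. (\<integral>\<^sup>+x. norm (f x - s i x) \<partial>lebesgue) < ennreal (e/2)"
    by (rule order_tendstoD) (use lim.prems in auto)
  then obtain i where i: "(\<integral>\<^sup>+x. norm (f x - s i x) \<partial>lebesgue) < ennreal (e/2)"
    using eventually_happens' trivial_limit_sequentially by blast
  obtain g where g: "continuous_on UNIV g" "(\<integral>\<^sup>+x. ennreal \<bar>s i x - g x\<bar> \<partial>lebesgue) < ennreal (e / 2)"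
    using lim.IH[of "e/2" i] lim.prems by auto
  have [measurable]: "g \<in> borel_measurable lebesgue"
    using g(1) by (auto intro!: borel_measurable_imp_lebesgue borel_measurable_continuous_onI)
  have "(\<integral>\<^sup>+x. ennreal \<bar>f x - g x\<bar> \<partial>lebesgue) \<le>
     (\<integral>\<^sup>+x. ennreal (norm (f x - s i x)) + ennreal \<bar>s i x - g x\<bar> \<partial>lebesgue)"
    by (intro nn_integral_mono) (auto simp: ennreal_plus[symmetric] simp del: ennreal_plus intro!: ennreal_leI)
  also have "\<dots> = (\<integral>\<^sup>+x. norm (f x - s i x) \<partial>lebesgue) + (\<integral>\<^sup>+x. ennreal \<bar>s i x - g x\<bar> \<partial>lebesgue)"
    by (rule nn_integral_add) measurable
  also have "\<dots> < ennreal (e/2) + ennreal (e/2)"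
    using i g(2) by (rule add_strict_mono)
  also have "\<dots> = ennreal e" using lim.prems by (simp add: ennreal_plus[symmetric] del: ennreal_plus)
  finally show ?case using g(1) by blast
qed


section \<open>Mollification of locally integrable functions\<close>

lemma locally_integrable_measurable:
  fixes v :: "real ^ 'n \<Rightarrow> real"
  assumes "locally_integrable v" shows "v \<in> borel_measurable lebesgue"
proof (rule borel_measurable_LIMSEQ_metric)
  show "(\<lambda>x. indicator (cball 0 (real n)) x *\<^sub>R v x) \<in> borel_measurable lebesgue" for n
    using assms unfolding locally_integrable_def set_integrable_def by (auto dest: spec[of _ "cball 0 (real n)"])
  show "(\<lambda>n. indicator (cball 0 (real n)) x *\<^sub>R v x) \<longlonglongrightarrow> v x" for x
  proof (rule tendsto_eventually)
    have "\<forall>\<^sub>F n in sequentially. norm x \<le> real n"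
      using real_arch_simple[of "norm x"] by (meson eventually_sequentiallyI of_nat_le_iff order_trans)
    then show "\<forall>\<^sub>F n in sequentially. indicator (cball 0 (real n)) x *\<^sub>R v x = v x"
      by eventually_elim auto
  qed
qed

lemma locally_integrable_mult:
  fixes v :: "real ^ 'n \<Rightarrow> real"
  assumes "locally_integrable v" "K \<in> borel_measurable borel"
    "\<And>x. \<bar>K x\<bar> \<le> b" "\<And>x. r < norm x \<Longrightarrow> K x = 0"
  shows "integrable lebesgue (\<lambda>z. v z * K z)"
proof -
  have i: "integrable lebesgue (\<lambda>x. indicator (cball 0 r) x *\<^sub>R v x)"
    using assms(1) unfolding locally_integrable_def set_integrable_def by auto
  show ?thesis
  proof (rule Bochner_Integration.integrable_bound)
    show "integrable lebesgue (\<lambda>x. b *\<^sub>R (indicator (cball 0 r) x *\<^sub>R v x))" using i by simp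
    show "(\<lambda>z. v z * K z) \<in> borel_measurable lebesgue"
      using locally_integrable_measurable[OF assms(1)] borel_measurable_imp_lebesgue[OF assms(2)] by measurable
    show "AE x in lebesgue. norm (v x * K x) \<le> norm (b *\<^sub>R (indicator (cball 0 r) x *\<^sub>R v x))"
    proof (rule AE_I2)
      fix x
      have "b \<ge> 0" using assms(3)[of x] by linarith
      then show "norm (v x * K x) \<le> norm (b *\<^sub>R (indicator (cball 0 r) x *\<^sub>R v x))"
        using assms(3)[of x] assms(4)[of x]
        by (cases "norm x \<le> r") (auto simp: abs_mult mult.commute[of "\<bar>v x\<bar>"] intro!: mult_right_mono)
    qed
  qed
qed

lemma locally_integrable_mult_test:
  fixes v :: "real ^ 'n \<Rightarrow> real"
  assumes "locally_integrable v" "test_function \<phi>"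
  shows "integrable lebesgue (\<lambda>z. v z * \<phi> z)"
proof -
  obtain b r where "\<And>x. \<bar>\<phi> x\<bar> \<le> b" "\<And>x. r < norm x \<Longrightarrow> \<phi> x = 0"
    using test_function_bounded[OF assms(2)] test_function_support[OF assms(2)] by metis
  then show ?thesis
    using locally_integrable_mult[OF assms(1) smooth_measurable[OF test_function_smooth[OF assms(2)]]] by blast
qed

lemma continuous_locally_integrable:
  fixes g :: "real ^ 'n \<Rightarrow> real"
  assumes "continuous_on UNIV g" shows "locally_integrable g"
  unfolding locally_integrable_def
proof (intro allI impI)
  fix K :: "(real ^ 'n) set" assume K: "compact K"
  have "integrable lborel (\<lambda>x. indicator K x *\<^sub>R g x)"
    using K assms by (intro borel_integrable_compact continuous_on_subset[OF assms]) auto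
  then show "set_integrable lebesgue K g"
    unfolding set_integrable_def
    using integrable_completion[of "\<lambda>x. indicator K x *\<^sub>R g x" lborel] borel_measurable_integrable by blast
qed

lemma test_function_kernel:
  fixes \<phi> :: "real ^ 'n \<Rightarrow> real"
  assumes "test_function \<phi>" "0 < \<rho>"
  shows "test_function (\<lambda>z. dilate_kernel \<rho> \<phi> (z - x))"
    and "partial_deriv is (\<lambda>z. dilate_kernel \<rho> \<phi> (z - x)) =
      (\<lambda>z. dilate_kernel \<rho> (partial_deriv is \<phi>) (z - x) / \<rho> ^ length is)"
proof -
  let ?f = "\<lambda>z. \<phi> (- (x /\<^sub>R \<rho>) + inverse \<rho> *\<^sub>R z)"
  have eq: "(\<lambda>z. dilate_kernel \<rho> \<phi> (z - x)) = (\<lambda>z. inverse (\<rho> ^ CARD('n)) * ?f z)"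
    by (auto simp: dilate_kernel_def fun_eq_iff algebra_simps divide_inverse)
  have t: "test_function ?f"
    using assms by (intro test_function_affine) auto
  show "test_function (\<lambda>z. dilate_kernel \<rho> \<phi> (z - x))"
    unfolding eq by (rule test_function_cmult(1)[OF t])
  show "partial_deriv is (\<lambda>z. dilate_kernel \<rho> \<phi> (z - x)) =
      (\<lambda>z. dilate_kernel \<rho> (partial_deriv is \<phi>) (z - x) / \<rho> ^ length is)"
    unfolding eq test_function_cmult(2)[OF t] smooth_affine(1)[OF test_function_smooth[OF assms(1)]]
    by (auto simp: dilate_kernel_def fun_eq_iff algebra_simps divide_inverse power_inverse)
qed

lemma integral_kernel:
  fixes \<phi> :: "real ^ 'n \<Rightarrow> real"
  assumes "\<phi> \<in> borel_measurable borel" "0 < \<rho>"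
  shows "(\<integral>z. dilate_kernel \<rho> \<phi> (z - x) \<partial>lebesgue) = (\<integral>z. \<phi> z \<partial>lborel)"
proof -
  note assms(1)[measurable]
  have "(\<integral>z. dilate_kernel \<rho> \<phi> (z - x) \<partial>lebesgue) = (\<integral>z. dilate_kernel \<rho> \<phi> (z - x) \<partial>lborel)"
    by (rule integral_completion) measurable
  also have "\<dots> = \<bar>\<rho>\<bar> ^ DIM(real ^ 'n) * (\<integral>z. dilate_kernel \<rho> \<phi> (x + \<rho> *\<^sub>R z - x) \<partial>lborel)"
    by (rule integral_affine) (use assms(2) in auto)
  also have "\<dots> = (\<integral>z. \<phi> z \<partial>lborel)"
    using assms(2) by (simp add: dilate_kernel_def)
  finally show ?thesis .
qed

lemma l1_norm_test_function: "test_function \<phi> \<Longrightarrow> l1_norm \<phi> < \<infinity>"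
  using test_function_integrable[of \<phi>] by (simp add: l1_norm_def integrable_iff_bounded)

lemma correlate_measurable:
  fixes v K :: "real ^ 'n \<Rightarrow> real"
  assumes [measurable]: "v \<in> borel_measurable lebesgue" "K \<in> borel_measurable borel"
  shows "correlate K v \<in> borel_measurable lebesgue"
proof -
  interpret L: sigma_finite_measure "lebesgue :: (real ^ 'n) measure" by (rule sigma_finite_lebesgue)
  note measurable_kernel_diff[OF assms(2), measurable]
  have "(\<lambda>(x, z). v z * K (z - x)) \<in> borel_measurable (lebesgue \<Otimes>\<^sub>M lebesgue)"
    unfolding split_beta' by measurable
  then have "(\<lambda>x. \<integral>z. v z * K (z - x) \<partial>lebesgue) \<in> borel_measurable lebesgue"
    by (rule L.borel_measurable_lebesgue_integral)
  then show ?thesis unfolding correlate_def[abs_def] .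
qed

text \<open>The kernel is not normalised, so its integral appears as a factor of \<open>g x\<close>.
  The difference is an average of \<open>g x - g z\<close> over z near x, controlled by uniform
  continuity on a slightly larger ball.\<close>

lemma mollify_continuous_close:
  fixes g :: "real ^ 'n \<Rightarrow> real"
  assumes \<phi>: "test_function \<phi>" and g: "continuous_on UNIV g" and "0 < e"
  shows "\<exists>d>0. \<forall>\<rho>. 0 < \<rho> \<and> \<rho> < d \<longrightarrow> (\<forall>x. norm x \<le> R \<longrightarrow>
    \<bar>(\<integral>z. \<phi> z \<partial>lborel) * g x - correlate (dilate_kernel \<rho> \<phi>) g x\<bar> \<le> e)"
proof -
  obtain r where r: "r > 0" "\<And>x. norm x > r \<Longrightarrow> \<phi> x = 0" using test_function_support[OF \<phi>] by blast
  define a where "a = (\<integral>x. \<bar>\<phi> x\<bar> \<partial>lborel)"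
  have a: "a \<ge> 0" unfolding a_def by simp
  have meas[measurable]: "\<phi> \<in> borel_measurable borel" by (rule smooth_measurable[OF test_function_smooth[OF \<phi>]])
  have "uniformly_continuous_on (cball 0 (R + r)) g"
    by (intro compact_uniformly_continuous continuous_on_subset[OF g]) auto
  then obtain d where d: "d > 0" "\<And>x y. x \<in> cball 0 (R + r) \<Longrightarrow> y \<in> cball 0 (R + r) \<Longrightarrow> dist y x < d \<Longrightarrow> dist (g y) (g x) < e / (a + 1)"
    unfolding uniformly_continuous_on_def using \<open>0 < e\<close> a by (metis add_nonneg_pos divide_pos_pos zero_less_one)
  show ?thesis
  \<comment> \<open>The bound 1 keeps the points z of the rescaled support inside the ball of radius
    \<open>R + r\<close>; the bound \<open>d / r\<close> makes their distance to x smaller than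
    \<open>d\<close>.\<close>
  proof (intro exI[of _ "min 1 (d / r)"] conjI allI impI)
    show "0 < min 1 (d / r)" using d r by simp
    fix \<rho> and x :: "real ^ 'n" assume \<rho>: "0 < \<rho> \<and> \<rho> < min 1 (d / r)" and x: "norm x \<le> R"
    let ?K = "\<lambda>z :: real ^ 'n. dilate_kernel \<rho> \<phi> (z - x)"
    have K: "test_function ?K" using test_function_kernel[OF \<phi>] \<rho> by blast
    have iK: "integrable lebesgue ?K"
      using test_function_integrable[OF K] by (subst integrable_completion) auto
    have ig: "integrable lebesgue (\<lambda>z. g z * ?K z)"
      by (rule locally_integrable_mult_test[OF continuous_locally_integrable[OF g] K])
    have "(\<integral>z. \<phi> z \<partial>lborel) * g x - correlate (dilate_kernel \<rho> \<phi>) g x = (\<integral>z. g x * ?K z - g z * ?K z \<partial>lebesgue)"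
      unfolding correlate_def using iK ig \<rho> by (subst Bochner_Integration.integral_diff) (auto simp: integral_kernel)
    also have "\<bar>\<dots>\<bar> \<le> (\<integral>z. \<bar>g x * ?K z - g z * ?K z\<bar> \<partial>lebesgue)"
      by (rule integral_abs_bound)
    also have "\<dots> \<le> (\<integral>z. e / (a + 1) * \<bar>?K z\<bar> \<partial>lebesgue)"
    proof (rule integral_mono)
      show "integrable lebesgue (\<lambda>z. \<bar>g x * ?K z - g z * ?K z\<bar>)" using iK ig by auto
      show "integrable lebesgue (\<lambda>z. e / (a + 1) * \<bar>?K z\<bar>)" using iK by auto
      fix z
      show "\<bar>g x * ?K z - g z * ?K z\<bar> \<le> e / (a + 1) * \<bar>?K z\<bar>"
      proof (cases "norm (z - x) \<le> \<rho> * r")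
        case True
        then have 1: "norm (z - x) < d" using \<rho> r by (simp add: field_simps)
        have "\<rho> * r \<le> r" using \<rho> r by simp
        then have "norm (z - x) \<le> r" using True by linarith
        then have "norm z \<le> R + r" using x norm_triangle_sub[of z x] by linarith
        then have "dist (g z) (g x) < e / (a + 1)"
          using x r 1 by (intro d) (auto simp: dist_norm)
        then have "\<bar>g x - g z\<bar> \<le> e / (a + 1)" by (simp add: dist_real_def)
        then show ?thesis
          by (simp add: left_diff_distrib[symmetric] abs_mult mult_right_mono del: times_divide_eq_left)
      next
        case False
        then have "r < norm (z - x) / \<rho>" using \<rho> by (simp add: pos_less_divide_eq mult.commute)
        then have "norm ((z - x) /\<^sub>R \<rho>) > r" using \<rho> by (simp add: divide_inverse mult.commute)
        then have "?K z = 0" unfolding dilate_kernel_def using r(2) by simp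
        then show ?thesis by simp
      qed
    qed
    also have "\<dots> = e / (a + 1) * a"
    proof -
      have "(\<lambda>z. \<bar>?K z\<bar>) = (\<lambda>z. dilate_kernel \<rho> (\<lambda>x. \<bar>\<phi> x\<bar>) (z - x))"
        using \<rho> by (auto simp: dilate_kernel_def)
      then have "(\<integral>z. \<bar>?K z\<bar> \<partial>lebesgue) = (\<integral>z. dilate_kernel \<rho> (\<lambda>x. \<bar>\<phi> x\<bar>) (z - x) \<partial>lebesgue)"
        by (simp only:)
      also have "\<dots> = a" unfolding a_def by (rule integral_kernel) (use \<rho> in auto)
      finally show ?thesis by simp
    qed
    also have "\<dots> \<le> e" using a \<open>0 < e\<close> by (simp add: field_simps)
    finally show "\<bar>(\<integral>z. \<phi> z \<partial>lborel) * g x - correlate (dilate_kernel \<rho> \<phi>) g x\<bar> \<le> e" .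
  qed
qed

lemma mollify_integrable_close:
  fixes f :: "real ^ 'n \<Rightarrow> real"
  assumes \<phi>: "test_function \<phi>" and f: "integrable lebesgue f" and "0 < e" "0 < R"
  shows "\<exists>d>0. \<forall>\<rho>. 0 < \<rho> \<and> \<rho> < d \<longrightarrow>
    (\<integral>\<^sup>+x\<in>cball 0 R. ennreal \<bar>(\<integral>z. \<phi> z \<partial>lborel) * f x - correlate (dilate_kernel \<rho> \<phi>) f x\<bar> \<partial>lebesgue) \<le> ennreal e"
proof -
  define c where "c = (\<integral>z. \<phi> z \<partial>lborel)"
  define a where "a = enn2real (l1_norm \<phi>)"
  have a: "a \<ge> 0" "l1_norm \<phi> = ennreal a" using l1_norm_test_function[OF \<phi>] by (auto simp: a_def less_top)
  define m where "m = measure lebesgue (cball (0::real ^ 'n) R)"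
  have m: "emeasure lebesgue (cball (0::real ^ 'n) R) = ennreal m" "m \<ge> 0"
    unfolding m_def by (auto simp: emeasure_eq_measure2 lmeasurable_cball)
  have meas[measurable]: "\<phi> \<in> borel_measurable borel" by (rule smooth_measurable[OF test_function_smooth[OF \<phi>]])
  \<comment> \<open>\<open>e1\<close> pays for replacing \<open>f\<close> by \<open>g\<close> twice,
    once in \<open>c * f\<close> and once under the mollification, which costs the L^1 norm
    \<open>a\<close> of the kernel. \<open>e2\<close> is a uniform error on the ball, so it is paid
    once per unit of the measure \<open>m\<close>.\<close>
  define e1 where "e1 = e / (2 * (\<bar>c\<bar> + a + 1))"
  define e2 where "e2 = e / (2 * (m + 1))"
  have e1: "e1 > 0" and e2: "e2 > 0" using a m \<open>0 < e\<close> by (auto simp: e1_def e2_def intro!: divide_pos_pos)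
  obtain g where g: "continuous_on UNIV g" "(\<integral>\<^sup>+x. ennreal \<bar>f x - g x\<bar> \<partial>lebesgue) < ennreal e1"
    using integrable_approx_continuous[OF f e1] by blast
  have f_m [measurable]: "f \<in> borel_measurable lebesgue" using f by auto
  have g_m [measurable]: "g \<in> borel_measurable lebesgue"
    using g(1) by (auto intro!: borel_measurable_imp_lebesgue borel_measurable_continuous_onI)
  obtain d where d: "d > 0" "\<And>\<rho> x. 0 < \<rho> \<Longrightarrow> \<rho> < d \<Longrightarrow> norm x \<le> R \<Longrightarrow>
    \<bar>c * g x - correlate (dilate_kernel \<rho> \<phi>) g x\<bar> \<le> e2"
    using mollify_continuous_close[OF \<phi> g(1) e2, of R] unfolding c_def by blast
  have "(\<integral>\<^sup>+x\<in>cball 0 R. ennreal \<bar>c * f x - correlate (dilate_kernel \<rho> \<phi>) f x\<bar> \<partial>lebesgue) \<le> ennreal e"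
    if \<rho>: "0 < \<rho>" "\<rho> < d" for \<rho>
  proof -
    let ?K = "dilate_kernel \<rho> \<phi>" and ?w = "\<lambda>x. f x - g x"
    have K: "test_function (\<lambda>z. ?K (z - x))" for x using test_function_kernel[OF \<phi> \<rho>(1)] by blast
    have "locally_integrable f"
      unfolding locally_integrable_def set_integrable_def
      using f by (auto intro!: integrable_mult_indicator sets_completionI_sets compact_imp_closed borel_closed simp del: scaleR_conv_of_real real_scaleR_def)
    then have corr: "correlate ?K ?w x = correlate ?K f x - correlate ?K g x" for x
      unfolding correlate_def left_diff_distrib
      by (intro Bochner_Integration.integral_diff locally_integrable_mult_test[OF _ K] continuous_locally_integrable[OF g(1)])
    have bound: "ennreal \<bar>c * f x - correlate ?K f x\<bar> * indicator (cball 0 R) x \<le>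
        ennreal \<bar>c\<bar> * ennreal \<bar>?w x\<bar> + ennreal \<bar>correlate ?K ?w x\<bar> * 1 + ennreal e2 * indicator (cball 0 R) x" for x
    proof (cases "norm x \<le> R")
      case True
      have "\<bar>c * f x - correlate ?K f x\<bar> \<le> \<bar>c * ?w x\<bar> + \<bar>correlate ?K ?w x\<bar> + \<bar>c * g x - correlate ?K g x\<bar>"
        unfolding corr by (simp add: algebra_simps)
      also have "\<dots> \<le> \<bar>c\<bar> * \<bar>?w x\<bar> + \<bar>correlate ?K ?w x\<bar> + e2"
        using d(2)[OF \<rho> True] by (simp add: abs_mult)
      finally show ?thesis using True e2
        by (simp add: ennreal_plus[symmetric] ennreal_mult[symmetric] ennreal_leI del: ennreal_plus)
    qed simp
    have [measurable]: "correlate ?K ?w \<in> borel_measurable lebesgue" "cball (0::real^'n) R \<in> sets lebesgue"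
      by (auto intro!: correlate_measurable)
    have w: "(\<integral>\<^sup>+x. ennreal \<bar>?w x\<bar> \<partial>lebesgue) \<le> ennreal e1" using g(2) by simp
    have "(\<integral>\<^sup>+x. ennreal \<bar>correlate ?K ?w x\<bar> * 1 \<partial>lebesgue) \<le>
      (\<integral>\<^sup>+z. ennreal \<bar>?w z\<bar> * (\<integral>\<^sup>+x. ennreal \<bar>?K (z - x)\<bar> * 1 \<partial>lebesgue) \<partial>lebesgue)"
      by (rule nn_integral_correlate_le) measurable
    also have "\<dots> = (\<integral>\<^sup>+z. ennreal \<bar>?w z\<bar> \<partial>lebesgue) * ennreal a"
      using \<rho> by (simp add: nn_integral_kernel_shift l1_norm_dilate_kernel a nn_integral_multc)
    also have "\<dots> \<le> ennreal e1 * ennreal a"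
      by (intro mult_right_mono w) simp
    finally have 2: "(\<integral>\<^sup>+x. ennreal \<bar>correlate ?K ?w x\<bar> * 1 \<partial>lebesgue) \<le> ennreal (e1 * a)"
      using e1 a by (simp add: ennreal_mult)
    have "(\<integral>\<^sup>+x\<in>cball 0 R. ennreal \<bar>c * f x - correlate ?K f x\<bar> \<partial>lebesgue) \<le>
      (\<integral>\<^sup>+x. ennreal \<bar>c\<bar> * ennreal \<bar>?w x\<bar> + ennreal \<bar>correlate ?K ?w x\<bar> * 1 + ennreal e2 * indicator (cball 0 R) x \<partial>lebesgue)"
      by (intro nn_integral_mono bound)
    also have "\<dots> = ennreal \<bar>c\<bar> * (\<integral>\<^sup>+x. ennreal \<bar>?w x\<bar> \<partial>lebesgue) + (\<integral>\<^sup>+x. ennreal \<bar>correlate ?K ?w x\<bar> * 1 \<partial>lebesgue)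
       + ennreal e2 * ennreal m"
      by (simp add: nn_integral_add nn_integral_cmult m(1)[symmetric])
    also have "\<dots> \<le> ennreal \<bar>c\<bar> * ennreal e1 + ennreal (e1 * a) + ennreal e2 * ennreal m"
      by (intro add_mono mult_left_mono w 2) auto
    also have "\<dots> = ennreal (e1 * (\<bar>c\<bar> + a) + e2 * m)"
      using e1 e2 a m(2) by (simp add: ennreal_plus[symmetric] ennreal_mult[symmetric] algebra_simps del: ennreal_plus)
    also have "\<dots> \<le> ennreal e"
    proof (rule ennreal_leI)
      have "e1 * (\<bar>c\<bar> + a) \<le> e / 2" "e2 * m \<le> e / 2"
        using a m(2) \<open>0 < e\<close> by (auto simp: e1_def e2_def field_simps)
      then show "e1 * (\<bar>c\<bar> + a) + e2 * m \<le> e" by simp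
    qed
    finally show ?thesis .
  qed
  then show ?thesis using d(1) unfolding c_def by blast
qed

text \<open>For scales below 1 the mollification on the ball of radius \<open>R\<close> sees
  \<open>v\<close> only on the ball of radius \<open>R + r\<close>, so \<open>v\<close> may be cut
  off there and becomes integrable.\<close>

lemma mollify_locally_integrable_close:
  fixes v :: "real ^ 'n \<Rightarrow> real"
  assumes \<phi>: "test_function \<phi>" and v: "locally_integrable v" and "0 < e" "0 < R"
  shows "\<exists>d>0. \<forall>\<rho>. 0 < \<rho> \<and> \<rho> < d \<longrightarrow>
    (\<integral>\<^sup>+x\<in>cball 0 R. ennreal \<bar>(\<integral>z. \<phi> z \<partial>lborel) * v x - correlate (dilate_kernel \<rho> \<phi>) v x\<bar> \<partial>lebesgue) \<le> ennreal e"
proof -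
  obtain r where r: "r > 0" "\<And>x. norm x > r \<Longrightarrow> \<phi> x = 0" using test_function_support[OF \<phi>] by blast
  define f where "f x = indicator (cball 0 (R + r)) x *\<^sub>R v x" for x
  have f: "integrable lebesgue f"
    using v unfolding locally_integrable_def set_integrable_def f_def[abs_def] by auto
  obtain d where d: "d > 0" "\<And>\<rho>. 0 < \<rho> \<Longrightarrow> \<rho> < d \<Longrightarrow>
    (\<integral>\<^sup>+x\<in>cball 0 R. ennreal \<bar>(\<integral>z. \<phi> z \<partial>lborel) * f x - correlate (dilate_kernel \<rho> \<phi>) f x\<bar> \<partial>lebesgue) \<le> ennreal e"
    using mollify_integrable_close[OF \<phi> f assms(3,4)] by blast
  have eq: "(\<integral>\<^sup>+x\<in>cball 0 R. ennreal \<bar>(\<integral>z. \<phi> z \<partial>lborel) * v x - correlate (dilate_kernel \<rho> \<phi>) v x\<bar> \<partial>lebesgue)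
      = (\<integral>\<^sup>+x\<in>cball 0 R. ennreal \<bar>(\<integral>z. \<phi> z \<partial>lborel) * f x - correlate (dilate_kernel \<rho> \<phi>) f x\<bar> \<partial>lebesgue)"
    if \<rho>: "0 < \<rho>" "\<rho> < 1" for \<rho>
  proof (rule nn_integral_cong)
    fix x
    show "ennreal \<bar>(\<integral>z. \<phi> z \<partial>lborel) * v x - correlate (dilate_kernel \<rho> \<phi>) v x\<bar> * indicator (cball 0 R) x =
      ennreal \<bar>(\<integral>z. \<phi> z \<partial>lborel) * f x - correlate (dilate_kernel \<rho> \<phi>) f x\<bar> * indicator (cball 0 R) x"
    proof (cases "norm x \<le> R")
      case True
      have "v z * dilate_kernel \<rho> \<phi> (z - x) = f z * dilate_kernel \<rho> \<phi> (z - x)" for z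
      proof (cases "norm z \<le> R + r")
        case False
        then have "norm (z - x) > r" using True norm_triangle_sub[of z x] by linarith
        moreover have "\<rho> * r \<le> r" using \<rho> r by simp
        ultimately have "r < norm (z - x) / \<rho>" using \<rho> by (simp add: pos_less_divide_eq mult.commute)
        then have "norm ((z - x) /\<^sub>R \<rho>) > r" using \<rho> by (simp add: divide_inverse mult.commute)
        then have "dilate_kernel \<rho> \<phi> (z - x) = 0" unfolding dilate_kernel_def using r(2) by simp
        then show ?thesis by simp
      qed (simp add: f_def)
      then have "correlate (dilate_kernel \<rho> \<phi>) v x = correlate (dilate_kernel \<rho> \<phi>) f x"
        unfolding correlate_def by (intro Bochner_Integration.integral_cong) auto
      moreover have "v x = f x" using True r(1) by (simp add: f_def)
      ultimately show ?thesis by simp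
    qed simp
  qed
  show ?thesis
    using d eq by (intro exI[of _ "min d 1"]) auto
qed

section \<open>Weak derivatives\<close>

lemma integral_pos_kernel:
  fixes \<phi> :: "real ^ 'n \<Rightarrow> real"
  assumes "test_function \<phi>" "\<And>x. 0 \<le> \<phi> x" "\<exists>x. 0 < \<phi> x"
  shows "0 < (\<integral>x. \<phi> x \<partial>lborel)"
proof (rule ccontr)
  assume "\<not> ?thesis"
  moreover have "0 \<le> (\<integral>x. \<phi> x \<partial>lborel)" by (simp add: assms(2) integral_nonneg_AE)
  ultimately have "(\<integral>x. \<phi> x \<partial>lborel) = 0" by simp
  then have "AE x in lborel. \<phi> x = 0"
    using integral_nonneg_eq_0_iff_AE[OF test_function_integrable[OF assms(1)]] assms(2) by simp
  then have "AE x in lebesgue. x \<notin> {x. 0 < \<phi> x}"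
    by (intro AE_completion) auto
  moreover have op: "open {x. 0 < \<phi> x}"
    by (intro open_Collect_less smooth_continuous test_function_smooth assms continuous_intros)
  then have "{x. 0 < \<phi> x} \<in> sets lebesgue"
    by (intro sets_completionI_sets) simp
  ultimately have "negligible {x. 0 < \<phi> x}"
    by (simp add: negligible_iff_null_sets AE_iff_null_sets)
  then show False using op assms(3) open_not_negligible by blast
qed

text \<open>The fundamental lemma of the calculus of variations. All mollifications of
  \<open>v\<close> are integrals against test functions and hence vanish, yet they approximate a
  positive multiple of \<open>v\<close> in L^1 on balls.\<close>

lemma AE_eq_0_of_test_integrals:
  fixes v :: "real ^ 'n \<Rightarrow> real"
  assumes v: "locally_integrable v" and z: "\<And>\<phi>. test_function \<phi> \<Longrightarrow> (\<integral>x. v x * \<phi> x \<partial>lebesgue) = 0"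
  shows "AE x in lebesgue. v x = 0"
proof -
  obtain \<phi> :: "real ^ 'n \<Rightarrow> real" where \<phi>: "test_function \<phi>" "\<And>x. 0 \<le> \<phi> x" "\<exists>x. 0 < \<phi> x"
    using smoothing_kernel_exists by metis
  define c where "c = (\<integral>x. \<phi> x \<partial>lborel)"
  have c: "c > 0" unfolding c_def by (rule integral_pos_kernel[OF \<phi>])
  have [measurable]: "v \<in> borel_measurable lebesgue" by (rule locally_integrable_measurable[OF v])
  have "AE x in lebesgue. norm x \<le> R \<longrightarrow> v x = 0" if R: "R > 0" for R
  proof -
    have [measurable]: "cball (0::real^'n) R \<in> sets lebesgue" by auto
    have "(\<integral>\<^sup>+x\<in>cball 0 R. ennreal \<bar>c * v x\<bar> \<partial>lebesgue) \<le> 0 + ennreal e" if e: "e > 0" for e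
    proof -
      obtain d where d: "d > 0" "\<forall>\<rho>. 0 < \<rho> \<and> \<rho> < d \<longrightarrow>
        (\<integral>\<^sup>+x\<in>cball 0 R. ennreal \<bar>c * v x - correlate (dilate_kernel \<rho> \<phi>) v x\<bar> \<partial>lebesgue) \<le> ennreal e"
        using mollify_locally_integrable_close[OF \<phi>(1) v e R] unfolding c_def by blast
      have "0 < d / 2" "d / 2 < d" using d by auto
      moreover have "correlate (dilate_kernel (d / 2) \<phi>) v x = 0" for x
        unfolding correlate_def using test_function_kernel(1)[OF \<phi>(1)] d by (intro z) auto
      ultimately show ?thesis using d(2)[rule_format, of "d / 2"] by simp
    qed
    then have "(\<integral>\<^sup>+x\<in>cball 0 R. ennreal \<bar>c * v x\<bar> \<partial>lebesgue) \<le> 0" by (rule ennreal_le_epsilon)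
    then have "AE x in lebesgue. ennreal \<bar>c * v x\<bar> * indicator (cball 0 R) x = 0"
      by (subst (asm) le_zero_eq, subst (asm) nn_integral_0_iff_AE) auto
    then show ?thesis by eventually_elim (use c in \<open>auto simp: indicator_def\<close>)
  qed
  then have "AE x in lebesgue. \<forall>n. norm x \<le> real (Suc n) \<longrightarrow> v x = 0"
    unfolding AE_all_countable by auto
  then show ?thesis
  proof eventually_elim
    case (elim x)
    obtain n where "norm x \<le> real n" using real_arch_simple by blast
    then show ?case using elim[rule_format, of n] by simp
  qed
qed

text \<open>Serves to tame \<open>weak_partial\<close>, which is an arbitrary choice: it can be
  identified almost everywhere with an explicitly known derivative.\<close>

lemma has_weak_partial_unique:
  assumes "has_weak_partial u is v" "has_weak_partial u is w"
  shows "AE x in lebesgue. v x = w x"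
proof -
  have v: "locally_integrable v" and w: "locally_integrable w"
    using assms by (auto simp: has_weak_partial_def)
  have "locally_integrable (\<lambda>x. v x - w x)"
    unfolding locally_integrable_def
  proof (intro allI impI)
    fix K :: "(real ^ 'a) set" assume "compact K"
    then show "set_integrable lebesgue K (\<lambda>x. v x - w x)"
      using v w unfolding locally_integrable_def by (intro set_integral_diff) auto
  qed
  moreover have "(\<integral>x. (v x - w x) * \<phi> x \<partial>lebesgue) = 0" if \<phi>: "test_function \<phi>" for \<phi>
  proof -
    have "(- 1) ^ length is * (\<integral>x. v x * \<phi> x \<partial>lebesgue) = (- 1) ^ length is * (\<integral>x. w x * \<phi> x \<partial>lebesgue)"
      using assms \<phi> unfolding has_weak_partial_def by metis
    then have "(\<integral>x. v x * \<phi> x \<partial>lebesgue) = (\<integral>x. w x * \<phi> x \<partial>lebesgue)" by simp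
    then show ?thesis
      unfolding left_diff_distrib
      by (subst Bochner_Integration.integral_diff) (auto intro: locally_integrable_mult_test v w \<phi>)
  qed
  ultimately have "AE x in lebesgue. v x - w x = 0" by (rule AE_eq_0_of_test_integrals)
  then show ?thesis by simp
qed

lemma has_weak_partial_weak_partial:
  "weakly_differentiable k u \<Longrightarrow> length is \<le> k \<Longrightarrow> has_weak_partial u is (weak_partial u is)"
  unfolding weakly_differentiable_def weak_partial_def by (metis someI_ex)

text \<open>The list \<open>is @ [i]\<close> differentiates the test function in direction i first.
  Inserting \<open>partial_deriv [i] \<phi>\<close> into the identity for \<open>is\<close>
  therefore involves no exchange of mixed derivatives.\<close>

lemma has_weak_partial_snoc:
  assumes "has_weak_partial u is v" "has_weak_partial u (is @ [i]) w" "test_function \<phi>"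
  shows "(\<integral>x. v x * partial_deriv [i] \<phi> x \<partial>lebesgue) = - (\<integral>x. w x * \<phi> x \<partial>lebesgue)"
proof -
  have "(- 1) ^ length is * (\<integral>x. v x * partial_deriv [i] \<phi> x \<partial>lebesgue) = (\<integral>x. u x * partial_deriv is (partial_deriv [i] \<phi>) x \<partial>lebesgue)"
    using assms(1) test_function_partial_deriv[OF assms(3)] unfolding has_weak_partial_def by metis
  also have "\<dots> = (- 1) ^ length (is @ [i]) * (\<integral>x. w x * \<phi> x \<partial>lebesgue)"
    using assms(2,3) unfolding has_weak_partial_def partial_deriv_append[symmetric] by blast
  finally have "(- 1) ^ length is * (\<integral>x. v x * partial_deriv [i] \<phi> x \<partial>lebesgue) =
      (- 1) ^ length is * (- (\<integral>x. w x * \<phi> x \<partial>lebesgue))"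
    by (simp del: partial_deriv.simps)
  then show ?thesis
    by (subst (asm) mult_left_cancel) auto
qed

text \<open>
  \<open>weighted_sup t g\<close> plays the role of \<open>t g\<^sup>*\<^sup>*(t)\<close>. Averaging over weights instead of sets makes
  its behaviour under convolution immediate, as weights are stable under convolution.
\<close>

definition weights :: "real \<Rightarrow> (real ^ 'n \<Rightarrow> ennreal) set" where
  "weights t = {H \<in> borel_measurable lebesgue. (\<forall>x. H x \<le> 1) \<and> (\<integral>\<^sup>+x. H x \<partial>lebesgue) \<le> ennreal t \<and>
     (\<exists>r. \<forall>x. r < norm x \<longrightarrow> H x = 0)}"

definition weighted_sup :: "real \<Rightarrow> (real ^ 'n \<Rightarrow> real) \<Rightarrow> ennreal" where
  "weighted_sup t g = (SUP H\<in>weights t. \<integral>\<^sup>+x. ennreal \<bar>g x\<bar> * H x \<partial>lebesgue)"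

lemma weighted_sup_upper: "H \<in> weights t \<Longrightarrow> (\<integral>\<^sup>+x. ennreal \<bar>g x\<bar> * H x \<partial>lebesgue) \<le> weighted_sup t g"
  unfolding weighted_sup_def by (rule SUP_upper)

lemma weighted_sup_least:
  "(\<And>H. H \<in> weights t \<Longrightarrow> (\<integral>\<^sup>+x. ennreal \<bar>g x\<bar> * H x \<partial>lebesgue) \<le> b) \<Longrightarrow> weighted_sup t g \<le> b"
  unfolding weighted_sup_def by (rule SUP_least)

lemma weighted_sup_mono:
  assumes "\<And>x. \<bar>g x\<bar> \<le> \<bar>h x\<bar>" shows "weighted_sup t g \<le> weighted_sup t h"
proof (rule weighted_sup_least)
  fix H :: "real ^ 'a \<Rightarrow> ennreal" assume H: "H \<in> weights t"
  have "(\<integral>\<^sup>+x. ennreal \<bar>g x\<bar> * H x \<partial>lebesgue) \<le> (\<integral>\<^sup>+x. ennreal \<bar>h x\<bar> * H x \<partial>lebesgue)"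
    by (intro nn_integral_mono mult_right_mono ennreal_leI assms) simp
  then show "(\<integral>\<^sup>+x. ennreal \<bar>g x\<bar> * H x \<partial>lebesgue) \<le> weighted_sup t h"
    using weighted_sup_upper[OF H, of h] by (rule order_trans)
qed

lemma weighted_sup_le_max_rearr:
  assumes "u \<in> borel_measurable lebesgue" "0 < t"
  shows "weighted_sup t u \<le> ennreal t * max_rearr u t"
  using assms by (intro weighted_sup_least nn_integral_le_max_rearr) (auto simp: weights_def)

text \<open>By duality: once the kernel has been moved to \<open>H\<close>, the integral of
  \<open>H\<close> against the absolute kernel, divided by the L^1 norm of \<open>K\<close>, is
  again a weight. It is at most 1, its mass is at most t, and its support has grown only by the
  radius of the kernel.\<close>

lemma correlate_weight_le:
  fixes v K :: "real ^ 'n \<Rightarrow> real"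
  assumes [measurable]: "v \<in> borel_measurable lebesgue" and K: "test_function K" and H: "H \<in> weights t" and "0 < \<rho>"
  shows "(\<integral>\<^sup>+x. ennreal \<bar>correlate (dilate_kernel \<rho> K) v x\<bar> * H x \<partial>lebesgue) \<le> l1_norm K * weighted_sup t v"
proof -
  interpret L: sigma_finite_measure "lebesgue :: (real ^ 'n) measure" by (rule sigma_finite_lebesgue)
  interpret P: pair_sigma_finite "lebesgue :: (real ^ 'n) measure" "lebesgue :: (real ^ 'n) measure" ..
  let ?K = "dilate_kernel \<rho> K"
  have [measurable]: "K \<in> borel_measurable borel" by (rule smooth_measurable[OF test_function_smooth[OF K]])
  have [measurable]: "H \<in> borel_measurable lebesgue" using H by (simp add: weights_def)
  have m[measurable]: "(\<lambda>p. ?K (snd p - fst p)) \<in> borel_measurable (lebesgue \<Otimes>\<^sub>M lebesgue)"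
    by (rule measurable_kernel_diff) measurable
  have [measurable]: "(\<lambda>x. ?K (z - x)) \<in> borel_measurable lebesgue" "(\<lambda>z. ?K (z - x)) \<in> borel_measurable lebesgue" for x z
    by (auto intro!: borel_measurable_imp_lebesgue)
  define H' where "H' z = (\<integral>\<^sup>+x. ennreal \<bar>?K (z - x)\<bar> * H x \<partial>lebesgue)" for z
  have le: "(\<integral>\<^sup>+x. ennreal \<bar>correlate ?K v x\<bar> * H x \<partial>lebesgue) \<le> (\<integral>\<^sup>+z. ennreal \<bar>v z\<bar> * H' z \<partial>lebesgue)"
    unfolding H'_def by (rule nn_integral_correlate_le) measurable
  obtain a where a: "0 \<le> a" "l1_norm K = ennreal a"
    using l1_norm_test_function[OF K] by (cases "l1_norm K") auto
  have "H' z \<le> (\<integral>\<^sup>+x. ennreal \<bar>?K (z - x)\<bar> \<partial>lebesgue)" for z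
  proof -
    have "ennreal \<bar>?K (z - x)\<bar> * H x \<le> ennreal \<bar>?K (z - x)\<bar>" for x
      using H mult_left_mono[of "H x" 1 "ennreal \<bar>?K (z - x)\<bar>"] by (auto simp: weights_def)
    then show ?thesis unfolding H'_def by (rule nn_integral_mono)
  qed
  then have H'_le: "H' z \<le> ennreal a" for z
    using \<open>0 < \<rho>\<close> by (simp add: nn_integral_kernel_shift l1_norm_dilate_kernel a)
  show ?thesis
  \<comment> \<open>A kernel of norm zero cannot be normalised and is treated separately.\<close>
  proof (cases "a = 0")
    case True
    then have "H' z = 0" for z using H'_le[of z] by simp
    then show ?thesis using le by simp
  next
    case False
    then have "a > 0" using a by simp
    have H'_m[measurable]: "H' \<in> borel_measurable lebesgue"
    proof -
      \<comment> \<open>The roles of the two variables are exchanged here; the reflected kernel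
        restores the form "second minus first" of \<open>measurable_kernel_diff\<close>.\<close>
      have "(\<lambda>(z, x). ennreal \<bar>?K (- (x - z))\<bar> * H x) \<in> borel_measurable (lebesgue \<Otimes>\<^sub>M lebesgue)"
      proof -
        have "(\<lambda>w. ?K (- w)) \<in> borel_measurable borel" by measurable
        from measurable_kernel_diff[OF this] have [measurable]:
          "(\<lambda>p. ?K (- (snd p - fst p))) \<in> borel_measurable (lebesgue \<Otimes>\<^sub>M lebesgue)" .
        show ?thesis unfolding split_beta' by measurable
      qed
      then have "(\<lambda>z. \<integral>\<^sup>+x. ennreal \<bar>?K (- (x - z))\<bar> * H x \<partial>lebesgue) \<in> borel_measurable lebesgue"
        by (rule L.borel_measurable_nn_integral)
      then show ?thesis unfolding H'_def[abs_def] by simp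
    qed
    have "(\<integral>\<^sup>+z. H' z \<partial>lebesgue) = (\<integral>\<^sup>+x. (\<integral>\<^sup>+z. ennreal \<bar>?K (z - x)\<bar> * H x \<partial>lebesgue) \<partial>lebesgue)"
      unfolding H'_def by (rule P.Fubini') (simp add: split_beta')
    also have "\<dots> = (\<integral>\<^sup>+x. ennreal a * H x \<partial>lebesgue)"
      using \<open>0 < \<rho>\<close> by (simp add: nn_integral_multc nn_integral_kernel_shift l1_norm_dilate_kernel a)
    also have "\<dots> = ennreal a * (\<integral>\<^sup>+x. H x \<partial>lebesgue)" by (rule nn_integral_cmult) measurable
    also have "\<dots> \<le> ennreal a * ennreal t" using H by (intro mult_left_mono) (auto simp: weights_def)
    finally have H'_int: "(\<integral>\<^sup>+z. H' z \<partial>lebesgue) \<le> ennreal a * ennreal t" .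
    have inv: "ennreal (1 / a) * ennreal a = 1" using \<open>a > 0\<close> by (simp add: ennreal_mult[symmetric])
    obtain R where R: "\<And>x. R < norm x \<Longrightarrow> H x = 0" using H by (auto simp: weights_def)
    obtain r where r: "r > 0" "\<And>x. norm x > r \<Longrightarrow> K x = 0" using test_function_support[OF K] by blast
    have "H' z = 0" if z: "R + \<rho> * r < norm z" for z
    proof -
      have "ennreal \<bar>?K (z - x)\<bar> * H x = 0" for x
      proof (cases "R < norm x")
        case False
        then have "norm (z - x) > \<rho> * r" using z norm_triangle_sub[of z x] by linarith
        then have "r < norm (z - x) / \<rho>" using \<open>0 < \<rho>\<close> by (simp add: pos_less_divide_eq mult.commute)
        then have "norm ((z - x) /\<^sub>R \<rho>) > r" using \<open>0 < \<rho>\<close> by (simp add: divide_inverse mult.commute)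
        then have "?K (z - x) = 0" unfolding dilate_kernel_def using r(2) by simp
        then show ?thesis by simp
      qed (simp add: R)
      then show ?thesis unfolding H'_def by (simp only: nn_integral_const mult_zero_left)
    qed
    moreover have "ennreal (1 / a) * H' z \<le> 1" for z
      using mult_left_mono[OF H'_le[of z], of "ennreal (1 / a)"] inv by simp
    moreover have "(\<integral>\<^sup>+z. ennreal (1 / a) * H' z \<partial>lebesgue) \<le> ennreal t"
      using mult_left_mono[OF H'_int, of "ennreal (1 / a)"] inv
      by (simp add: nn_integral_cmult mult.assoc[symmetric])
    ultimately have "(\<lambda>z. ennreal (1 / a) * H' z) \<in> weights t"
      unfolding weights_def by (auto intro!: exI[of _ "R + \<rho> * r"])
    from weighted_sup_upper[OF this, of v]
    have "ennreal a * (\<integral>\<^sup>+z. ennreal \<bar>v z\<bar> * (ennreal (1 / a) * H' z) \<partial>lebesgue) \<le> ennreal a * weighted_sup t v"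
      by (rule mult_left_mono) simp
    also have "ennreal a * (\<integral>\<^sup>+z. ennreal \<bar>v z\<bar> * (ennreal (1 / a) * H' z) \<partial>lebesgue) =
      (\<integral>\<^sup>+z. (ennreal (1 / a) * ennreal a) * (ennreal \<bar>v z\<bar> * H' z) \<partial>lebesgue)"
      by (subst nn_integral_cmult[symmetric]) (auto simp: mult_ac)
    also have "\<dots> = (\<integral>\<^sup>+z. ennreal \<bar>v z\<bar> * H' z \<partial>lebesgue)"
      unfolding inv by simp
    finally show ?thesis using order_trans[OF le] a(2) by simp
  qed
qed

section \<open>Intermediate derivatives\<close>

lemma weak_partial_correlate:
  fixes u :: "real ^ 'n \<Rightarrow> real"
  assumes "has_weak_partial u is v" "test_function \<phi>" "0 < \<rho>"
  shows "correlate (dilate_kernel \<rho> \<phi>) v x =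
    (- 1) ^ length is / \<rho> ^ length is * correlate (dilate_kernel \<rho> (partial_deriv is \<phi>)) u x"
proof -
  have "(\<integral>z. u z * partial_deriv is (\<lambda>z. dilate_kernel \<rho> \<phi> (z - x)) z \<partial>lebesgue) =
    (- 1) ^ length is * (\<integral>z. v z * dilate_kernel \<rho> \<phi> (z - x) \<partial>lebesgue)"
    using assms(1) test_function_kernel(1)[OF assms(2,3), of x] unfolding has_weak_partial_def by blast
  then have "(\<integral>z. u z * (dilate_kernel \<rho> (partial_deriv is \<phi>) (z - x) / \<rho> ^ length is) \<partial>lebesgue) =
    (- 1) ^ length is * (\<integral>z. v z * dilate_kernel \<rho> \<phi> (z - x) \<partial>lebesgue)"
    unfolding test_function_kernel(2)[OF assms(2,3), of "is" x] .
  then have "correlate (dilate_kernel \<rho> (partial_deriv is \<phi>)) u x / \<rho> ^ length is =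
    (- 1) ^ length is * correlate (dilate_kernel \<rho> \<phi>) v x"
    by (simp add: correlate_def)
  then have "(- 1) ^ length is * (correlate (dilate_kernel \<rho> (partial_deriv is \<phi>)) u x / \<rho> ^ length is) =
    ((- 1) ^ length is * (- 1) ^ length is) * correlate (dilate_kernel \<rho> \<phi>) v x"
    by (simp only: mult.assoc)
  also have "(- 1) ^ length is * (- 1) ^ length is = (1::real)"
    by (simp add: power_mult_distrib[symmetric])
  finally show ?thesis by simp
qed

text \<open>Dilating a kernel divides its first derivatives by \<rho>. At scale \<rho> the identity
  \<open>halve\<close> thus exhibits the difference of the kernels as \<rho> times a divergence, and
  each derivative passes to \<open>v\<close>. This factor \<rho> makes the errors of successive
  scales summable.\<close>

lemma correlate_halving:
  fixes u v :: "real ^ 'n \<Rightarrow> real"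
  assumes v: "has_weak_partial u is v" and w: "\<And>i. has_weak_partial u (is @ [i]) (w i)"
    and \<phi>: "test_function \<phi>" and \<psi>: "\<And>i. test_function (\<psi> i)" and "0 < \<rho>"
    and halve: "\<And>x. 2 ^ CARD('n) * \<phi> (2 *\<^sub>R x) - \<phi> x = (\<Sum>i\<in>UNIV. partial_deriv [i] (\<psi> i) x)"
  shows "correlate (dilate_kernel (\<rho> / 2) \<phi>) v x - correlate (dilate_kernel \<rho> \<phi>) v x =
    - \<rho> * (\<Sum>i\<in>UNIV. correlate (dilate_kernel \<rho> (\<psi> i)) (w i) x)"
proof -
  have vl: "locally_integrable v" using v by (simp add: has_weak_partial_def)
  have k: "test_function (\<lambda>z. dilate_kernel (\<rho> / 2) \<phi> (z - x))" "test_function (\<lambda>z. dilate_kernel \<rho> \<phi> (z - x))"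
    "test_function (\<lambda>z. dilate_kernel \<rho> (\<psi> i) (z - x))" for i
    using test_function_kernel(1)[OF \<phi>] test_function_kernel(1)[OF \<psi>] assms(5) by auto
  have eq: "dilate_kernel (\<rho> / 2) \<phi> (z - x) - dilate_kernel \<rho> \<phi> (z - x) =
    \<rho> * (\<Sum>i\<in>UNIV. partial_deriv [i] (\<lambda>z. dilate_kernel \<rho> (\<psi> i) (z - x)) z)" for z
  proof -
    let ?y = "(z - x) /\<^sub>R \<rho>"
    have "dilate_kernel (\<rho> / 2) \<phi> (z - x) - dilate_kernel \<rho> \<phi> (z - x) =
      (2 ^ CARD('n) * \<phi> (2 *\<^sub>R ?y) - \<phi> ?y) / \<rho> ^ CARD('n)"
    proof -
      have "(z - x) /\<^sub>R (\<rho> / 2) = 2 *\<^sub>R ?y"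
        by (simp only: inverse_mult_distrib inverse_inverse_eq scaleR_scaleR divide_inverse mult.commute)
      then show ?thesis
        unfolding dilate_kernel_def by (simp only: power_divide diff_divide_distrib) simp
    qed
    also have "\<dots> = (\<Sum>i\<in>UNIV. partial_deriv [i] (\<psi> i) ?y) / \<rho> ^ CARD('n)" by (simp only: halve)
    also have "\<dots> = (\<Sum>i\<in>UNIV. dilate_kernel \<rho> (partial_deriv [i] (\<psi> i)) (z - x))"
      by (simp add: dilate_kernel_def sum_divide_distrib)
    also have "\<dots> = \<rho> * (\<Sum>i\<in>UNIV. partial_deriv [i] (\<lambda>z. dilate_kernel \<rho> (\<psi> i) (z - x)) z)"
      using assms(5) unfolding test_function_kernel(2)[OF \<psi> assms(5)] by (simp add: sum_divide_distrib[symmetric] del: partial_deriv.simps)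
    finally show ?thesis .
  qed
  have "correlate (dilate_kernel (\<rho> / 2) \<phi>) v x - correlate (dilate_kernel \<rho> \<phi>) v x =
    (\<integral>z. v z * dilate_kernel (\<rho> / 2) \<phi> (z - x) - v z * dilate_kernel \<rho> \<phi> (z - x) \<partial>lebesgue)"
    unfolding correlate_def
    by (rule Bochner_Integration.integral_diff[symmetric]; rule locally_integrable_mult_test[OF vl]; rule k)
  also have "\<dots> = (\<integral>z. \<rho> * (\<Sum>i\<in>UNIV. v z * partial_deriv [i] (\<lambda>z. dilate_kernel \<rho> (\<psi> i) (z - x)) z) \<partial>lebesgue)"
    unfolding right_diff_distrib[symmetric] eq by (simp add: sum_distrib_left mult_ac del: partial_deriv.simps)
  also have "\<dots> = \<rho> * (\<Sum>i\<in>UNIV. (\<integral>z. v z * partial_deriv [i] (\<lambda>z. dilate_kernel \<rho> (\<psi> i) (z - x)) z \<partial>lebesgue))"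
    by (subst integral_mult_right_zero, subst Bochner_Integration.integral_sum)
      (rule locally_integrable_mult_test[OF vl test_function_partial_deriv[OF k(3)]], rule refl)
  also have "\<dots> = \<rho> * (\<Sum>i\<in>UNIV. - correlate (dilate_kernel \<rho> (\<psi> i)) (w i) x)"
    unfolding has_weak_partial_snoc[OF v w k(3)] correlate_def by simp
  finally show ?thesis by (simp add: sum_negf)
qed

text \<open>A telescoping sum over the scales \<open>r / 2 ^ m\<close>, integrated against a fixed
  weight. At the coarsest scale all derivatives sit on the kernel, the increments come from halving,
  and the remainder tends to 0. The constant depends on the kernel and on \<open>is\<close> only,
  hence is chosen before \<open>u\<close>, t and r.\<close>

lemma weighted_sup_weak_partial_le:
  fixes u :: "real ^ 'n \<Rightarrow> real"
  shows "\<exists>C\<ge>0. \<forall>u t r v w. u \<in> borel_measurable lebesgue \<longrightarrow> has_weak_partial u is v \<longrightarrow>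
    (\<forall>i. has_weak_partial u (is @ [i]) (w i)) \<longrightarrow> 0 < r \<longrightarrow>
    weighted_sup t v \<le> ennreal C * (ennreal r * (\<Sum>i\<in>UNIV. weighted_sup t (w i)) + ennreal (1 / r ^ length is) * weighted_sup t (u :: real ^ 'n \<Rightarrow> real))"
proof -
  obtain \<phi> :: "real ^ 'n \<Rightarrow> real" and \<psi> where \<phi>: "test_function \<phi>" "\<And>x. 0 \<le> \<phi> x" "\<exists>x. 0 < \<phi> x" and \<psi>: "\<And>i. test_function (\<psi> i)"
    and halve: "\<And>x. 2 ^ CARD('n) * \<phi> (2 *\<^sub>R x) - \<phi> x = (\<Sum>i\<in>UNIV. partial_deriv [i] (\<psi> i) x)"
    by (rule smoothing_kernel_exists) blast
  define c where "c = (\<integral>x. \<phi> x \<partial>lborel)"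
  have c: "c > 0" unfolding c_def by (rule integral_pos_kernel[OF \<phi>])
  define a where "a = enn2real (l1_norm (partial_deriv is \<phi>))"
  define b where "b = (\<Sum>i\<in>UNIV. enn2real (l1_norm (\<psi> i)))"
  have a: "a \<ge> 0" "l1_norm (partial_deriv is \<phi>) = ennreal a"
    using l1_norm_test_function[OF test_function_partial_deriv[OF \<phi>(1)]] by (auto simp: a_def less_top)
  have b: "b \<ge> 0" "\<And>i. l1_norm (\<psi> i) \<le> ennreal b"
  proof -
    show "b \<ge> 0" unfolding b_def by (intro sum_nonneg) auto
    fix i
    have "l1_norm (\<psi> i) = ennreal (enn2real (l1_norm (\<psi> i)))"
      using l1_norm_test_function[OF \<psi>[of i]] by (simp add: less_top)
    also have "\<dots> \<le> ennreal b" unfolding b_def by (intro ennreal_leI member_le_sum) auto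
    finally show "l1_norm (\<psi> i) \<le> ennreal b" .
  qed
  have main: "weighted_sup t v \<le> ennreal ((a + 2 * b) / c) * (ennreal r * (\<Sum>i\<in>UNIV. weighted_sup t (w i)) + ennreal (1 / r ^ length is) * weighted_sup t u)"
    if u: "u \<in> borel_measurable lebesgue" and v: "has_weak_partial u is v" and w: "\<And>i. has_weak_partial u (is @ [i]) (w i)" and r: "0 < r"
    for u :: "real ^ 'n \<Rightarrow> real" and t r v w
  proof (rule weighted_sup_least)
    fix H :: "real ^ 'n \<Rightarrow> ennreal" assume H: "H \<in> weights t"
    have vl: "locally_integrable v" and wl: "\<And>i. locally_integrable (w i)" using v w by (auto simp: has_weak_partial_def)
    have [measurable]: "v \<in> borel_measurable lebesgue" "\<And>i. w i \<in> borel_measurable lebesgue" "H \<in> borel_measurable lebesgue"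
      using vl wl H by (auto intro: locally_integrable_measurable simp: weights_def)
    have smb[measurable]: "\<phi> \<in> borel_measurable borel" "\<psi> i \<in> borel_measurable borel" for i
      using \<phi>(1) \<psi> by (auto intro: smooth_measurable test_function_smooth)
    obtain R where R: "R > 0" "\<And>x. R < norm x \<Longrightarrow> H x = 0"
    proof -
      obtain R where "\<And>x. R < norm x \<Longrightarrow> H x = 0" using H by (auto simp: weights_def)
      \<comment> \<open>The radius is enlarged because the approximation by mollification is stated
        for balls of positive radius.\<close>
      then show ?thesis by (intro that[of "max 1 R"]) auto
    qed
    define F where "F m = correlate (dilate_kernel (r / 2 ^ m) \<phi>) v" for m :: nat
    have [measurable]: "F m \<in> borel_measurable lebesgue" for m
      unfolding F_def by (rule correlate_measurable) measurable
    define W where "W = (\<Sum>i\<in>UNIV. weighted_sup t (w i))"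
    have step: "(\<integral>\<^sup>+x. ennreal \<bar>F (Suc m) x - F m x\<bar> * H x \<partial>lebesgue) \<le> ennreal (r / 2 ^ m) * (ennreal b * W)" for m
    proof -
      let ?\<rho> = "r / 2 ^ m"
      let ?K = "\<lambda>i. correlate (dilate_kernel ?\<rho> (\<psi> i)) (w i)"
      have [measurable]: "?K i \<in> borel_measurable lebesgue" for i
        by (rule correlate_measurable) measurable
      have \<rho>: "?\<rho> > 0" using r by simp
      have "ennreal \<bar>F (Suc m) x - F m x\<bar> * H x \<le> ennreal ?\<rho> * (\<Sum>i\<in>UNIV. ennreal \<bar>?K i x\<bar> * H x)" for x
      proof -
        have "F (Suc m) x - F m x = - ?\<rho> * (\<Sum>i\<in>UNIV. ?K i x)"
          using correlate_halving[OF v w \<phi>(1) \<psi> \<rho> halve, of x] by (simp add: F_def field_simps)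
        then have "\<bar>F (Suc m) x - F m x\<bar> \<le> ?\<rho> * (\<Sum>i\<in>UNIV. \<bar>?K i x\<bar>)"
          using r by (simp add: abs_mult divide_right_mono mult_left_mono)
        then have "ennreal \<bar>F (Suc m) x - F m x\<bar> \<le> ennreal (?\<rho> * (\<Sum>i\<in>UNIV. \<bar>?K i x\<bar>))"
          by (rule ennreal_leI)
        also have "\<dots> = ennreal ?\<rho> * (\<Sum>i\<in>UNIV. ennreal \<bar>?K i x\<bar>)"
          using \<rho> by (subst ennreal_mult) (auto intro!: sum_nonneg simp: sum_ennreal)
        finally have "ennreal \<bar>F (Suc m) x - F m x\<bar> * H x \<le> ennreal ?\<rho> * (\<Sum>i\<in>UNIV. ennreal \<bar>?K i x\<bar>) * H x"
          by (rule mult_right_mono) simp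
        then show ?thesis by (simp only: sum_distrib_right mult.assoc)
      qed
      then have "(\<integral>\<^sup>+x. ennreal \<bar>F (Suc m) x - F m x\<bar> * H x \<partial>lebesgue) \<le>
         (\<integral>\<^sup>+x. ennreal ?\<rho> * (\<Sum>i\<in>UNIV. ennreal \<bar>?K i x\<bar> * H x) \<partial>lebesgue)"
        by (rule nn_integral_mono)
      also have "\<dots> = ennreal ?\<rho> * (\<Sum>i\<in>UNIV. (\<integral>\<^sup>+x. ennreal \<bar>?K i x\<bar> * H x \<partial>lebesgue))"
        by (subst nn_integral_cmult, measurable, subst nn_integral_sum) auto
      also have "\<dots> \<le> ennreal ?\<rho> * (\<Sum>i\<in>UNIV. l1_norm (\<psi> i) * weighted_sup t (w i))"
        by (intro mult_left_mono sum_mono correlate_weight_le[OF _ \<psi> H \<rho>]) auto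
      also have "\<dots> \<le> ennreal ?\<rho> * (\<Sum>i\<in>UNIV. ennreal b * weighted_sup t (w i))"
        by (intro mult_left_mono sum_mono mult_right_mono b) auto
      finally show ?thesis by (simp add: W_def sum_distrib_left)
    qed
    have F0: "(\<integral>\<^sup>+x. ennreal \<bar>F 0 x\<bar> * H x \<partial>lebesgue) \<le> ennreal (1 / r ^ length is) * (ennreal a * weighted_sup t u)"
    proof -
      let ?G = "correlate (dilate_kernel r (partial_deriv is \<phi>)) u"
      have t: "test_function (partial_deriv is \<phi>)" by (rule test_function_partial_deriv[OF \<phi>(1)])
      have [measurable]: "?G \<in> borel_measurable lebesgue"
        using u smooth_measurable[OF test_function_smooth[OF t]] by (intro correlate_measurable) auto
      have "ennreal \<bar>F 0 x\<bar> = ennreal (1 / r ^ length is) * ennreal \<bar>?G x\<bar>" for x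
        using weak_partial_correlate[OF v \<phi>(1) r, of x] r
        by (simp add: F_def abs_mult power_abs ennreal_mult[symmetric])
      then have "(\<integral>\<^sup>+x. ennreal \<bar>F 0 x\<bar> * H x \<partial>lebesgue) = ennreal (1 / r ^ length is) * (\<integral>\<^sup>+x. ennreal \<bar>?G x\<bar> * H x \<partial>lebesgue)"
        by (simp add: nn_integral_cmult mult.assoc)
      also have "\<dots> \<le> ennreal (1 / r ^ length is) * (ennreal a * weighted_sup t u)"
        using correlate_weight_le[OF u t H r] a by (intro mult_left_mono) auto
      finally show ?thesis .
    qed
    \<comment> \<open>The coefficient \<open>2 * r - 2 * r / 2 ^ M\<close> is the exact sum of the
      scales \<open>r / 2 ^ m\<close> over \<open>m < M\<close>. The exact value closes the
      induction, and it never exceeds \<open>2 * r\<close>.\<close>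
    have FM: "(\<integral>\<^sup>+x. ennreal \<bar>F M x\<bar> * H x \<partial>lebesgue) \<le>
       ennreal (1 / r ^ length is) * (ennreal a * weighted_sup t u) + ennreal (2 * r - 2 * r / 2 ^ M) * (ennreal b * W)" for M
    proof (induction M)
      case 0 then show ?case using F0 by simp
    next
      case (Suc M)
      have "ennreal \<bar>F (Suc M) x\<bar> * H x \<le> ennreal \<bar>F M x\<bar> * H x + ennreal \<bar>F (Suc M) x - F M x\<bar> * H x" for x
        unfolding distrib_right[symmetric]
        by (intro mult_right_mono) (auto simp: ennreal_plus[symmetric] simp del: ennreal_plus intro!: ennreal_leI)
      then have "(\<integral>\<^sup>+x. ennreal \<bar>F (Suc M) x\<bar> * H x \<partial>lebesgue) \<le> (\<integral>\<^sup>+x. ennreal \<bar>F M x\<bar> * H x + ennreal \<bar>F (Suc M) x - F M x\<bar> * H x \<partial>lebesgue)"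
        by (rule nn_integral_mono)
      also have "\<dots> = (\<integral>\<^sup>+x. ennreal \<bar>F M x\<bar> * H x \<partial>lebesgue) + (\<integral>\<^sup>+x. ennreal \<bar>F (Suc M) x - F M x\<bar> * H x \<partial>lebesgue)"
        by (rule nn_integral_add) measurable
      also have "\<dots> \<le> (ennreal (1 / r ^ length is) * (ennreal a * weighted_sup t u) + ennreal (2 * r - 2 * r / 2 ^ M) * (ennreal b * W))
         + ennreal (r / 2 ^ M) * (ennreal b * W)"
        by (intro add_mono Suc step)
      also have "\<dots> = ennreal (1 / r ^ length is) * (ennreal a * weighted_sup t u) +
         (ennreal (2 * r - 2 * r / 2 ^ M) + ennreal (r / 2 ^ M)) * (ennreal b * W)"
        by (simp add: distrib_right add.assoc)
      also have "ennreal (2 * r - 2 * r / 2 ^ M) + ennreal (r / 2 ^ M) = ennreal (2 * r - 2 * r / 2 ^ Suc M)"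
      proof -
        have "2 * r / 2 ^ M \<le> 2 * r" using r by (simp add: field_simps)
        then show ?thesis using r by (subst ennreal_plus[symmetric]) (auto simp: field_simps)
      qed
      finally show ?case .
    qed
    \<comment> \<open>The kernel has integral \<open>c\<close> rather than 1, so its mollifications
      approximate \<open>c * v\<close>; the factor is divided out at the end.\<close>
    have "ennreal c * (\<integral>\<^sup>+x. ennreal \<bar>v x\<bar> * H x \<partial>lebesgue) \<le>
      (ennreal (1 / r ^ length is) * (ennreal a * weighted_sup t u) + ennreal (2 * r) * (ennreal b * W)) + ennreal e" if e: "e > 0" for e
    proof -
      obtain d where d: "d > 0" "\<And>\<rho>. 0 < \<rho> \<Longrightarrow> \<rho> < d \<Longrightarrow>
        (\<integral>\<^sup>+x\<in>cball 0 R. ennreal \<bar>c * v x - correlate (dilate_kernel \<rho> \<phi>) v x\<bar> \<partial>lebesgue) \<le> ennreal e"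
        using mollify_locally_integrable_close[OF \<phi>(1) vl e R(1)] unfolding c_def by blast
      obtain M where "(1 / 2) ^ M < d / r" using real_arch_pow_inv[of "d / r" "1/2"] d r by auto
      then have M: "r / 2 ^ M < d" "0 < r / 2 ^ M" using r by (auto simp: field_simps)
      have "ennreal c * (ennreal \<bar>v x\<bar> * H x) \<le> ennreal \<bar>F M x\<bar> * H x + ennreal \<bar>c * v x - F M x\<bar> * H x" for x
        unfolding distrib_right[symmetric] mult.assoc[symmetric]
      proof (rule mult_right_mono)
        have "c * \<bar>v x\<bar> = \<bar>c * v x\<bar>" using c by (simp add: abs_mult)
        then have "c * \<bar>v x\<bar> \<le> \<bar>F M x\<bar> + \<bar>c * v x - F M x\<bar>" by linarith
        then show "ennreal c * ennreal \<bar>v x\<bar> \<le> ennreal \<bar>F M x\<bar> + ennreal \<bar>c * v x - F M x\<bar>"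
          using c by (simp add: ennreal_plus[symmetric] ennreal_mult[symmetric] ennreal_leI del: ennreal_plus)
      qed simp
      \<comment> \<open>The bounded support of the weight enters here: the remainder is small in L^1
        on balls only.\<close>
      moreover have "ennreal \<bar>c * v x - F M x\<bar> * H x \<le> ennreal \<bar>c * v x - F M x\<bar> * indicator (cball 0 R) x" for x
        using R(2)[of x] H mult_left_mono[of "H x" 1 "ennreal \<bar>c * v x - F M x\<bar>"]
        by (cases "norm x \<le> R") (auto simp: weights_def)
      ultimately have "ennreal c * (ennreal \<bar>v x\<bar> * H x) \<le> ennreal \<bar>F M x\<bar> * H x + ennreal \<bar>c * v x - F M x\<bar> * indicator (cball 0 R) x" for x
        by (rule order_trans[OF _ add_left_mono])
      then have "(\<integral>\<^sup>+x. ennreal c * (ennreal \<bar>v x\<bar> * H x) \<partial>lebesgue) \<le>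
          (\<integral>\<^sup>+x. ennreal \<bar>F M x\<bar> * H x + ennreal \<bar>c * v x - F M x\<bar> * indicator (cball 0 R) x \<partial>lebesgue)"
        by (rule nn_integral_mono)
      also have "\<dots> = (\<integral>\<^sup>+x. ennreal \<bar>F M x\<bar> * H x \<partial>lebesgue) + (\<integral>\<^sup>+x\<in>cball 0 R. ennreal \<bar>c * v x - F M x\<bar> \<partial>lebesgue)"
      proof -
        have [measurable]: "cball (0::real^'n) R \<in> sets lebesgue" by auto
        show ?thesis by (rule nn_integral_add) measurable
      qed
      also have "\<dots> \<le> (ennreal (1 / r ^ length is) * (ennreal a * weighted_sup t u) + ennreal (2 * r) * (ennreal b * W)) + ennreal e"
      proof (intro add_mono order_trans[OF FM] mult_right_mono order_refl)
        show "ennreal (2 * r - 2 * r / 2 ^ M) \<le> ennreal (2 * r)" using r by (intro ennreal_leI) simp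
        show "(\<integral>\<^sup>+x\<in>cball 0 R. ennreal \<bar>c * v x - F M x\<bar> \<partial>lebesgue) \<le> ennreal e"
          unfolding F_def by (rule d(2)[OF M(2,1)])
      qed simp_all
      finally show ?thesis by (simp add: nn_integral_cmult)
    qed
    then have *: "ennreal c * (\<integral>\<^sup>+x. ennreal \<bar>v x\<bar> * H x \<partial>lebesgue) \<le>
      ennreal (1 / r ^ length is) * (ennreal a * weighted_sup t u) + ennreal (2 * r) * (ennreal b * W)"
      by (rule ennreal_le_epsilon)
    have e1: "ennreal (1 / r ^ length is) * (ennreal a * weighted_sup t u) = ennreal a * (ennreal (1 / r ^ length is) * weighted_sup t u)"
      by (rule mult.left_commute)
    have e2: "ennreal (2 * r) * (ennreal b * W) = ennreal (2 * b) * (ennreal r * W)"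
    proof -
      have "ennreal (2 * r) * ennreal b = ennreal (2 * b) * ennreal r"
        using r b by (simp add: ennreal_mult[symmetric] mult_ac)
      then show ?thesis by (simp add: mult.assoc[symmetric])
    qed
    have "ennreal a * (ennreal (1 / r ^ length is) * weighted_sup t u) \<le> ennreal (a + 2 * b) * (ennreal (1 / r ^ length is) * weighted_sup t u)"
      "ennreal (2 * b) * (ennreal r * W) \<le> ennreal (a + 2 * b) * (ennreal r * W)"
      using a b by (auto intro!: mult_right_mono ennreal_leI)
    note order_trans[OF *[unfolded e1 e2] add_mono[OF this]]
    also have "ennreal (a + 2 * b) * (ennreal (1 / r ^ length is) * weighted_sup t u) + ennreal (a + 2 * b) * (ennreal r * W) =
       ennreal (a + 2 * b) * (ennreal r * W + ennreal (1 / r ^ length is) * weighted_sup t u)"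
      by (simp only: distrib_left add.commute)
    finally have "ennreal c * (\<integral>\<^sup>+x. ennreal \<bar>v x\<bar> * H x \<partial>lebesgue) \<le>
       ennreal (a + 2 * b) * (ennreal r * W + ennreal (1 / r ^ length is) * weighted_sup t u)" .
    then have "ennreal (1 / c) * (ennreal c * (\<integral>\<^sup>+x. ennreal \<bar>v x\<bar> * H x \<partial>lebesgue)) \<le>
       ennreal (1 / c) * (ennreal (a + 2 * b) * (ennreal r * W + ennreal (1 / r ^ length is) * weighted_sup t u))"
      by (rule mult_left_mono) simp
    moreover have "ennreal (1 / c) * ennreal c = 1" "ennreal (1 / c) * ennreal (a + 2 * b) = ennreal ((a + 2 * b) / c)"
      using a b c by (simp_all add: ennreal_mult[symmetric] del: ennreal_plus)
    ultimately show "(\<integral>\<^sup>+x. ennreal \<bar>v x\<bar> * H x \<partial>lebesgue) \<le>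
      ennreal ((a + 2 * b) / c) * (ennreal r * (\<Sum>i\<in>UNIV. weighted_sup t (w i)) + ennreal (1 / r ^ length is) * weighted_sup t u)"
      unfolding W_def by (simp only: mult.assoc[symmetric] mult_1)
  qed
  show ?thesis
    using main a b c by (intro exI[of _ "(a + 2 * b) / c"]) auto
qed


lemma finite_lists_length: "finite {is :: 'n::finite list. length is = m}"
  using finite_lists_length_eq[of "UNIV :: 'n set" m] by simp

text \<open>Summing over all tuples of a given length gives a quantity that can be iterated in the
  order: for a fixed \<open>is\<close>, the tuples \<open>is @ [i]\<close> are distinct members of
  the next sum.\<close>

lemma sum_weighted_sup_step:
  assumes "j < k"
  shows "\<exists>C\<ge>0. \<forall>(u :: real ^ 'n \<Rightarrow> real) t r. weakly_differentiable k u \<longrightarrow> 0 < r \<longrightarrow>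
    (\<Sum>is | length is = j. weighted_sup t (weak_partial u is)) \<le>
    ennreal C * (ennreal r * (\<Sum>is | length is = Suc j. weighted_sup t (weak_partial u is)) + ennreal (1 / r ^ j) * weighted_sup t u)"
proof -
  have "\<forall>is :: 'n list. \<exists>C\<ge>0. \<forall>u t r v w. u \<in> borel_measurable lebesgue \<longrightarrow> has_weak_partial u is v \<longrightarrow>
    (\<forall>i. has_weak_partial u (is @ [i]) (w i)) \<longrightarrow> 0 < r \<longrightarrow>
    weighted_sup t v \<le> ennreal C * (ennreal r * (\<Sum>i\<in>UNIV. weighted_sup t (w i)) + ennreal (1 / r ^ length is) * weighted_sup t (u :: real ^ 'n \<Rightarrow> real))"
    using weighted_sup_weak_partial_le by blast
  then obtain C where C0: "\<And>is :: 'n list. C is \<ge> 0" and C: "\<And>is (u :: real ^ 'n \<Rightarrow> real) t r v w. u \<in> borel_measurable lebesgue \<Longrightarrow> has_weak_partial u is v \<Longrightarrow>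
    (\<forall>i. has_weak_partial u (is @ [i]) (w i)) \<Longrightarrow> 0 < r \<Longrightarrow>
    weighted_sup t v \<le> ennreal (C is) * (ennreal r * (\<Sum>i\<in>UNIV. weighted_sup t (w i)) + ennreal (1 / r ^ length is) * weighted_sup t u)"
    by metis
  show ?thesis
  proof (intro exI[of _ "\<Sum>is | length is = j. C is"] conjI allI impI)
    show "0 \<le> (\<Sum>is | length is = j. C is)" by (intro sum_nonneg C0)
    fix u :: "real ^ 'n \<Rightarrow> real" and t r :: real
    assume u: "weakly_differentiable k u" and r: "0 < r"
    let ?N = "\<Sum>is | length is = Suc j. weighted_sup t (weak_partial u is)"
    have um: "u \<in> borel_measurable lebesgue"
      using u by (auto simp: weakly_differentiable_def intro: locally_integrable_measurable)
    have "weighted_sup t (weak_partial u is) \<le> ennreal (C is) * (ennreal r * ?N + ennreal (1 / r ^ j) * weighted_sup t u)"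
      if "length is = j" for "is"
    proof -
      have "weighted_sup t (weak_partial u is) \<le> ennreal (C is) * (ennreal r * (\<Sum>i\<in>UNIV. weighted_sup t (weak_partial u (is @ [i]))) + ennreal (1 / r ^ length is) * weighted_sup t u)"
        using that \<open>j < k\<close> by (intro C um has_weak_partial_weak_partial[OF u] r allI) auto
      also have "(\<Sum>i\<in>UNIV. weighted_sup t (weak_partial u (is @ [i]))) = (\<Sum>js\<in>(\<lambda>i. is @ [i]) ` UNIV. weighted_sup t (weak_partial u js))"
        by (subst sum.reindex) (auto simp: inj_on_def)
      also have "\<dots> \<le> ?N"
        using that by (intro sum_mono2 finite_lists_length) auto
      finally show ?thesis using that by (simp add: mult_left_mono add_right_mono)
    qed
    then have "(\<Sum>is | length is = j. weighted_sup t (weak_partial u is)) \<le>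
      (\<Sum>is | length is = j. ennreal (C is) * (ennreal r * ?N + ennreal (1 / r ^ j) * weighted_sup t u))"
      by (intro sum_mono) auto
    also have "\<dots> = ennreal (\<Sum>is | length is = j. C is) * (ennreal r * ?N + ennreal (1 / r ^ j) * weighted_sup t u)"
      by (simp only: sum_distrib_right[symmetric] sum_ennreal[OF C0])
    finally show "(\<Sum>is | length is = j. weighted_sup t (weak_partial u is)) \<le>
      ennreal (\<Sum>is | length is = j. C is) * (ennreal r * ?N + ennreal (1 / r ^ j) * weighted_sup t u)" .
  qed
qed

text \<open>Downward induction on j with the same r throughout. Multiplication by r turns the
  coefficients \<open>r ^ (k - Suc j)\<close> and \<open>1 / r ^ Suc j\<close> into those wanted for
  j, so the new term in \<open>u\<close> merges with the old one.\<close>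

lemma sum_weighted_sup_le:
  assumes "j \<le> k"
  shows "\<exists>C\<ge>0. \<forall>(u :: real ^ 'n \<Rightarrow> real) t r. weakly_differentiable k u \<longrightarrow> 0 < r \<longrightarrow>
    (\<Sum>is | length is = j. weighted_sup t (weak_partial u is)) \<le>
    ennreal C * (ennreal (r ^ (k - j)) * (\<Sum>is | length is = k. weighted_sup t (weak_partial u is)) + ennreal (1 / r ^ j) * weighted_sup t u)"
  using assms
proof (induction rule: inc_induct)
  case base
  show ?case by (intro exI[of _ 1]) auto
next
  case (step j)
  obtain C where C: "C \<ge> 0" "\<And>(u :: real ^ 'n \<Rightarrow> real) t r. weakly_differentiable k u \<Longrightarrow> 0 < r \<Longrightarrow>
    (\<Sum>is | length is = j. weighted_sup t (weak_partial u is)) \<le>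
    ennreal C * (ennreal r * (\<Sum>is | length is = Suc j. weighted_sup t (weak_partial u is)) + ennreal (1 / r ^ j) * weighted_sup t u)"
    using sum_weighted_sup_step[OF step.hyps(2)] by blast
  obtain C' where C': "C' \<ge> 0" "\<And>(u :: real ^ 'n \<Rightarrow> real) t r. weakly_differentiable k u \<Longrightarrow> 0 < r \<Longrightarrow>
    (\<Sum>is | length is = Suc j. weighted_sup t (weak_partial u is)) \<le>
    ennreal C' * (ennreal (r ^ (k - Suc j)) * (\<Sum>is | length is = k. weighted_sup t (weak_partial u is)) + ennreal (1 / r ^ Suc j) * weighted_sup t u)"
    using step.IH by blast
  show ?case
  proof (intro exI[of _ "C * (C' + 1)"] conjI allI impI)
    show "0 \<le> C * (C' + 1)" using C(1) C'(1) by simp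
    fix u :: "real ^ 'n \<Rightarrow> real" and t r :: real
    assume u: "weakly_differentiable k u" and r: "0 < r"
    let ?N = "\<Sum>is | length is = k. weighted_sup t (weak_partial u is)" and ?U = "weighted_sup t u"
    have pow: "ennreal r * ennreal (r ^ (k - Suc j)) = ennreal (r ^ (k - j))" "ennreal r * ennreal (1 / r ^ Suc j) = ennreal (1 / r ^ j)"
    proof -
      have "r * r ^ (k - Suc j) = r ^ (k - j)" using step.hyps(2) by (metis Suc_diff_Suc power_Suc)
      then show "ennreal r * ennreal (r ^ (k - Suc j)) = ennreal (r ^ (k - j))" using r by (simp add: ennreal_mult[symmetric])
      have "r * (1 / r ^ Suc j) = 1 / r ^ j" using r by (simp add: field_simps)
      then show "ennreal r * ennreal (1 / r ^ Suc j) = ennreal (1 / r ^ j)" using r by (simp add: ennreal_mult[symmetric])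
    qed
    have "(\<Sum>is | length is = j. weighted_sup t (weak_partial u is)) \<le>
      ennreal C * (ennreal r * (ennreal C' * (ennreal (r ^ (k - Suc j)) * ?N + ennreal (1 / r ^ Suc j) * ?U)) + ennreal (1 / r ^ j) * ?U)"
      by (rule order_trans[OF C(2)[OF u r]]) (intro mult_left_mono add_right_mono C'(2)[OF u r] zero_le)
    also have "ennreal r * (ennreal C' * (ennreal (r ^ (k - Suc j)) * ?N + ennreal (1 / r ^ Suc j) * ?U)) =
       ennreal C' * (ennreal (r ^ (k - j)) * ?N + ennreal (1 / r ^ j) * ?U)"
      unfolding pow[symmetric] by (simp only: distrib_left mult_ac)
    also have "\<dots> + ennreal (1 / r ^ j) * ?U \<le> \<dots> + 1 * (ennreal (r ^ (k - j)) * ?N + ennreal (1 / r ^ j) * ?U)"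
      by (intro add_left_mono) simp
    also have "\<dots> = ennreal (C' + 1) * (ennreal (r ^ (k - j)) * ?N + ennreal (1 / r ^ j) * ?U)"
      using C'(1) by (simp add: distrib_right ennreal_1[symmetric] del: ennreal_1)
    finally have "(\<Sum>is | length is = j. weighted_sup t (weak_partial u is)) \<le>
      ennreal C * (ennreal (C' + 1) * (ennreal (r ^ (k - j)) * ?N + ennreal (1 / r ^ j) * ?U))"
      by (simp add: mult_left_mono)
    also have "\<dots> = ennreal (C * (C' + 1)) * (ennreal (r ^ (k - j)) * ?N + ennreal (1 / r ^ j) * ?U)"
      using C(1) C'(1) by (simp add: ennreal_mult mult.assoc)
    finally show "(\<Sum>is | length is = j. weighted_sup t (weak_partial u is)) \<le>
      ennreal (C * (C' + 1)) * (ennreal (r ^ (k - j)) * ?N + ennreal (1 / r ^ j) * ?U)" .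
  qed
qed

section \<open>From weighted averages back to rearrangements\<close>

lemma weak_partial_measurable:
  "weakly_differentiable k u \<Longrightarrow> length is \<le> k \<Longrightarrow> weak_partial u is \<in> borel_measurable lebesgue"
  using has_weak_partial_weak_partial locally_integrable_measurable unfolding has_weak_partial_def by blast

lemma abs_nabla_measurable:
  assumes "weakly_differentiable k u" "m \<le> k"
  shows "abs_nabla m u \<in> borel_measurable lebesgue"
proof -
  have [measurable]: "(\<lambda>x. \<Sum>is | length is = m. (weak_partial u is x)\<^sup>2) \<in> borel_measurable lebesgue"
    using assms weak_partial_measurable by (intro borel_measurable_sum borel_measurable_power) auto
  show ?thesis
    unfolding abs_nabla_def[abs_def] L2_set_def by measurable
qed

lemma abs_nabla_bounds:
  "\<bar>abs_nabla m u x\<bar> \<le> (\<Sum>is | length is = m. \<bar>weak_partial u is x\<bar>)"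
  "length is = m \<Longrightarrow> \<bar>weak_partial u is x\<bar> \<le> \<bar>abs_nabla m u x\<bar>"
proof -
  have eq: "abs_nabla m u x = L2_set (\<lambda>is. \<bar>weak_partial u is x\<bar>) {is. length is = m}"
    by (simp add: abs_nabla_def L2_set_def)
  then show "\<bar>abs_nabla m u x\<bar> \<le> (\<Sum>is | length is = m. \<bar>weak_partial u is x\<bar>)"
    using L2_set_le_sum[of "{is. length is = m}" "\<lambda>is. \<bar>weak_partial u is x\<bar>"] by (simp add: L2_set_nonneg)
  show "\<bar>weak_partial u is x\<bar> \<le> \<bar>abs_nabla m u x\<bar>" if "length is = m"
    unfolding eq using that member_le_L2_set[OF finite_lists_length, of "is" m "\<lambda>is. \<bar>weak_partial u is x\<bar>"] by simp
qed

text \<open>Chebyshev's inequality. The level set at s has measure above t, and by continuity from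
  below so does its part in some large ball, which has finite measure and carries an admissible
  weight.\<close>

lemma mult_le_weighted_sup:
  fixes f :: "real ^ 'n \<Rightarrow> real"
  assumes [measurable]: "f \<in> borel_measurable lebesgue" and "0 \<le> s" "ennreal s < decr_rearr f t" "0 < t"
  shows "ennreal (t * s) \<le> weighted_sup t f"
proof -
  have S[measurable]: "{x. s < \<bar>f x\<bar>} \<inter> cball 0 (real n) \<in> sets lebesgue" for n
    using abs_level_set[OF assms(1)] by auto
  have "ennreal t < emeasure lebesgue {x. \<bar>f x\<bar> > s}"
    using less_decr_rearr_iff[of f s t] assms by simp
  also have "{x. \<bar>f x\<bar> > s} = (\<Union>n. {x. s < \<bar>f x\<bar>} \<inter> cball 0 (real n))"
    by (auto intro: real_arch_simple)
  also have "emeasure lebesgue \<dots> = (SUP n. emeasure lebesgue ({x. s < \<bar>f x\<bar>} \<inter> cball 0 (real n)))"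
    using S by (intro SUP_emeasure_incseq[symmetric]) (auto simp: incseq_def)
  finally obtain n where n: "ennreal t < emeasure lebesgue ({x. s < \<bar>f x\<bar>} \<inter> cball 0 (real n))"
    unfolding less_SUP_iff by blast
  let ?E = "{x. s < \<bar>f x\<bar>} \<inter> cball 0 (real n)"
  have "emeasure lebesgue ?E \<le> emeasure lebesgue (cball (0::real^'n) (real n))"
    by (intro emeasure_mono) auto
  also have "\<dots> < \<infinity>" using lmeasurable_cball[of "0::real^'n" "real n"] by (simp add: fmeasurable_def)
  finally obtain m where m: "m \<ge> 0" "emeasure lebesgue ?E = ennreal m"
    by (cases "emeasure lebesgue ?E") auto
  then have tm: "t < m" using n \<open>0 < t\<close> by (simp add: ennreal_less_iff)
  \<comment> \<open>The factor \<open>t / m\<close>, which is below 1, gives the weight mass exactly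
    t.\<close>
  define H where "H x = ennreal (t / m) * indicator ?E x" for x
  have int: "(\<integral>\<^sup>+x. H x \<partial>lebesgue) = ennreal t"
    unfolding H_def using m tm \<open>0 < t\<close> by (simp add: nn_integral_cmult S ennreal_mult[symmetric])
  have "H \<in> weights t"
    unfolding weights_def
  proof (intro CollectI conjI allI exI[of _ "real n"] impI)
    show "H \<in> borel_measurable lebesgue" unfolding H_def[abs_def] by measurable
    show "H x \<le> 1" for x using tm \<open>0 < t\<close> by (auto simp: H_def indicator_def)
    show "(\<integral>\<^sup>+x. H x \<partial>lebesgue) \<le> ennreal t" using int by simp
    show "H x = 0" if "real n < norm x" for x using that by (auto simp: H_def)
  qed
  have "ennreal (t * s) = ennreal s * (\<integral>\<^sup>+x. H x \<partial>lebesgue)"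
    unfolding int using assms by (simp add: ennreal_mult mult.commute)
  also have "\<dots> = (\<integral>\<^sup>+x. ennreal s * H x \<partial>lebesgue)"
    by (rule nn_integral_cmult[symmetric]) (unfold H_def[abs_def], measurable)
  also have "\<dots> \<le> (\<integral>\<^sup>+x. ennreal \<bar>f x\<bar> * H x \<partial>lebesgue)"
    by (intro nn_integral_mono) (auto simp: H_def indicator_def intro!: mult_right_mono ennreal_leI)
  also have "\<dots> \<le> weighted_sup t f" by (rule weighted_sup_upper) fact
  finally show ?thesis .
qed

lemma decr_rearr_nabla_additive:
  assumes "j \<le> k"
  shows "\<exists>C\<ge>0. \<forall>(u :: real ^ 'n \<Rightarrow> real) t r. weakly_differentiable k u \<longrightarrow> 0 < t \<longrightarrow> 0 < r \<longrightarrow>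
    decr_rearr (abs_nabla j u) t \<le> ennreal C * (ennreal (r ^ (k - j)) * max_rearr (abs_nabla k u) t + ennreal (1 / r ^ j) * max_rearr u t)"
proof -
  obtain C where C: "C \<ge> 0" "\<And>(u :: real ^ 'n \<Rightarrow> real) t r. weakly_differentiable k u \<Longrightarrow> 0 < r \<Longrightarrow>
    (\<Sum>is | length is = j. weighted_sup t (weak_partial u is)) \<le>
    ennreal C * (ennreal (r ^ (k - j)) * (\<Sum>is | length is = k. weighted_sup t (weak_partial u is)) + ennreal (1 / r ^ j) * weighted_sup t u)"
    using sum_weighted_sup_le[OF assms] by blast
  define n where "n = real (card {is :: 'n list. length is = k})"
  show ?thesis
  proof (intro exI[of _ "C * (n + 1)"] conjI allI impI)
    show "0 \<le> C * (n + 1)" using C(1) by (simp add: n_def)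
    fix u :: "real ^ 'n \<Rightarrow> real" and t r :: real
    assume u: "weakly_differentiable k u" and t: "0 < t" and r: "0 < r"
    let ?G = "max_rearr (abs_nabla k u) t" and ?U = "max_rearr u t"
    have um: "u \<in> borel_measurable lebesgue"
      using u by (auto simp: weakly_differentiable_def intro: locally_integrable_measurable)
    have "weighted_sup t (weak_partial u is) \<le> ennreal t * ?G" if "length is = k" for "is"
      using that abs_nabla_bounds(2)[OF that, of u]
      by (intro order_trans[OF weighted_sup_mono weighted_sup_le_max_rearr[OF abs_nabla_measurable[OF u order_refl] t]])
    then have "(\<Sum>is | length is = k. weighted_sup t (weak_partial u is)) \<le> (\<Sum>is :: 'n list | length is = k. ennreal t * ?G)"
      by (intro sum_mono) auto
    also have "\<dots> = ennreal t * (ennreal n * ?G)"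
      by (simp add: n_def ennreal_of_nat_eq_real_of_nat mult.left_commute)
    finally have N: "(\<Sum>is | length is = k. weighted_sup t (weak_partial u is)) \<le> ennreal t * (ennreal n * ?G)" .
    have bound: "(\<Sum>is | length is = j. weighted_sup t (weak_partial u is)) \<le>
      ennreal t * (ennreal (C * (n + 1)) * (ennreal (r ^ (k - j)) * ?G + ennreal (1 / r ^ j) * ?U))"
    proof -
      have "(\<Sum>is | length is = j. weighted_sup t (weak_partial u is)) \<le>
        ennreal C * (ennreal (r ^ (k - j)) * (ennreal t * (ennreal n * ?G)) + ennreal (1 / r ^ j) * (ennreal t * ?U))"
        by (rule order_trans[OF C(2)[OF u r]])
          (intro mult_left_mono add_mono N weighted_sup_le_max_rearr um t zero_le)
      also have "\<dots> = ennreal t * (ennreal C * (ennreal n * (ennreal (r ^ (k - j)) * ?G) + 1 * (ennreal (1 / r ^ j) * ?U)))"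
        by (simp add: distrib_left mult_ac)
      also have "\<dots> \<le> ennreal t * (ennreal C * (ennreal (n + 1) * (ennreal (r ^ (k - j)) * ?G) + ennreal (n + 1) * (ennreal (1 / r ^ j) * ?U)))"
      proof -
        have n0: "n \<ge> 0" by (simp add: n_def)
        have "ennreal n \<le> ennreal (n + 1)" "1 \<le> ennreal (n + 1)" using n0 by (auto intro!: ennreal_leI simp del: ennreal_plus)
        then show ?thesis by (intro mult_left_mono add_mono mult_right_mono) auto
      qed
      also have "\<dots> = ennreal t * (ennreal (C * (n + 1)) * (ennreal (r ^ (k - j)) * ?G + ennreal (1 / r ^ j) * ?U))"
      proof -
        have "ennreal (C * (n + 1)) = ennreal C * ennreal (n + 1)"
          using C(1) by (intro ennreal_mult) (auto simp: n_def)
        then show ?thesis by (simp only: distrib_left mult.assoc)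
      qed
      finally show ?thesis .
    qed
    show "decr_rearr (abs_nabla j u) t \<le> ennreal (C * (n + 1)) * (ennreal (r ^ (k - j)) * ?G + ennreal (1 / r ^ j) * ?U)" (is "_ \<le> ?B")
    \<comment> \<open>The left side may be infinite, so the contradiction comes from a real number
      strictly between the two sides, to which Chebyshev's inequality applies.\<close>
    proof (rule ccontr)
      assume nle: "\<not> ?thesis"
      obtain s where s: "?B < ennreal s" "ennreal s < decr_rearr (abs_nabla j u) t" "s \<ge> 0"
      proof -
        assume *: "\<And>s. ?B < ennreal s \<Longrightarrow> ennreal s < decr_rearr (abs_nabla j u) t \<Longrightarrow> s \<ge> 0 \<Longrightarrow> thesis"
        from nle obtain z where z: "?B < z" "z < decr_rearr (abs_nabla j u) t"
          using dense[of ?B "decr_rearr (abs_nabla j u) t"] by (auto simp: not_le)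
        show thesis
          using * z by (cases z) auto
      qed
      have "ennreal t * ennreal s \<le> weighted_sup t (abs_nabla j u)"
        using mult_le_weighted_sup[OF abs_nabla_measurable[OF u assms] s(3,2) t] s(3) t by (simp add: ennreal_mult)
      also have "\<dots> \<le> (\<Sum>is | length is = j. weighted_sup t (weak_partial u is))"
      proof (rule weighted_sup_least)
        fix H :: "real ^ 'n \<Rightarrow> ennreal" assume H: "H \<in> weights t"
        then have [measurable]: "H \<in> borel_measurable lebesgue" by (simp add: weights_def)
        have [measurable]: "weak_partial u is \<in> borel_measurable lebesgue" if "length is = j" for "is"
          using weak_partial_measurable[OF u] that assms by auto
        have "ennreal \<bar>abs_nabla j u x\<bar> \<le> (\<Sum>is | length is = j. ennreal \<bar>weak_partial u is x\<bar>)" for x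
          using ennreal_leI[OF abs_nabla_bounds(1)[of j u x]] by (simp add: sum_ennreal)
        then have "(\<integral>\<^sup>+x. ennreal \<bar>abs_nabla j u x\<bar> * H x \<partial>lebesgue) \<le> (\<integral>\<^sup>+x. (\<Sum>is | length is = j. ennreal \<bar>weak_partial u is x\<bar>) * H x \<partial>lebesgue)"
          by (intro nn_integral_mono mult_right_mono) auto
        also have "\<dots> = (\<integral>\<^sup>+x. (\<Sum>is | length is = j. ennreal \<bar>weak_partial u is x\<bar> * H x) \<partial>lebesgue)"
          by (simp only: sum_distrib_right)
        also have "\<dots> = (\<Sum>is | length is = j. \<integral>\<^sup>+x. ennreal \<bar>weak_partial u is x\<bar> * H x \<partial>lebesgue)"
          by (intro nn_integral_sum) auto
        also have "\<dots> \<le> (\<Sum>is | length is = j. weighted_sup t (weak_partial u is))"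
          by (intro sum_mono weighted_sup_upper H)
        finally show "(\<integral>\<^sup>+x. ennreal \<bar>abs_nabla j u x\<bar> * H x \<partial>lebesgue) \<le> (\<Sum>is | length is = j. weighted_sup t (weak_partial u is))" .
      qed
      also note bound
      finally have "ennreal t * ennreal s \<le> ennreal t * ?B" .
      moreover have "ennreal t * ?B < ennreal t * ennreal s"
        using s(1) t by (intro ennreal_mult_strict_left_mono) auto
      ultimately show False by simp
    qed
  qed
qed

section \<open>Orlicz norms of intermediate derivatives\<close>

text \<open>Powers with positive exponent are continuous at 0. Degenerate values can thus be
  perturbed, both when optimising in r and when approaching a Luxemburg norm from above.\<close>

lemma le_powr_limit:
  fixes s :: real
  assumes "0 < \<theta>" "\<theta> < 1" "0 \<le> a" "0 \<le> b"
    and le: "\<And>\<eta>. 0 < \<eta> \<Longrightarrow> s \<le> K * ((a + \<eta>) powr \<theta> * (b + \<eta>) powr (1 - \<theta>))"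
  shows "s \<le> K * (a powr \<theta> * b powr (1 - \<theta>))"
proof (rule tendsto_lowerbound)
  have "((\<lambda>\<eta>. K * ((a + \<eta>) powr \<theta> * (b + \<eta>) powr (1 - \<theta>))) \<longlongrightarrow> K * ((a + 0) powr \<theta> * (b + 0) powr (1 - \<theta>))) (at_right 0)"
    using assms(1-4)
    by (intro tendsto_mult tendsto_powr' tendsto_add tendsto_const tendsto_ident_at)
       (auto simp: eventually_at_filter)
  then show "((\<lambda>\<eta>. K * ((a + \<eta>) powr \<theta> * (b + \<eta>) powr (1 - \<theta>))) \<longlongrightarrow> K * (a powr \<theta> * b powr (1 - \<theta>))) (at_right 0)"
    by simp
  show "\<forall>\<^sub>F \<eta> in at_right 0. s \<le> K * ((a + \<eta>) powr \<theta> * (b + \<eta>) powr (1 - \<theta>))"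
    using le by (auto simp: eventually_at_filter)
qed simp

lemma additive_imp_multiplicative:
  fixes s C G U :: real
  assumes "1 \<le> j" "j < k" "0 \<le> C" "0 \<le> G" "0 \<le> U"
    and le: "\<And>r. 0 < r \<Longrightarrow> s \<le> C * (r ^ (k - j) * G + 1 / r ^ j * U)"
  shows "s \<le> 2 * C * (G powr (real j / real k) * U powr (1 - real j / real k))"
proof (rule le_powr_limit)
  show "0 < real j / real k" "real j / real k < 1" using assms(1,2) by auto
  fix \<eta> :: real assume \<eta>: "0 < \<eta>"
  define g h where "g = G + \<eta>" and "h = U + \<eta>"
  have gh: "0 < g" "0 < h" "G \<le> g" "U \<le> h" using assms \<eta> by (auto simp: g_def h_def)
  \<comment> \<open>This r makes the two terms equal, whence the factor 2; the perturbation by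
    \<eta> keeps the quotient positive.\<close>
  define r where "r = (h / g) powr (1 / real k)"
  have r: "0 < r" using gh by (simp add: r_def)
  have k: "real k > 0" using assms by simp
  have "r ^ (k - j) * g = (h / g) powr (1 - real j / real k) * g"
    using gh assms k by (simp add: r_def powr_realpow[symmetric] powr_powr of_nat_diff field_simps)
  also have "\<dots> = g powr (real j / real k) * h powr (1 - real j / real k)"
    using gh by (simp add: powr_divide powr_diff field_simps)
  finally have 1: "r ^ (k - j) * g = g powr (real j / real k) * h powr (1 - real j / real k)" .
  have "1 / r ^ j * h = h / (h / g) powr (real j / real k)"
    using gh assms k by (simp add: r_def powr_realpow[symmetric] powr_powr)
  also have "\<dots> = g powr (real j / real k) * h powr (1 - real j / real k)"
    using gh by (simp add: powr_divide powr_diff field_simps)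
  finally have 2: "1 / r ^ j * h = g powr (real j / real k) * h powr (1 - real j / real k)" .
  have "s \<le> C * (r ^ (k - j) * G + 1 / r ^ j * U)" by (rule le[OF r])
  also have "\<dots> \<le> C * (r ^ (k - j) * g + 1 / r ^ j * h)"
    using gh r assms by (intro mult_left_mono add_mono) auto
  also have "\<dots> = 2 * C * (g powr (real j / real k) * h powr (1 - real j / real k))"
    unfolding 1 2 by simp
  finally show "s \<le> 2 * C * ((G + \<eta>) powr (real j / real k) * (U + \<eta>) powr (1 - real j / real k))"
    by (simp add: g_def h_def)
qed (use assms in auto)

lemma interp_ennreal: "0 \<le> a \<Longrightarrow> 0 \<le> b \<Longrightarrow> interp \<theta> (ennreal a) (ennreal b) = ennreal (a powr \<theta> * b powr (1 - \<theta>))"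
  by (simp add: interp_def)

lemma interp_infinity [simp]: "interp \<theta> \<infinity> b = \<infinity>" "interp \<theta> a \<infinity> = \<infinity>" "interp \<theta> top b = \<infinity>" "interp \<theta> a top = \<infinity>"
  by (simp_all add: interp_def)

lemma decr_rearr_nabla_interp:
  assumes "1 \<le> j" "j < k"
  shows "\<exists>C>0. \<forall>(u :: real ^ 'n \<Rightarrow> real) t. weakly_differentiable k u \<longrightarrow> 0 < t \<longrightarrow>
    decr_rearr (abs_nabla j u) t \<le> ennreal C * interp (real j / real k) (max_rearr (abs_nabla k u) t) (max_rearr u t)"
proof -
  obtain C where C: "C \<ge> 0" "\<And>(u :: real ^ 'n \<Rightarrow> real) t r. weakly_differentiable k u \<Longrightarrow> 0 < t \<Longrightarrow> 0 < r \<Longrightarrow>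
    decr_rearr (abs_nabla j u) t \<le> ennreal C * (ennreal (r ^ (k - j)) * max_rearr (abs_nabla k u) t + ennreal (1 / r ^ j) * max_rearr u t)"
    using decr_rearr_nabla_additive[of j k] assms by (metis less_imp_le)
  show ?thesis
  \<comment> \<open>The summand 1 makes the constant positive, so that an infinite right side stays
    infinite: in \<open>ennreal\<close>, zero times infinity is zero.\<close>
  proof (intro exI[of _ "2 * C + 1"] conjI allI impI)
    show "0 < 2 * C + 1" using C(1) by simp
    fix u :: "real ^ 'n \<Rightarrow> real" and t :: real
    assume u: "weakly_differentiable k u" and t: "0 < t"
    let ?\<theta> = "real j / real k"
    show "decr_rearr (abs_nabla j u) t \<le> ennreal (2 * C + 1) * interp ?\<theta> (max_rearr (abs_nabla k u) t) (max_rearr u t)"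
    proof (cases "max_rearr (abs_nabla k u) t = top \<or> max_rearr u t = top")
      case True
      then have "interp ?\<theta> (max_rearr (abs_nabla k u) t) (max_rearr u t) = top" by auto
      then show ?thesis using C(1) by (simp add: ennreal_mult_top)
    next
      case False
      then obtain G U where G: "G \<ge> 0" "max_rearr (abs_nabla k u) t = ennreal G" and U: "U \<ge> 0" "max_rearr u t = ennreal U"
        by (metis ennreal_cases)
      have le: "decr_rearr (abs_nabla j u) t \<le> ennreal (C * (r ^ (k - j) * G + 1 / r ^ j * U))" if r: "0 < r" for r
        using C(2)[OF u t r] C(1) G U r by (simp add: ennreal_mult[symmetric] ennreal_plus[symmetric] del: ennreal_plus)
      \<comment> \<open>A single r shows that the left side is finite, so the optimisation can take
        place in the reals.\<close>
      from le[of 1] obtain s where s: "s \<ge> 0" "decr_rearr (abs_nabla j u) t = ennreal s"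
        by (cases "decr_rearr (abs_nabla j u) t") (auto simp: top_unique)
      have "s \<le> 2 * C * (G powr ?\<theta> * U powr (1 - ?\<theta>))"
        using le C(1) G(1) U(1) unfolding s(2)
        by (intro additive_imp_multiplicative assms) (auto simp: ennreal_le_iff intro!: add_nonneg_nonneg mult_nonneg_nonneg)
      also have "\<dots> \<le> (2 * C + 1) * (G powr ?\<theta> * U powr (1 - ?\<theta>))"
        by (intro mult_right_mono) auto
      finally show ?thesis unfolding s(2) G(2) U(2) interp_ennreal[OF G(1) U(1)]
        using C(1) by (simp add: ennreal_mult[symmetric] ennreal_leI del: ennreal_plus)
    qed
  qed
qed

text \<open>
  Where \<open>g\<close>, \<open>h\<close> are normalised, both are controlled by the inverses at
  \<open>y = max (B g) (C h)\<close>, so that \<open>inverse_condition\<close> applies at the level \<open>y\<close>.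
\<close>

lemma luxemburg_norm_interp_le:
  assumes A: "young_function A" and B: "young_function B" and C: "young_function C"
    and \<theta>: "0 < \<theta>" "\<theta> < 1" and ic: "inverse_condition \<theta> A B C" and "0 < K"
  shows "\<exists>c>0. \<forall>(M :: 'a measure) f g h. g \<in> borel_measurable M \<longrightarrow> h \<in> borel_measurable M \<longrightarrow>
    (\<forall>x\<in>space M. f x \<le> ennreal K * interp \<theta> (g x) (h x)) \<longrightarrow>
    luxemburg_norm A M f \<le> ennreal c * interp \<theta> (luxemburg_norm B M g) (luxemburg_norm C M h)"
proof -
  obtain c where c: "c > 0" "\<And>t. t > 0 \<Longrightarrow> young_inv B t powr \<theta> * young_inv C t powr (1 - \<theta>) \<le> c * young_inv A t"
    using ic unfolding inverse_condition_def by blast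
  show ?thesis
  proof (intro exI[of _ "2 * c * K"] conjI allI impI)
    show "0 < 2 * c * K" using c(1) \<open>0 < K\<close> by simp
    fix M :: "'a measure" and f g h
    assume [measurable]: "g \<in> borel_measurable M" "h \<in> borel_measurable M"
      and f: "\<forall>x\<in>space M. f x \<le> ennreal K * interp \<theta> (g x) (h x)"
    note young_ext_measurable[OF B, measurable] young_ext_measurable[OF C, measurable]
    show "luxemburg_norm A M f \<le> ennreal (2 * c * K) * interp \<theta> (luxemburg_norm B M g) (luxemburg_norm C M h)"
    proof (cases "luxemburg_norm B M g = top \<or> luxemburg_norm C M h = top")
      case True
      then have "interp \<theta> (luxemburg_norm B M g) (luxemburg_norm C M h) = top" by auto
      then show ?thesis using c(1) \<open>0 < K\<close> by (simp add: ennreal_mult_top)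
    next
      case False
      then obtain p q where p: "p \<ge> 0" "luxemburg_norm B M g = ennreal p" and q: "q \<ge> 0" "luxemburg_norm C M h = ennreal q"
        by (metis ennreal_cases)
      have le: "luxemburg_norm A M f \<le> ennreal (2 * c * K * ((p + \<eta>) powr \<theta> * (q + \<eta>) powr (1 - \<theta>)))" if \<eta>: "0 < \<eta>" for \<eta>
      proof -
        define b' c' where "b' = p + \<eta>" and "c' = q + \<eta>"
        have pos: "b' > 0" "c' > 0" using p q \<eta> by (auto simp: b'_def c'_def)
        \<comment> \<open>The 2 pays for adding two modulars, each at most 1: by convexity, halving
          the argument of \<open>A\<close> at least halves its value.\<close>
        define l where "l = 2 * c * K * (b' powr \<theta> * c' powr (1 - \<theta>))"
        have l: "l > 0" using c(1) \<open>0 < K\<close> pos by (simp add: l_def)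
        have mB: "(\<integral>\<^sup>+ x. young_ext B (g x / ennreal b') \<partial>M) \<le> 1"
          by (rule luxemburg_normD[OF B]) (use p \<eta> in \<open>auto simp: b'_def ennreal_less_iff simp del: ennreal_plus\<close>)
        have mC: "(\<integral>\<^sup>+ x. young_ext C (h x / ennreal c') \<partial>M) \<le> 1"
          by (rule luxemburg_normD[OF C]) (use q \<eta> in \<open>auto simp: c'_def ennreal_less_iff simp del: ennreal_plus\<close>)
        have pw: "young_ext A (f x / ennreal l) \<le> ennreal (1 / 2) * (young_ext B (g x / ennreal b') + young_ext C (h x / ennreal c'))"
          if x: "x \<in> space M" for x
        proof (cases "g x = top \<or> h x = top")
          case True
          then have "young_ext B (g x / ennreal b') = \<infinity> \<or> young_ext C (h x / ennreal c') = \<infinity>"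
            using pos by (auto simp: young_ext_def ennreal_top_divide)
          then have "ennreal (1 / 2) * (young_ext B (g x / ennreal b') + young_ext C (h x / ennreal c')) = top"
            by (auto simp: ennreal_mult_top)
          then show ?thesis by simp
        next
          case False
          then obtain G H where G: "G \<ge> 0" "g x = ennreal G" and H: "H \<ge> 0" "h x = ennreal H"
            by (metis ennreal_cases)
          have eq: "young_ext B (g x / ennreal b') = ennreal (B (G / b'))" "young_ext C (h x / ennreal c') = ennreal (C (H / c'))"
            using pos G H by (simp_all add: divide_ennreal young_ext_def)
          define y where "y = max (B (G / b')) (C (H / c'))"
          have n: "0 \<le> G / b'" "0 \<le> H / c'" using G H pos by auto
          then have nn: "0 \<le> B (G / b')" "0 \<le> C (H / c')" using young_nonneg[OF B] young_nonneg[OF C] by auto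
          then have y0: "y \<ge> 0" by (simp add: y_def)
          have 1: "G / b' \<le> young_inv B y" "H / c' \<le> young_inv C y"
            using young_le_iff[OF B n(1) y0] young_le_iff[OF C n(2) y0] by (auto simp: y_def)
          then have 2: "G \<le> b' * young_inv B y" "H \<le> c' * young_inv C y" using pos by (simp_all add: field_simps)
          have yi: "0 \<le> young_inv B y" "0 \<le> young_inv C y" "0 \<le> young_inv A y"
            using young_inv_nonneg[OF B y0] young_inv_nonneg[OF C y0] young_inv_nonneg[OF A y0] by auto
          have 3: "G powr \<theta> * H powr (1 - \<theta>) \<le> b' powr \<theta> * c' powr (1 - \<theta>) * (c * young_inv A y)"
          \<comment> \<open>The hypothesis on the inverses concerns positive arguments only; at 0
            the left side vanishes because \<open>G\<close> does.\<close>
          proof (cases "y = 0")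
            case True
            have "young_inv B 0 = 0" using young_young_inv[OF B, of 0] young_inv_nonneg[OF B, of 0] young_less[OF B, of 0 "young_inv B 0"] young_zero[OF B]
              by force
            then have "G = 0" using 2(1) G(1) True by simp
            then show ?thesis using pos c(1) yi by simp
          next
            case False
            have "G powr \<theta> * H powr (1 - \<theta>) \<le> (b' * young_inv B y) powr \<theta> * (c' * young_inv C y) powr (1 - \<theta>)"
              using 2 G(1) H(1) \<theta> by (intro mult_mono powr_mono2) auto
            also have "\<dots> = b' powr \<theta> * c' powr (1 - \<theta>) * (young_inv B y powr \<theta> * young_inv C y powr (1 - \<theta>))"
              using pos yi by (simp add: powr_mult)
            also have "\<dots> \<le> b' powr \<theta> * c' powr (1 - \<theta>) * (c * young_inv A y)"
              using False y0 by (intro mult_left_mono c(2)) auto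
            finally show ?thesis .
          qed
          have "f x \<le> ennreal (K * (G powr \<theta> * H powr (1 - \<theta>)))"
            using f x G H \<open>0 < K\<close> by (auto simp: interp_ennreal ennreal_mult[symmetric])
          also have "\<dots> \<le> ennreal (l * (young_inv A y / 2))"
          proof (rule ennreal_leI)
            have "K * (G powr \<theta> * H powr (1 - \<theta>)) \<le> K * (b' powr \<theta> * c' powr (1 - \<theta>) * (c * young_inv A y))"
              using 3 \<open>0 < K\<close> by (intro mult_left_mono) auto
            then show "K * (G powr \<theta> * H powr (1 - \<theta>)) \<le> l * (young_inv A y / 2)"
              by (simp add: l_def mult_ac)
          qed
          finally have "f x / ennreal l \<le> ennreal (l * (young_inv A y / 2)) / ennreal l"
            by (rule divide_right_mono_ennreal)
          also have "\<dots> = ennreal (1 / 2) * ennreal (young_inv A y)"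
          proof -
            have "ennreal (l * (young_inv A y / 2)) / ennreal l = ennreal (1 / 2 * young_inv A y)"
              using l yi by (simp add: divide_ennreal)
            also have "\<dots> = ennreal (1 / 2) * ennreal (young_inv A y)"
              by (rule ennreal_mult) (use yi in auto)
            finally show ?thesis .
          qed
          finally have "young_ext A (f x / ennreal l) \<le> ennreal (1 / 2) * young_ext A (ennreal (young_inv A y))"
            by (rule order_trans[OF young_ext_mono[OF A]]) (rule young_ext_scale[OF A]; simp)
          also have "young_ext A (ennreal (young_inv A y)) = ennreal y"
            using yi y0 by (simp add: young_ext_ennreal[OF A] young_young_inv[OF A])
          also have "ennreal y \<le> ennreal (B (G / b')) + ennreal (C (H / c'))"
            using nn by (simp add: y_def ennreal_plus[symmetric] ennreal_leI del: ennreal_plus)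
          finally show ?thesis unfolding eq by (simp add: mult_left_mono)
        qed
        have "(\<integral>\<^sup>+ x. young_ext A (f x / ennreal l) \<partial>M) \<le>
          (\<integral>\<^sup>+ x. ennreal (1 / 2) * (young_ext B (g x / ennreal b') + young_ext C (h x / ennreal c')) \<partial>M)"
          by (rule nn_integral_mono) (rule pw)
        also have "\<dots> = ennreal (1 / 2) * ((\<integral>\<^sup>+ x. young_ext B (g x / ennreal b') \<partial>M) + (\<integral>\<^sup>+ x. young_ext C (h x / ennreal c') \<partial>M))"
          by (simp add: nn_integral_cmult nn_integral_add)
        also have "\<dots> \<le> ennreal (1 / 2) * (1 + 1)"
          by (intro mult_left_mono add_mono mB mC) simp
        also have "\<dots> = 1"
        proof -
          have "ennreal (1 / 2) * ennreal 2 = ennreal (1 / 2 * 2)" by (rule ennreal_mult[symmetric]) auto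
          then show ?thesis by simp
        qed
        finally show ?thesis
          using luxemburg_norm_le[OF l] by (simp add: l_def b'_def c'_def)
      qed
      from le[of 1] obtain s where s: "s \<ge> 0" "luxemburg_norm A M f = ennreal s"
        by (cases "luxemburg_norm A M f") (auto simp: top_unique)
      have "s \<le> 2 * c * K * (p powr \<theta> * q powr (1 - \<theta>))"
      proof (rule le_powr_limit[OF \<theta> p(1) q(1)])
        fix \<eta> :: real assume "0 < \<eta>"
        then show "s \<le> 2 * c * K * ((p + \<eta>) powr \<theta> * (q + \<eta>) powr (1 - \<theta>))"
          using le[of \<eta>] c(1) \<open>0 < K\<close> unfolding s(2) by (subst (asm) ennreal_le_iff) auto
      qed
      then show ?thesis
        unfolding s(2) p(2) q(2) interp_ennreal[OF p(1) q(1)] using c(1) \<open>0 < K\<close>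
        by (simp add: ennreal_mult[symmetric] ennreal_leI)
    qed
  qed
qed

lemma orlicz_norm_eq_halfline:
  assumes "young_function A" "u \<in> borel_measurable lebesgue"
  shows "orlicz_norm A u = orlicz_norm_halfline A (decr_rearr u)"
proof -
  have "r > 0 \<and> (\<integral>\<^sup>+ x. young_ext A (ennreal \<bar>u x\<bar> / ennreal r) \<partial>lebesgue) \<le> 1 \<longleftrightarrow>
    r > 0 \<and> (\<integral>\<^sup>+ x. young_ext A (decr_rearr u x / ennreal r) \<partial>lebesgue_on {0<..}) \<le> 1" for r
    using young_modular_decr_rearr[OF assms] by auto
  then show ?thesis unfolding orlicz_norm_def orlicz_norm_halfline_def luxemburg_norm_def by simp
qed

lemma halfline_measurable: "f \<in> borel_measurable borel \<Longrightarrow> f \<in> borel_measurable (lebesgue_on {0::real<..})"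
  by (intro measurable_restrict_space1 measurable_completion) simp

lemma orlicz_norm_nabla_le_max_rearr:
  assumes "1 \<le> j" and "j < k" and "young_function A" "young_function B" "young_function C"
    and "inverse_condition (real j / real k) A B C"
  shows "\<exists>c1>0. \<forall>u :: real ^ 'n \<Rightarrow> real. weakly_differentiable k u \<longrightarrow>
    orlicz_norm A (abs_nabla j u) \<le> ennreal c1 * interp (real j / real k)
      (orlicz_norm_halfline B (max_rearr (abs_nabla k u))) (orlicz_norm_halfline C (max_rearr u))"
proof -
  obtain K where K: "K > 0" "\<And>(u :: real ^ 'n \<Rightarrow> real) t. weakly_differentiable k u \<Longrightarrow> 0 < t \<Longrightarrow>
    decr_rearr (abs_nabla j u) t \<le> ennreal K * interp (real j / real k) (max_rearr (abs_nabla k u) t) (max_rearr u t)"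
    using decr_rearr_nabla_interp[OF assms(1,2)] by blast
  have \<theta>: "0 < real j / real k" "real j / real k < 1" using assms(1,2) by auto
  obtain c where c: "c > 0" and Hoelder: "\<And>(M :: real measure) f g h. g \<in> borel_measurable M \<Longrightarrow> h \<in> borel_measurable M \<Longrightarrow>
    (\<forall>x\<in>space M. f x \<le> ennreal K * interp (real j / real k) (g x) (h x)) \<Longrightarrow>
    luxemburg_norm A M f \<le> ennreal c * interp (real j / real k) (luxemburg_norm B M g) (luxemburg_norm C M h)"
    using luxemburg_norm_interp_le[OF assms(3,4,5) \<theta> assms(6) K(1)] by blast
  show ?thesis
  proof (intro exI[of _ c] conjI allI impI c)
    fix u :: "real ^ 'n \<Rightarrow> real" assume u: "weakly_differentiable k u"
    have "orlicz_norm A (abs_nabla j u) = luxemburg_norm A (lebesgue_on {0<..}) (decr_rearr (abs_nabla j u))"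
      using orlicz_norm_eq_halfline[OF assms(3) abs_nabla_measurable[OF u]] assms(2) by (simp add: orlicz_norm_halfline_def)
    also have "\<dots> \<le> ennreal c * interp (real j / real k)
      (orlicz_norm_halfline B (max_rearr (abs_nabla k u))) (orlicz_norm_halfline C (max_rearr u))"
      unfolding orlicz_norm_halfline_def using K(2)[OF u]
      by (intro Hoelder halfline_measurable max_rearr_measurable) auto
    finally show "orlicz_norm A (abs_nabla j u) \<le> ennreal c * interp (real j / real k)
      (orlicz_norm_halfline B (max_rearr (abs_nabla k u))) (orlicz_norm_halfline C (max_rearr u))" .
  qed
qed

section \<open>Dilations and the maximal rearrangement\<close>

lemma nn_integral_halfline_dilate:
  fixes f :: "real \<Rightarrow> ennreal"
  assumes f: "f \<in> borel_measurable (lebesgue_on {0<..})" and "0 < t"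
  shows "(\<integral>\<^sup>+s. f (s / t) \<partial>lebesgue_on {0<..}) = ennreal t * (\<integral>\<^sup>+s. f s \<partial>lebesgue_on {0<..})"
proof -
  have S: "{0::real<..} \<in> sets lebesgue" by (rule sets_completionI_sets) simp
  define F where "F s = f s * indicator {0<..} s" for s
  have F: "F \<in> borel_measurable lebesgue"
    unfolding F_def[abs_def] using f S by (subst (asm) borel_measurable_restrict_space_iff_ennreal) auto
  have "(\<integral>\<^sup>+s. f s \<partial>lebesgue_on {0<..}) = (\<integral>\<^sup>+s. F s \<partial>lebesgue)"
    unfolding F_def using S by (subst nn_integral_restrict_space) auto
  also have "\<dots> = ennreal \<bar>1 / t\<bar> * (\<integral>\<^sup>+s. F (0 + 1 / t * s) \<partial>lebesgue)"
    by (rule nn_integral_real_affine_lebesgue[OF F]) (use assms in auto)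
  also have "(\<integral>\<^sup>+s. F (0 + 1 / t * s) \<partial>lebesgue) = (\<integral>\<^sup>+s. f (s / t) * indicator {0<..} s \<partial>lebesgue)"
    using assms by (intro nn_integral_cong) (auto simp: F_def indicator_def zero_less_divide_iff)
  also have "\<dots> = (\<integral>\<^sup>+s. f (s / t) \<partial>lebesgue_on {0<..})"
    using S by (subst nn_integral_restrict_space) auto
  finally have "ennreal t * (\<integral>\<^sup>+s. f s \<partial>lebesgue_on {0<..}) =
     (ennreal t * ennreal (1 / t)) * (\<integral>\<^sup>+s. f (s / t) \<partial>lebesgue_on {0<..})"
    using assms by (simp add: mult.assoc)
  also have "ennreal t * ennreal (1 / t) = 1"
    using assms by (simp add: ennreal_mult[symmetric])
  finally show ?thesis by simp
qed

lemma ennreal_le_mult_limit: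
  assumes "0 \<le> c" "0 \<le> p" "\<And>r. p < r \<Longrightarrow> x \<le> ennreal (c * r)"
  shows "x \<le> ennreal (c * p)"
proof (rule ennreal_le_epsilon)
  fix e :: real assume "0 < e"
  define d where "d = e / (c + 1)"
  have d: "d > 0" using \<open>0 < e\<close> assms(1) by (simp add: d_def)
  have "x \<le> ennreal (c * (p + d))" using assms(3)[of "p + d"] d by simp
  also have "\<dots> \<le> ennreal (c * p + e)"
  proof (rule ennreal_leI)
    have "c * d \<le> e" using \<open>0 < e\<close> assms(1) by (simp add: d_def field_simps)
    then show "c * (p + d) \<le> c * p + e" by (simp add: distrib_left)
  qed
  finally show "x \<le> ennreal (c * p) + ennreal e" using assms(1,2) \<open>0 < e\<close> by simp
qed

text \<open>Stretching by t multiplies the modular by t, while convexity gains the factor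
  \<open>1 / t\<close> when the argument is divided by t.\<close>

lemma dilation_norm_orlicz_le:
  assumes B: "young_function B" and t: "1 \<le> t"
  shows "dilation_norm (orlicz_norm_halfline B) t \<le> ennreal t"
  unfolding dilation_norm_def
proof (rule SUP_least, clarify)
  fix f :: "real \<Rightarrow> real"
  assume f: "f \<in> borel_measurable (lebesgue_on {0<..})" and le: "orlicz_norm_halfline B (\<lambda>s. ennreal \<bar>f s\<bar>) \<le> 1"
  note f[measurable] young_ext_measurable[OF B, measurable]
  have "orlicz_norm_halfline B (\<lambda>s. ennreal \<bar>f (s / t)\<bar>) \<le> ennreal (t * r)" if r: "1 < r" for r
  proof -
    have "luxemburg_norm B (lebesgue_on {0<..}) (\<lambda>s. ennreal \<bar>f s\<bar>) < ennreal r"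
      using le r unfolding orlicz_norm_halfline_def
      by (metis ennreal_1 ennreal_less_iff order_le_less_trans zero_le_one)
    then have m: "(\<integral>\<^sup>+s. young_ext B (ennreal \<bar>f s\<bar> / ennreal r) \<partial>lebesgue_on {0<..}) \<le> 1"
      by (rule luxemburg_normD[OF B])
    have "young_ext B (ennreal \<bar>f (s / t)\<bar> / ennreal (t * r)) \<le> ennreal (1 / t) * young_ext B (ennreal \<bar>f (s / t)\<bar> / ennreal r)" for s
    proof -
      have "ennreal \<bar>f (s / t)\<bar> / ennreal (t * r) = ennreal (1 / t) * (ennreal \<bar>f (s / t)\<bar> / ennreal r)"
        using t r by (simp add: divide_ennreal ennreal_mult[symmetric])
      then show ?thesis using young_ext_scale[OF B, of "1 / t"] t by simp
    qed
    then have "(\<integral>\<^sup>+s. young_ext B (ennreal \<bar>f (s / t)\<bar> / ennreal (t * r)) \<partial>lebesgue_on {0<..}) \<le>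
       (\<integral>\<^sup>+s. ennreal (1 / t) * young_ext B (ennreal \<bar>f (s / t)\<bar> / ennreal r) \<partial>lebesgue_on {0<..})"
      by (rule nn_integral_mono)
    also have "\<dots> = ennreal t * (\<integral>\<^sup>+s. ennreal (1 / t) * young_ext B (ennreal \<bar>f s\<bar> / ennreal r) \<partial>lebesgue_on {0<..})"
      by (rule nn_integral_halfline_dilate) (use t in auto)
    also have "\<dots> = (ennreal t * ennreal (1 / t)) * (\<integral>\<^sup>+s. young_ext B (ennreal \<bar>f s\<bar> / ennreal r) \<partial>lebesgue_on {0<..})"
      by (simp add: nn_integral_cmult mult.assoc)
    also have "ennreal t * ennreal (1 / t) = 1"
      using t by (simp add: ennreal_mult[symmetric])
    finally show ?thesis
      unfolding orlicz_norm_halfline_def using t r m by (intro luxemburg_norm_le) auto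
  qed
  then have "orlicz_norm_halfline B (\<lambda>s. ennreal \<bar>f (s / t)\<bar>) \<le> ennreal (t * 1)"
    by (rule ennreal_le_mult_limit[rotated 2]) (use t in auto)
  then show "orlicz_norm_halfline B (\<lambda>s. ennreal \<bar>f (s / t)\<bar>) \<le> ennreal t" by simp
qed

text \<open>
  Otherwise the dilation norm is \<open>t\<close> for all \<open>t > 1\<close> and the quotient defining the index is constantly
  \<open>1\<close>. Hence the existence of the limit, without which \<open>Lim\<close> is meaningless, need not be known.
\<close>

lemma dilation_norm_less:
  assumes B: "young_function B" and "upper_boyd_index (orlicz_norm_halfline B) < 1"
  shows "\<exists>t>1. dilation_norm (orlicz_norm_halfline B) t < ennreal t"
proof (rule ccontr)
  assume "\<not> ?thesis"
  then have eq: "dilation_norm (orlicz_norm_halfline B) t = ennreal t" if "t > 1" for t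
    using dilation_norm_orlicz_le[OF B, of t] that by (meson antisym leI less_imp_le)
  have "((\<lambda>t. ln (enn2real (dilation_norm (orlicz_norm_halfline B) t)) / ln t) \<longlongrightarrow> 1) at_top"
    by (rule tendsto_eventually, rule eventually_mono[OF eventually_gt_at_top[of 1]]) (simp add: eq)
  then have "upper_boyd_index (orlicz_norm_halfline B) = 1"
    unfolding upper_boyd_index_def by (intro tendsto_Lim) auto
  then show False using assms(2) by simp
qed

text \<open>Iteration of one dilation, with geometric growth of the norm. Since \<kappa> lies
  strictly above the dilation norm, each step yields a modular bound with exactly \<kappa>. The
  rescaled function \<open>g\<close> has norm at most 1 and so is admissible in the
  supremum.\<close>

lemma modular_dilate_power:
  fixes f :: "real \<Rightarrow> real"
  assumes B: "young_function B" and t: "1 < t" and d: "dilation_norm (orlicz_norm_halfline B) t < ennreal \<kappa>"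
    and f: "f \<in> borel_measurable borel" and "0 < r"
    and m: "(\<integral>\<^sup>+s. young_ext B (ennreal \<bar>f s\<bar> / ennreal r) \<partial>lebesgue_on {0<..}) \<le> 1"
  shows "(\<integral>\<^sup>+s. young_ext B (ennreal \<bar>f (s / t ^ m)\<bar> / ennreal (\<kappa> ^ m * r)) \<partial>lebesgue_on {0<..}) \<le> 1"
proof (induction m)
  case 0 then show ?case using m by simp
next
  case (Suc m)
  have \<kappa>: "\<kappa> > 0" using d by (metis ennreal_eq_0_iff not_le not_less_zero)
  define r' where "r' = \<kappa> ^ m * r"
  have r': "r' > 0" using \<kappa> \<open>0 < r\<close> by (simp add: r'_def)
  define g where "g s = f (s / t ^ m) / r'" for s
  note f[measurable]
  have g: "g \<in> borel_measurable (lebesgue_on {0<..})"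
    unfolding g_def[abs_def] by (intro halfline_measurable) measurable
  have eq: "ennreal \<bar>g s\<bar> = ennreal \<bar>f (s / t ^ m)\<bar> / ennreal r'" for s
    using r' by (simp add: g_def divide_ennreal)
  have "orlicz_norm_halfline B (\<lambda>s. ennreal \<bar>g s\<bar>) \<le> ennreal 1"
    unfolding orlicz_norm_halfline_def using Suc
    by (intro luxemburg_norm_le) (auto simp: eq r'_def divide_ennreal_def)
  then have "orlicz_norm_halfline B (\<lambda>s. ennreal \<bar>g (s / t)\<bar>) \<le> dilation_norm (orlicz_norm_halfline B) t"
    unfolding dilation_norm_def using g by (intro SUP_upper) auto
  then have "luxemburg_norm B (lebesgue_on {0<..}) (\<lambda>s. ennreal \<bar>g (s / t)\<bar>) < ennreal \<kappa>"
    using d unfolding orlicz_norm_halfline_def by (rule order_le_less_trans)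
  from luxemburg_normD[OF B this]
  have "(\<integral>\<^sup>+s. young_ext B (ennreal \<bar>g (s / t)\<bar> / ennreal \<kappa>) \<partial>lebesgue_on {0<..}) \<le> 1" .
  moreover have "ennreal \<bar>g (s / t)\<bar> / ennreal \<kappa> = ennreal \<bar>f (s / t ^ Suc m)\<bar> / ennreal (\<kappa> ^ Suc m * r)" for s
    using \<kappa> r' t \<open>0 < r\<close> by (simp add: g_def r'_def divide_ennreal divide_divide_eq_left mult_ac)
  ultimately show ?case by (simp only:)
qed

text \<open>Jensen's inequality for a countable convex combination. It is proved for partial sums
  and passed to the limit through the closed sublevel sets given by
  \<open>young_ext_le_iff\<close>.\<close>

lemma young_ext_suminf_le:
  assumes A: "young_function A" and a: "\<And>m. 0 \<le> a m" "a sums 1"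
  shows "young_ext A (\<Sum>m. ennreal (a m) * x m) \<le> (\<Sum>m. ennreal (a m) * young_ext A (x m))"
proof -
  have part: "young_ext A (\<Sum>m<M. ennreal (a m) * x m) \<le> (\<Sum>m<M. ennreal (a m) * young_ext A (x m))" for M
  proof (cases "\<exists>m<M. a m > 0 \<and> x m = top")
    case True
    then obtain m where m: "m < M" "a m > 0" "x m = top" by blast
    then have "ennreal (a m) * young_ext A (x m) = top" by (simp add: young_ext_def ennreal_mult_top)
    moreover have "ennreal (a m) * young_ext A (x m) \<le> (\<Sum>m<M. ennreal (a m) * young_ext A (x m))"
      using m(1) by (intro member_le_sum) auto
    ultimately have "(\<Sum>m<M. ennreal (a m) * young_ext A (x m)) = top" by (simp only: top_unique)
    then show ?thesis by (simp only: top_greatest)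
  next
    case False
    define y where "y m = (if m < M then enn2real (x m) else 0)" for m
    \<comment> \<open>A partial sum of the coefficients may fall short of 1. The missing mass is put
      at index \<open>M\<close>, where the point \<open>y M\<close> is 0 and \<open>A\<close>
      vanishes.\<close>
    define b where "b m = (if m < M then a m else 1 - sum a {..<M})" for m
    have y: "y m \<ge> 0" for m by (simp add: y_def)
    have "sum a {..<M} \<le> 1"
      using sum_le_suminf[of a "{..<M}"] a by (auto simp: sums_iff)
    then have b: "b m \<ge> 0" for m using a(1) by (simp add: b_def)
    have bsum: "sum b {..M} = 1"
      by (simp add: lessThan_Suc_atMost[symmetric] b_def)
    have 1: "ennreal (a m) * x m = ennreal (a m * y m)" if "m < M" for m
      using False that a(1)[of m] by (cases "x m"; cases "a m = 0") (auto simp: y_def ennreal_mult)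
    have 2: "ennreal (a m) * young_ext A (x m) = ennreal (a m * A (y m))" if "m < M" for m
      using False that a(1)[of m] young_nonneg[OF A]
      by (cases "x m"; cases "a m = 0") (auto simp: y_def young_ext_def ennreal_mult)
    have "young_ext A (\<Sum>m<M. ennreal (a m) * x m) = young_ext A (ennreal (\<Sum>m<M. a m * y m))"
      using 1 a(1) y by (simp add: sum_ennreal)
    also have "\<dots> = ennreal (A (\<Sum>m<M. a m * y m))"
      using a(1) y by (intro young_ext_ennreal[OF A] sum_nonneg) auto
    also have "(\<Sum>m<M. a m * y m) = (\<Sum>m\<le>M. b m *\<^sub>R y m)"
      by (simp add: lessThan_Suc_atMost[symmetric] b_def y_def)
    also have "A \<dots> \<le> (\<Sum>m\<le>M. b m * A (y m))"
    proof (rule convex_on_sum)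
      show "convex_on {0..} A" using A by (simp add: young_function_def)
    qed (use b bsum y in auto)
    also have "\<dots> = (\<Sum>m<M. a m * A (y m))"
      by (simp add: lessThan_Suc_atMost[symmetric] b_def y_def young_zero[OF A])
    finally show ?thesis
      using 2 a(1) young_nonneg[OF A y] by (simp add: sum_ennreal ennreal_leI)
  qed
  show ?thesis
  proof (cases "\<Sum>m. ennreal (a m) * young_ext A (x m)")
    case (real l)
    have "(\<Sum>m<M. ennreal (a m) * x m) \<le> ennreal (young_inv A l)" for M
    proof -
      have "(\<Sum>m<M. ennreal (a m) * young_ext A (x m)) \<le> ennreal l"
        unfolding real(2)[symmetric] by (rule sum_le_suminf) auto
      then show ?thesis using part[of M] young_ext_le_iff[OF A real(1)] by (meson order_trans)
    qed
    then have "(\<Sum>m. ennreal (a m) * x m) \<le> ennreal (young_inv A l)"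
      unfolding suminf_eq_SUP by (rule SUP_least)
    then show ?thesis using young_ext_le_iff[OF A real(1)] real(2) by simp
  qed simp
qed

text \<open>The interval (0, t) is cut at the points \<open>t / q ^ m\<close>. On each piece the
  rearrangement is at most its value at the left end, and the length of the piece is at most
  \<open>t / q ^ m\<close>.\<close>

lemma max_rearr_le_dilations:
  assumes q: "1 < q" and t: "0 < t"
  shows "max_rearr u t \<le> (\<Sum>m. ennreal (1 / q ^ m) * decr_rearr u (t / q ^ Suc m))"
proof -
  have mono: "t / q ^ Suc m \<le> t / q ^ m" for m
    using q t by (simp add: field_simps)
  have le: "decr_rearr u s * indicator {0<..<t} s \<le> (\<Sum>m. decr_rearr u (t / q ^ Suc m) * indicator {t / q ^ Suc m..<t / q ^ m} s)" for s
  proof (cases "0 < s \<and> s < t")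
    case True
    then have "\<exists>m. t / q ^ m \<le> s"
    proof -
      obtain m where "t / s < q ^ m" using real_arch_pow[OF q] by blast
      then show ?thesis using True q by (intro exI[of _ m]) (simp add: field_simps)
    qed
    \<comment> \<open>The least such m is the index of the first cut not above s; it is not 0
      because s lies below t.\<close>
    then obtain m where m: "t / q ^ m \<le> s" "\<And>i. i < m \<Longrightarrow> \<not> t / q ^ i \<le> s"
      using exists_least_iff[of "\<lambda>m. t / q ^ m \<le> s"] by auto
    have "m \<noteq> 0" using m(1) True by (cases m) auto
    then obtain n where n: "m = Suc n" by (cases m) auto
    have "decr_rearr u s * indicator {0<..<t} s \<le> decr_rearr u (t / q ^ Suc n) * indicator {t / q ^ Suc n..<t / q ^ n} s"
      using m(1) m(2)[of n] True by (auto simp: n indicator_def intro!: decr_rearr_antimono)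
    also have "\<dots> \<le> (\<Sum>m. decr_rearr u (t / q ^ Suc m) * indicator {t / q ^ Suc m..<t / q ^ m} s)"
    proof -
      have "F n \<le> (\<Sum>m. F m)" for F :: "nat \<Rightarrow> ennreal"
        using sum_le_suminf[of F "{n}"] by simp
      then show ?thesis .
    qed
    finally show ?thesis .
  qed simp
  have "(\<integral>\<^sup>+ s \<in> {0<..<t}. decr_rearr u s \<partial>lebesgue) \<le>
     (\<integral>\<^sup>+ s. (\<Sum>m. decr_rearr u (t / q ^ Suc m) * indicator {t / q ^ Suc m..<t / q ^ m} s) \<partial>lborel)"
    unfolding nn_integral_completion by (rule nn_integral_mono) (rule le)
  also have "\<dots> = (\<Sum>m. \<integral>\<^sup>+ s. decr_rearr u (t / q ^ Suc m) * indicator {t / q ^ Suc m..<t / q ^ m} s \<partial>lborel)"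
    by (rule nn_integral_suminf) measurable
  also have "\<dots> = (\<Sum>m. decr_rearr u (t / q ^ Suc m) * ennreal (t / q ^ m - t / q ^ Suc m))"
    using mono by (simp add: nn_integral_cmult)
  also have "\<dots> \<le> (\<Sum>m. (ennreal (1 / q ^ m) * decr_rearr u (t / q ^ Suc m)) * ennreal t)"
  proof (rule suminf_le)
    fix m
    have "ennreal (t / q ^ m - t / q ^ Suc m) \<le> ennreal (1 / q ^ m * t)"
      using q t by (intro ennreal_leI) simp
    also have "\<dots> = ennreal (1 / q ^ m) * ennreal t" using q t by (intro ennreal_mult) auto
    finally show "decr_rearr u (t / q ^ Suc m) * ennreal (t / q ^ m - t / q ^ Suc m) \<le> (ennreal (1 / q ^ m) * decr_rearr u (t / q ^ Suc m)) * ennreal t"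
      by (subst mult.commute[of "ennreal (1 / q ^ m)"], subst mult.assoc) (rule mult_left_mono, auto)
  qed auto
  also have "\<dots> = (\<Sum>m. ennreal (1 / q ^ m) * decr_rearr u (t / q ^ Suc m)) * ennreal t"
    by simp
  finally have "max_rearr u t \<le> (\<Sum>m. ennreal (1 / q ^ m) * decr_rearr u (t / q ^ Suc m)) * ennreal t / ennreal t"
    unfolding max_rearr_def by (rule divide_right_mono_ennreal)
  then show ?thesis using t by (simp add: ennreal_mult_divide_eq)
qed

text \<open>In the series of dilations, term m has norm at most
  \<open>\<kappa> ^ (m + 1) / q ^ m\<close> times the norm of \<open>u\<close>, and \<kappa> < q
  makes this summable. Jensen's inequality for modulars plays the part of the triangle inequality
  for the series.\<close>

lemma orlicz_norm_max_rearr_le: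
  assumes B: "young_function B" and boyd: "upper_boyd_index (orlicz_norm_halfline B) < 1"
  shows "\<exists>S>0. \<forall>u :: real ^ 'n \<Rightarrow> real. u \<in> borel_measurable lebesgue \<longrightarrow>
    orlicz_norm_halfline B (max_rearr u) \<le> ennreal S * orlicz_norm B u"
proof -
  note young_ext_measurable[OF B, measurable]
  obtain q where q: "q > 1" "dilation_norm (orlicz_norm_halfline B) q < ennreal q"
    using dilation_norm_less[OF B boyd] by blast
  then obtain z where z: "dilation_norm (orlicz_norm_halfline B) q < z" "z < ennreal q"
    using dense by blast
  then obtain \<kappa> where \<kappa>: "\<kappa> \<ge> 0" "z = ennreal \<kappa>" by (cases z) auto
  have \<kappa>d: "dilation_norm (orlicz_norm_halfline B) q < ennreal \<kappa>" "\<kappa> < q"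
    using z \<kappa> by (auto simp: ennreal_less_iff)
  have \<kappa>0: "\<kappa> > 0" using \<kappa>d(1) \<kappa>(1) by (cases "\<kappa> = 0") auto
  \<comment> \<open>\<open>S\<close> is the sum of the norms of the dilations with their
    coefficients; dividing the single terms by it gives the convex weights \<open>a\<close>.\<close>
  define S where "S = \<kappa> / (1 - \<kappa> / q)"
  have S: "S > 0" using \<kappa>0 \<kappa>d(2) q(1) by (simp add: S_def)
  have sumsS: "(\<lambda>m. \<kappa> * (\<kappa> / q) ^ m) sums S"
    using sums_mult[OF geometric_sums[of "\<kappa> / q"], of \<kappa>] \<kappa>0 \<kappa>d(2) q(1) by (simp add: S_def)
  define a where "a m = \<kappa> * (\<kappa> / q) ^ m / S" for m :: nat
  have a0: "a m \<ge> 0" for m using \<kappa>0 S q(1) by (simp add: a_def)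
  have a1: "a sums 1" unfolding a_def[abs_def] using sums_divide[OF sumsS, of S] S by simp
  have main: "(\<integral>\<^sup>+t. young_ext B (max_rearr u t / ennreal (S * r)) \<partial>lebesgue_on {0<..}) \<le> 1"
    if r: "0 < r" and m: "(\<integral>\<^sup>+t. young_ext B (decr_rearr u t / ennreal r) \<partial>lebesgue_on {0<..}) \<le> 1"
    for u :: "real ^ 'n \<Rightarrow> real" and r
  proof -
    \<comment> \<open>The dilation norm is a supremum over real-valued functions, so the
      rearrangement must be finite before it applies. An infinite value would persist on an interval
      and make the modular infinite.\<close>
    have fin: "decr_rearr u s < top" if s: "0 < s" for s
    proof (rule ccontr)
      assume "\<not> ?thesis"
      then have top: "decr_rearr u t = top" if "t \<le> s" for t
        using decr_rearr_antimono[OF that, of u] by (simp add: top_unique less_top[symmetric])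
      have "top = (\<integral>\<^sup>+t. top * indicator {0<..<s} t \<partial>lborel)"
        by (subst nn_integral_cmult_indicator) (use s in \<open>auto simp: ennreal_top_mult\<close>)
      also have "\<dots> \<le> (\<integral>\<^sup>+t\<in>{0<..}. young_ext B (decr_rearr u t / ennreal r) \<partial>lborel)"
        using r by (intro nn_integral_mono) (auto simp: indicator_def top young_ext_def ennreal_top_divide)
      also have "\<dots> \<le> 1" using m by (simp add: nn_integral_lebesgue_on_halfline)
      finally show False by (simp add: top_unique)
    qed
    define f where "f s = enn2real (decr_rearr u s)" for s
    have f[measurable]: "f \<in> borel_measurable borel" unfolding f_def[abs_def] by measurable
    have feq: "ennreal \<bar>f s\<bar> = decr_rearr u s" if "0 < s" for s
      using fin[OF that] by (simp add: f_def)
    have "(\<integral>\<^sup>+s. young_ext B (ennreal \<bar>f s\<bar> / ennreal r) \<partial>lebesgue_on {0<..}) = (\<integral>\<^sup>+t. young_ext B (decr_rearr u t / ennreal r) \<partial>lebesgue_on {0<..})"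
      by (rule nn_integral_cong) (simp add: feq)
    then have mf: "(\<integral>\<^sup>+s. young_ext B (ennreal \<bar>f (s / q ^ i)\<bar> / ennreal (\<kappa> ^ i * r)) \<partial>lebesgue_on {0<..}) \<le> 1" for i
      using modular_dilate_power[OF B q(1) \<kappa>d(1) f r] m by simp
    have pw: "young_ext B (max_rearr u t / ennreal (S * r)) \<le>
      (\<Sum>i. ennreal (a i) * young_ext B (ennreal \<bar>f (t / q ^ Suc i)\<bar> / ennreal (\<kappa> ^ Suc i * r)))" if t: "0 < t" for t
    proof -
      have "max_rearr u t / ennreal (S * r) \<le> (\<Sum>i. ennreal (1 / q ^ i) * decr_rearr u (t / q ^ Suc i)) / ennreal (S * r)"
        by (intro divide_right_mono_ennreal max_rearr_le_dilations q t)
      also have "\<dots> = (\<Sum>i. ennreal (1 / q ^ i) * decr_rearr u (t / q ^ Suc i) / ennreal (S * r))"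
        by (simp add: divide_ennreal_def)
      also have "\<dots> = (\<Sum>i. ennreal (a i) * (ennreal \<bar>f (t / q ^ Suc i)\<bar> / ennreal (\<kappa> ^ Suc i * r)))"
      proof (intro arg_cong[of _ _ suminf] ext)
        fix i
        have "0 < t / q ^ Suc i" using t q(1) by simp
        note feq[OF this, symmetric]
        moreover have "1 / q ^ i * \<bar>f (t / q ^ Suc i)\<bar> / (S * r) = a i * (\<bar>f (t / q ^ Suc i)\<bar> / (\<kappa> ^ Suc i * r))"
          using \<kappa>0 q(1) S r by (simp add: a_def power_divide field_simps)
        ultimately show "ennreal (1 / q ^ i) * decr_rearr u (t / q ^ Suc i) / ennreal (S * r) =
          ennreal (a i) * (ennreal \<bar>f (t / q ^ Suc i)\<bar> / ennreal (\<kappa> ^ Suc i * r))"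
          using \<kappa>0 q(1) S r a0[of i] by (simp add: ennreal_mult[symmetric] divide_ennreal del: power_Suc)
      qed
      finally have "young_ext B (max_rearr u t / ennreal (S * r)) \<le>
         young_ext B (\<Sum>i. ennreal (a i) * (ennreal \<bar>f (t / q ^ Suc i)\<bar> / ennreal (\<kappa> ^ Suc i * r)))"
        by (rule young_ext_mono[OF B])
      also have "\<dots> \<le> (\<Sum>i. ennreal (a i) * young_ext B (ennreal \<bar>f (t / q ^ Suc i)\<bar> / ennreal (\<kappa> ^ Suc i * r)))"
        by (rule young_ext_suminf_le[OF B a0 a1])
      finally show ?thesis .
    qed
    have [measurable]: "(\<lambda>t. f (t / q ^ Suc i)) \<in> borel_measurable (lebesgue_on {0<..})" for i
      by (intro halfline_measurable) measurable
    have "(\<integral>\<^sup>+t. young_ext B (max_rearr u t / ennreal (S * r)) \<partial>lebesgue_on {0<..}) \<le>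
      (\<integral>\<^sup>+t. (\<Sum>i. ennreal (a i) * young_ext B (ennreal \<bar>f (t / q ^ Suc i)\<bar> / ennreal (\<kappa> ^ Suc i * r))) \<partial>lebesgue_on {0<..})"
      by (rule nn_integral_mono) (use pw in auto)
    also have "\<dots> = (\<Sum>i. \<integral>\<^sup>+t. ennreal (a i) * young_ext B (ennreal \<bar>f (t / q ^ Suc i)\<bar> / ennreal (\<kappa> ^ Suc i * r)) \<partial>lebesgue_on {0<..})"
      by (rule nn_integral_suminf) measurable
    also have "\<dots> = (\<Sum>i. ennreal (a i) * (\<integral>\<^sup>+t. young_ext B (ennreal \<bar>f (t / q ^ Suc i)\<bar> / ennreal (\<kappa> ^ Suc i * r)) \<partial>lebesgue_on {0<..}))"
      by (intro arg_cong[of _ _ suminf] ext nn_integral_cmult) measurable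
    also have "\<dots> \<le> (\<Sum>i. ennreal (a i))"
    proof (rule suminf_le)
      fix i
      show "ennreal (a i) * (\<integral>\<^sup>+t. young_ext B (ennreal \<bar>f (t / q ^ Suc i)\<bar> / ennreal (\<kappa> ^ Suc i * r)) \<partial>lebesgue_on {0<..}) \<le> ennreal (a i)"
        using mult_left_mono[OF mf[of "Suc i"], of "ennreal (a i)"] by simp
    qed auto
    also have "\<dots> = 1"
      using suminf_ennreal_eq[OF a0 a1] by simp
    finally show ?thesis .
  qed
  show ?thesis
  proof (intro exI[of _ S] conjI allI impI S)
    fix u :: "real ^ 'n \<Rightarrow> real" assume u: "u \<in> borel_measurable lebesgue"
    show "orlicz_norm_halfline B (max_rearr u) \<le> ennreal S * orlicz_norm B u"
    proof (cases "orlicz_norm B u")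
      case top then show ?thesis using S by (simp add: ennreal_mult_top)
    next
      case (real p)
      have "orlicz_norm_halfline B (max_rearr u) \<le> ennreal (S * r)" if r: "p < r" for r
      proof -
        have "luxemburg_norm B (lebesgue_on {0<..}) (decr_rearr u) < ennreal r"
          using orlicz_norm_eq_halfline[OF B u, folded real(2)] ennreal_less_iff[OF real(1)] r
          by (simp add: orlicz_norm_halfline_def real(2))
        from luxemburg_normD[OF B this] show ?thesis
          unfolding orlicz_norm_halfline_def using S r real(1) by (intro luxemburg_norm_le main) auto
      qed
      then have "orlicz_norm_halfline B (max_rearr u) \<le> ennreal (S * p)"
        by (rule ennreal_le_mult_limit[rotated 2]) (use S real(1) in auto)
      then show ?thesis using S real by (simp add: ennreal_mult)
    qed
  qed
qed

lemma interp_mono: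
  assumes "a \<le> ennreal S * a'" "b \<le> ennreal T * b'" "0 < S" "0 < T" "0 < \<theta>" "\<theta> < 1"
  shows "interp \<theta> a b \<le> ennreal (S powr \<theta> * T powr (1 - \<theta>)) * interp \<theta> a' b'"
proof (cases "a' = top \<or> b' = top")
  case True
  then have "interp \<theta> a' b' = top" by auto
  then show ?thesis using assms by (simp add: ennreal_mult_top)
next
  case False
  then obtain x' y' where x': "x' \<ge> 0" "a' = ennreal x'" and y': "y' \<ge> 0" "b' = ennreal y'"
    by (metis ennreal_cases)
  have ab: "a \<le> ennreal (S * x')" "b \<le> ennreal (T * y')"
    using assms x' y' by (simp_all add: ennreal_mult)
  then obtain x y where x: "x \<ge> 0" "a = ennreal x" and y: "y \<ge> 0" "b = ennreal y"
    by (metis ennreal_cases top_unique ennreal_neq_top)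
  have "x \<le> S * x'" "y \<le> T * y'" using ab x y x' y' assms by (simp_all add: ennreal_le_iff)
  then have "x powr \<theta> * y powr (1 - \<theta>) \<le> (S * x') powr \<theta> * (T * y') powr (1 - \<theta>)"
    using x y assms by (intro mult_mono powr_mono2) auto
  also have "\<dots> = (S powr \<theta> * T powr (1 - \<theta>)) * (x' powr \<theta> * y' powr (1 - \<theta>))"
    using assms x' y' by (simp add: powr_mult mult_ac)
  finally have "ennreal (x powr \<theta> * y powr (1 - \<theta>)) \<le>
      ennreal ((S powr \<theta> * T powr (1 - \<theta>)) * (x' powr \<theta> * y' powr (1 - \<theta>)))" by (rule ennreal_leI)
  then show ?thesis
    unfolding x(2) y(2) x'(2) y'(2) interp_ennreal[OF x(1) y(1)] interp_ennreal[OF x'(1) y'(1)]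
    by (simp add: ennreal_mult)
qed

lemma orlicz_norm_nabla_le:
  assumes "1 \<le> j" and "j < k" and "young_function A" "young_function B" "young_function C"
    and "inverse_condition (real j / real k) A B C"
    and "upper_boyd_index (orlicz_norm_halfline B) < 1" "upper_boyd_index (orlicz_norm_halfline C) < 1"
  shows "\<exists>c2>0. \<forall>u :: real ^ 'n \<Rightarrow> real. weakly_differentiable k u \<longrightarrow>
    orlicz_norm A (abs_nabla j u) \<le> ennreal c2 * interp (real j / real k) (orlicz_norm B (abs_nabla k u)) (orlicz_norm C u)"
proof -
  let ?\<theta> = "real j / real k"
  have \<theta>: "0 < ?\<theta>" "?\<theta> < 1" using assms(1,2) by auto
  obtain c where c: "c > 0" "\<And>u :: real ^ 'n \<Rightarrow> real. weakly_differentiable k u \<Longrightarrow>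
    orlicz_norm A (abs_nabla j u) \<le> ennreal c * interp ?\<theta>
      (orlicz_norm_halfline B (max_rearr (abs_nabla k u))) (orlicz_norm_halfline C (max_rearr u))"
    using orlicz_norm_nabla_le_max_rearr[OF assms(1-6)] by blast
  obtain S where S: "S > 0" "\<And>u :: real ^ 'n \<Rightarrow> real. u \<in> borel_measurable lebesgue \<Longrightarrow>
    orlicz_norm_halfline B (max_rearr u) \<le> ennreal S * orlicz_norm B u"
    using orlicz_norm_max_rearr_le[OF assms(4,7)] by blast
  obtain T where T: "T > 0" "\<And>u :: real ^ 'n \<Rightarrow> real. u \<in> borel_measurable lebesgue \<Longrightarrow>
    orlicz_norm_halfline C (max_rearr u) \<le> ennreal T * orlicz_norm C u"
    using orlicz_norm_max_rearr_le[OF assms(5,8)] by blast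
  show ?thesis
  proof (intro exI[of _ "c * (S powr ?\<theta> * T powr (1 - ?\<theta>))"] conjI allI impI)
    show "0 < c * (S powr ?\<theta> * T powr (1 - ?\<theta>))" using c(1) S(1) T(1) by simp
    fix u :: "real ^ 'n \<Rightarrow> real" assume u: "weakly_differentiable k u"
    have um: "u \<in> borel_measurable lebesgue"
      using u by (auto simp: weakly_differentiable_def intro: locally_integrable_measurable)
    have "orlicz_norm A (abs_nabla j u) \<le> ennreal c * interp ?\<theta>
      (orlicz_norm_halfline B (max_rearr (abs_nabla k u))) (orlicz_norm_halfline C (max_rearr u))" by (rule c(2)[OF u])
    also have "\<dots> \<le> ennreal c * (ennreal (S powr ?\<theta> * T powr (1 - ?\<theta>)) * interp ?\<theta> (orlicz_norm B (abs_nabla k u)) (orlicz_norm C u))"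
      by (intro mult_left_mono interp_mono S T \<theta> um abs_nabla_measurable[OF u]) auto
    also have "\<dots> = ennreal (c * (S powr ?\<theta> * T powr (1 - ?\<theta>))) * interp ?\<theta> (orlicz_norm B (abs_nabla k u)) (orlicz_norm C u)"
      using c(1) by (simp add: ennreal_mult mult.assoc)
    finally show "orlicz_norm A (abs_nabla j u) \<le> ennreal (c * (S powr ?\<theta> * T powr (1 - ?\<theta>))) * interp ?\<theta> (orlicz_norm B (abs_nabla k u)) (orlicz_norm C u)" .
  qed
qed

section \<open>Necessity of the condition\<close>

text \<open>Difference quotients have integral zero by translation invariance. The mean value
  theorem bounds them by \<open>b\<close>, and the steps of at most 1 keep them supported in the
  ball of radius \<open>r + 1\<close>, so dominated convergence applies.\<close>

lemma integral_partial_deriv_eq_0: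
  fixes f :: "real ^ 'n \<Rightarrow> real"
  assumes diff: "\<And>x. f differentiable (at x)" and b: "\<And>x. \<bar>partial_deriv [i] f x\<bar> \<le> b"
    and r: "\<And>x. norm x > r \<Longrightarrow> f x = 0"
  shows "(\<integral>x. partial_deriv [i] f x \<partial>lborel) = 0"
proof -
  let ?e = "axis i 1 :: real ^ 'n"
  define s where "s n x = (f (x + inverse (real (Suc n)) *\<^sub>R ?e) - f x) / inverse (real (Suc n))" for n x
  have cont: "continuous_on UNIV f"
    by (simp add: continuous_at_imp_continuous_on differentiable_imp_continuous_within diff)
  have [measurable]: "f \<in> borel_measurable borel" by (rule borel_measurable_continuous_onI[OF cont])
  have fi: "integrable lborel f" by (rule integrable_bounded_support[OF cont r])
  have lim: "(\<lambda>n. s n x) \<longlonglongrightarrow> partial_deriv [i] f x" for x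
  proof -
    have "((\<lambda>t. f (x + t *\<^sub>R ?e)) has_real_derivative partial_deriv [i] f x) (at 0)"
      using partial_deriv_along_line[of f x 0 i] diff by simp
    then have "((\<lambda>t. (f (x + t *\<^sub>R ?e) - f x) / t) \<longlongrightarrow> partial_deriv [i] f x) (at 0)"
      by (simp add: has_field_derivative_iff)
    moreover have "filterlim (\<lambda>n. inverse (real (Suc n))) (at 0) sequentially"
      unfolding filterlim_at using LIMSEQ_inverse_real_of_nat by auto
    ultimately show ?thesis unfolding s_def by (rule filterlim_compose)
  qed
  have bound: "\<bar>s n x\<bar> \<le> b * indicator (cball 0 (r + 1)) x" for n x
  proof -
    let ?h = "inverse (real (Suc n))"
    have h: "0 < ?h" "?h \<le> 1" by (auto simp: field_simps)
    have "\<exists>z. 0 < z \<and> z < ?h \<and> f (x + ?h *\<^sub>R ?e) - f (x + 0 *\<^sub>R ?e) = (?h - 0) * partial_deriv [i] f (x + z *\<^sub>R ?e)"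
      by (rule MVT2[OF h(1)]) (rule partial_deriv_along_line[OF diff])
    then obtain z where z: "0 < z" "z < ?h" "f (x + ?h *\<^sub>R ?e) - f x = ?h * partial_deriv [i] f (x + z *\<^sub>R ?e)"
      by auto
    then have sn: "s n x = partial_deriv [i] f (x + z *\<^sub>R ?e)" unfolding s_def by simp
    show ?thesis
    proof (cases "norm x \<le> r + 1")
      case True then show ?thesis using b sn by simp
    next
      case False
      have "norm x \<le> norm (x + z *\<^sub>R ?e) + norm (z *\<^sub>R ?e)"
        by (metis add_diff_cancel norm_triangle_ineq4)
      then have "norm (x + z *\<^sub>R ?e) > r" using z h False by simp
      then show ?thesis using partial_deriv_eq_0_outside[of r f "x + z *\<^sub>R ?e" "[i]"] r False sn by simp
    qed
  qed
  have [measurable]: "s n \<in> borel_measurable borel" for n unfolding s_def[abs_def] by measurable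
  have pm[measurable]: "partial_deriv [i] f \<in> borel_measurable borel"
    by (rule borel_measurable_LIMSEQ_real[of _ s]) (use lim in auto)
  have "(\<lambda>n. \<integral>x. s n x \<partial>lborel) \<longlonglongrightarrow> (\<integral>x. partial_deriv [i] f x \<partial>lborel)"
  proof (rule integral_dominated_convergence)
    have "emeasure lborel (cball (0::real^'n) (r + 1)) < \<infinity>" by (rule emeasure_lborel_cball_finite)
    then show "integrable lborel (\<lambda>x::real^'n. b * indicator (cball 0 (r + 1)) x)"
      by (intro integrable_mult_right integrable_real_indicator) auto
  qed (use lim bound pm in auto)
  moreover have "(\<integral>x. s n x \<partial>lborel) = 0" for n
  proof -
    let ?h = "inverse (real (Suc n))"
    have i2: "integrable lborel (\<lambda>x. f (x + ?h *\<^sub>R ?e))"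
    proof (rule integrable_bounded_support)
      show "continuous_on UNIV (\<lambda>x. f (x + ?h *\<^sub>R ?e))"
        by (rule continuous_on_compose2[OF cont]) (auto intro: continuous_intros)
      show "f (x + ?h *\<^sub>R ?e) = 0" if "norm x > r + norm (?h *\<^sub>R ?e)" for x
        using that norm_triangle_ineq4[of "x + ?h *\<^sub>R ?e" "?h *\<^sub>R ?e"] by (intro r) simp
    qed
    have "(\<integral>x. f (x + ?h *\<^sub>R ?e) \<partial>lborel) = (\<integral>x. f x \<partial>lborel)"
      using integral_affine[of f 1 "?h *\<^sub>R ?e"] by (simp add: add.commute)
    then show ?thesis unfolding s_def using fi i2 by simp
  qed
  ultimately show ?thesis using LIMSEQ_unique[OF _ tendsto_const] by fastforce
qed

lemma integral_by_parts_test: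
  assumes "test_function f" "test_function g"
  shows "(\<integral>x. f x * partial_deriv [i] g x \<partial>lebesgue) = - (\<integral>x. partial_deriv [i] f x * g x \<partial>lebesgue)"
proof -
  have sm: "smooth_function f" "smooth_function g" "smooth_function (partial_deriv [i] f)" "smooth_function (partial_deriv [i] g)"
    using assms test_function_smooth smooth_partial_deriv by blast+
  have [measurable]: "f \<in> borel_measurable borel" "g \<in> borel_measurable borel"
    "partial_deriv [i] f \<in> borel_measurable borel" "partial_deriv [i] g \<in> borel_measurable borel"
    using sm smooth_measurable by blast+
  have d: "((\<lambda>x. f x * g x) has_derivative (\<lambda>h. f x * frechet_derivative g (at x) h + frechet_derivative f (at x) h * g x)) (at x)" for x
    using smooth_differentiable[OF sm(1)] smooth_differentiable[OF sm(2)]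
    by (intro has_derivative_mult) (auto simp: frechet_derivative_works)
  have eq: "partial_deriv [i] (\<lambda>x. f x * g x) x = f x * partial_deriv [i] g x + partial_deriv [i] f x * g x" for x
    by (subst has_derivative_partial_deriv[OF d]) simp
  obtain r where r: "\<And>x. norm x > r \<Longrightarrow> f x = 0" using test_function_support[OF assms(1)] by blast
  obtain b1 b2 b3 b4 where b: "\<And>x. \<bar>f x\<bar> \<le> b1" "\<And>x. \<bar>g x\<bar> \<le> b2" "\<And>x. \<bar>partial_deriv [i] f x\<bar> \<le> b3" "\<And>x. \<bar>partial_deriv [i] g x\<bar> \<le> b4"
    using test_function_bounded assms test_function_partial_deriv by metis
  have "(\<integral>x. partial_deriv [i] (\<lambda>x. f x * g x) x \<partial>lborel) = 0"
  proof (rule integral_partial_deriv_eq_0)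
    show "(\<lambda>x. f x * g x) differentiable at x" for x using d differentiable_def by blast
    show "f x * g x = 0" if "norm x > r" for x using r[OF that] by simp
    show "\<bar>partial_deriv [i] (\<lambda>x. f x * g x) x\<bar> \<le> b1 * b4 + b3 * b2" for x
      unfolding eq using b[of x] by (intro order_trans[OF abs_triangle_ineq] add_mono) (auto simp: abs_mult simp del: partial_deriv.simps intro!: mult_mono order_trans[OF abs_ge_zero])
  qed
  moreover have "integrable lborel (\<lambda>x. f x * partial_deriv [i] g x)" "integrable lborel (\<lambda>x. partial_deriv [i] f x * g x)"
    using r partial_deriv_eq_0_outside[of r f _ "[i]"] sm[THEN smooth_continuous]
    by (auto intro!: integrable_bounded_support[of _ r] continuous_on_mult simp del: partial_deriv.simps)
  ultimately have "(\<integral>x. f x * partial_deriv [i] g x \<partial>lborel) + (\<integral>x. partial_deriv [i] f x * g x \<partial>lborel) = 0"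
    unfolding eq by (subst (asm) Bochner_Integration.integral_add)
  moreover have "(\<integral>x. f x * partial_deriv [i] g x \<partial>lebesgue) = (\<integral>x. f x * partial_deriv [i] g x \<partial>lborel)"
    "(\<integral>x. partial_deriv [i] f x * g x \<partial>lebesgue) = (\<integral>x. partial_deriv [i] f x * g x \<partial>lborel)"
    by (rule integral_completion; measurable)+
  ultimately show ?thesis by linarith
qed

text \<open>Integration by parts removes the outermost derivative of \<phi> first, and on
  \<open>u\<close> it becomes the innermost one. The reversed list records this order, so that mixed
  derivatives are never interchanged.\<close>

lemma has_weak_partial_test_function:
  assumes "test_function u" shows "has_weak_partial u is (partial_deriv (rev is) u)"
  unfolding has_weak_partial_def
proof (intro conjI allI impI)
  show "locally_integrable (partial_deriv (rev is) u)"
    by (intro continuous_locally_integrable smooth_continuous smooth_partial_deriv test_function_smooth assms)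
  fix \<phi> :: "real ^ 'a \<Rightarrow> real" assume \<phi>: "test_function \<phi>"
  show "(\<integral>x. u x * partial_deriv is \<phi> x \<partial>lebesgue) = (- 1) ^ length is * (\<integral>x. partial_deriv (rev is) u x * \<phi> x \<partial>lebesgue)"
    using assms
  proof (induction "is" arbitrary: u)
    case Nil then show ?case by simp
  next
    case (Cons i "is")
    have "(\<integral>x. u x * partial_deriv (i # is) \<phi> x \<partial>lebesgue) = (\<integral>x. u x * partial_deriv [i] (partial_deriv is \<phi>) x \<partial>lebesgue)"
      by simp
    also have "\<dots> = - (\<integral>x. partial_deriv [i] u x * partial_deriv is \<phi> x \<partial>lebesgue)"
      by (rule integral_by_parts_test[OF Cons.prems test_function_partial_deriv[OF \<phi>]])
    also have "\<dots> = - ((- 1) ^ length is * (\<integral>x. partial_deriv (rev is) (partial_deriv [i] u) x * \<phi> x \<partial>lebesgue))"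
      by (simp only: Cons.IH[OF test_function_partial_deriv[OF Cons.prems, of "[i]"]])
    finally show ?case unfolding rev.simps partial_deriv_append by simp
  qed
qed

lemma test_function_weakly_differentiable:
  "test_function u \<Longrightarrow> weakly_differentiable k u"
  unfolding weakly_differentiable_def
  using has_weak_partial_test_function continuous_locally_integrable smooth_continuous test_function_smooth by blast

lemma AE_weak_partial_test_function:
  assumes "test_function u" shows "AE x in lebesgue. weak_partial u is x = partial_deriv (rev is) u x"
  by (rule has_weak_partial_unique[OF has_weak_partial_weak_partial[OF test_function_weakly_differentiable[OF assms] order_refl]
    has_weak_partial_test_function[OF assms]])

text \<open>A function whose derivative in direction i vanishes everywhere is constant on the lines
  in that direction, and bounded support makes the constant zero.\<close>

lemma partial_deriv_nonvanishing:
  assumes "test_function f" "f x0 \<noteq> 0" shows "\<exists>x. partial_deriv (replicate m i) f x \<noteq> 0"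
proof (induction m)
  case 0 then show ?case using assms(2) by auto
next
  case (Suc m)
  let ?g = "partial_deriv (replicate m i) f"
  have g: "test_function ?g" by (rule test_function_partial_deriv[OF assms(1)])
  obtain x where x: "?g x \<noteq> 0" using Suc by blast
  obtain r where r: "r > 0" "\<And>x. norm x > r \<Longrightarrow> ?g x = 0" using test_function_support[OF g] by blast
  show ?case
  proof (rule ccontr)
    assume "\<not> ?thesis"
    then have z: "partial_deriv [i] ?g y = 0" for y by simp
    \<comment> \<open>Far enough along the line to leave the ball of radius r, by the triangle
      inequality.\<close>
    define T where "T = r + norm x + 1"
    have "((\<lambda>t. ?g (x + t *\<^sub>R axis i 1)) has_real_derivative 0) (at t)" for t
      using partial_deriv_along_line[OF smooth_differentiable[OF test_function_smooth[OF g]], where x = x and t = t and i = i] z by simp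
    then have "?g (x + T *\<^sub>R axis i 1) = ?g (x + 0 *\<^sub>R axis i 1)"
      using DERIV_isconst_all[of "\<lambda>t. ?g (x + t *\<^sub>R axis i 1)" T 0] by blast
    moreover have "norm (T *\<^sub>R axis i 1 :: real ^ 'a) \<le> norm (x + T *\<^sub>R axis i 1) + norm x"
      by (metis add_diff_cancel_left' norm_triangle_ineq4)
    then have "norm (x + T *\<^sub>R axis i 1) > r" using r(1) by (simp add: T_def)
    ultimately show False using r(2) x by simp
  qed
qed

lemma nn_integral_dilate:
  fixes F :: "real ^ 'n \<Rightarrow> ennreal"
  assumes [measurable]: "F \<in> borel_measurable borel" and "0 < \<epsilon>"
  shows "(\<integral>\<^sup>+x. F ((1 / \<epsilon>) *\<^sub>R x) \<partial>lebesgue) = ennreal (\<epsilon> ^ CARD('n)) * (\<integral>\<^sup>+x. F x \<partial>lborel)"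
proof -
  have "(\<lambda>x. F ((1 / \<epsilon>) *\<^sub>R x)) \<in> borel_measurable borel" by measurable
  from nn_integral_affine[OF this, of \<epsilon> 0] show ?thesis
    using assms(2) by (simp add: nn_integral_completion)
qed

text \<open>The indicator of a set of measure \<open>1 / t\<close> has Luxemburg norm
  \<open>1 / young_inv B t\<close>. The dilated ball has measure at most \<open>q / t\<close>, and
  convexity absorbs \<open>q\<close> into the norm. The bound on \<open>v\<close> is almost
  everywhere because weak derivatives are known only up to null sets.\<close>

lemma orlicz_norm_dilate_upper:
  fixes v :: "real ^ 'n \<Rightarrow> real"
  assumes B: "young_function B" and t: "0 < t" and \<epsilon>: "0 < \<epsilon>" "\<epsilon> ^ CARD('n) = 1 / t"
    and q: "1 \<le> q" "emeasure lborel (cball (0::real ^ 'n) R) \<le> ennreal q" and b: "0 < b"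
    and v: "AE x in lebesgue. \<bar>v x\<bar> \<le> b * indicator (cball 0 R) ((1 / \<epsilon>) *\<^sub>R x)"
  shows "orlicz_norm B v \<le> ennreal (b * q / young_inv B t)"
  unfolding orlicz_norm_def
proof (rule luxemburg_norm_le)
  have i: "young_inv B t > 0" by (rule young_inv_pos[OF B t])
  let ?r = "b * q / young_inv B t"
  show r: "?r > 0" using i b q by simp
  have Bt: "B (young_inv B t / q) \<le> t / q"
    using young_scale[OF B, of "1 / q" "young_inv B t"] q i young_young_inv[OF B, of t] t by simp
  have "(\<integral>\<^sup>+x. young_ext B (ennreal \<bar>v x\<bar> / ennreal ?r) \<partial>lebesgue) \<le>
    (\<integral>\<^sup>+x. ennreal (t / q) * indicator (cball (0 :: real ^ 'n) R) ((1 / \<epsilon>) *\<^sub>R x) \<partial>lebesgue)"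
  proof (rule nn_integral_mono_AE, rule eventually_mono[OF v])
    fix x :: "real ^ 'n" assume elim: "\<bar>v x\<bar> \<le> b * indicator (cball 0 R) ((1 / \<epsilon>) *\<^sub>R x)"
    show "young_ext B (ennreal \<bar>v x\<bar> / ennreal ?r) \<le> ennreal (t / q) * indicator (cball 0 R) ((1 / \<epsilon>) *\<^sub>R x)"
    proof (cases "(1 / \<epsilon>) *\<^sub>R x \<in> cball 0 R")
      case True
      have "ennreal \<bar>v x\<bar> / ennreal ?r \<le> ennreal b / ennreal ?r"
        using elim True by (intro divide_right_mono_ennreal ennreal_leI) simp
      also have "\<dots> = ennreal (young_inv B t / q)"
        using b i q r by (simp add: divide_ennreal)
      finally have "young_ext B (ennreal \<bar>v x\<bar> / ennreal ?r) \<le> young_ext B (ennreal (young_inv B t / q))"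
        by (rule young_ext_mono[OF B])
      also have "\<dots> = ennreal (B (young_inv B t / q))" using i q by (intro young_ext_ennreal[OF B]) auto
      also have "\<dots> \<le> ennreal (t / q)" by (rule ennreal_leI[OF Bt])
      finally show ?thesis using True by simp
    next
      case False
      then have "v x = 0" using elim by simp
      then show ?thesis by (simp add: young_ext_zero[OF B])
    qed
  qed
  also have "\<dots> = ennreal (\<epsilon> ^ CARD('n)) * (\<integral>\<^sup>+x. ennreal (t / q) * indicator (cball 0 R) (x :: real ^ 'n) \<partial>lborel)"
    by (rule nn_integral_dilate[OF _ \<epsilon>(1)]) (simp add: borel_measurable_times_ennreal borel_measurable_indicator)
  also have "\<dots> = ennreal (1 / t) * (ennreal (t / q) * emeasure lborel (cball (0::real ^ 'n) R))"
    unfolding \<epsilon>(2) by (subst nn_integral_cmult_indicator) simp_all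
  also have "\<dots> \<le> ennreal (1 / t) * (ennreal (t / q) * ennreal q)"
    by (intro mult_left_mono q) auto
  also have "\<dots> = 1" using t q by (simp add: ennreal_mult[symmetric])
  finally show "(\<integral>\<^sup>+x. young_ext B (ennreal \<bar>v x\<bar> / ennreal ?r) \<partial>lebesgue) \<le> 1" .
qed

text \<open>The counterpart from below: the absolute value of \<open>v\<close> is at least
  \<open>b * \<delta>\<close> almost everywhere on a dilated set of measure at least
  \<open>p / t\<close>. The scaling property \<open>young_inv_scale\<close> of the inverse turns the
  level \<open>t / p\<close> back into t at the price of the factor \<open>p\<close>.\<close>

lemma orlicz_norm_dilate_lower:
  fixes v g :: "real ^ 'n \<Rightarrow> real"
  assumes A: "young_function A" and t: "0 < t" and \<epsilon>: "0 < \<epsilon>" "\<epsilon> ^ CARD('n) = 1 / t"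
    and p: "0 < p" "p \<le> 1" "ennreal p \<le> emeasure lborel {x. \<delta> < \<bar>g x\<bar>}" and b: "0 < b" and \<delta>: "0 < \<delta>"
    and g[measurable]: "g \<in> borel_measurable borel"
    and v: "AE x in lebesgue. b * \<bar>g ((1 / \<epsilon>) *\<^sub>R x)\<bar> \<le> \<bar>v x\<bar>"
  shows "ennreal (b * \<delta> * p / young_inv A t) \<le> orlicz_norm A v"
  unfolding orlicz_norm_def luxemburg_norm_def
proof (rule Inf_greatest, clarify)
  fix r :: real assume r: "0 < r" and m: "(\<integral>\<^sup>+x. young_ext A (ennreal \<bar>v x\<bar> / ennreal r) \<partial>lebesgue) \<le> 1"
  let ?y = "b * \<delta> / r"
  have y: "0 < ?y" using b \<delta> r by simp
  have Ay: "0 \<le> A ?y" using young_nonneg[OF A] y by simp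
  have "ennreal (1 / t) * (ennreal (A ?y) * ennreal p) \<le> ennreal (1 / t) * (ennreal (A ?y) * emeasure lborel {x. \<delta> < \<bar>g x\<bar>})"
    by (intro mult_left_mono p) auto
  also have "\<dots> = ennreal (\<epsilon> ^ CARD('n)) * (\<integral>\<^sup>+x. ennreal (A ?y) * indicator {x. \<delta> < \<bar>g x\<bar>} x \<partial>lborel)"
    unfolding \<epsilon>(2) by (subst nn_integral_cmult_indicator) auto
  also have "\<dots> = (\<integral>\<^sup>+x. ennreal (A ?y) * indicator {x. \<delta> < \<bar>g x\<bar>} ((1 / \<epsilon>) *\<^sub>R x) \<partial>lebesgue)"
    by (rule nn_integral_dilate[OF _ \<epsilon>(1), symmetric]) measurable
  also have "\<dots> \<le> (\<integral>\<^sup>+x. young_ext A (ennreal \<bar>v x\<bar> / ennreal r) \<partial>lebesgue)"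
  proof (rule nn_integral_mono_AE, rule eventually_mono[OF v])
    fix x :: "real ^ 'n" assume elim: "b * \<bar>g ((1 / \<epsilon>) *\<^sub>R x)\<bar> \<le> \<bar>v x\<bar>"
    show "ennreal (A ?y) * indicator {x. \<delta> < \<bar>g x\<bar>} ((1 / \<epsilon>) *\<^sub>R x) \<le> young_ext A (ennreal \<bar>v x\<bar> / ennreal r)"
    proof (cases "\<delta> < \<bar>g ((1 / \<epsilon>) *\<^sub>R x)\<bar>")
      case True
      then have "b * \<delta> \<le> b * \<bar>g ((1 / \<epsilon>) *\<^sub>R x)\<bar>" using b by (intro mult_left_mono) auto
      then have "b * \<delta> \<le> \<bar>v x\<bar>" using elim by linarith
      then have "ennreal (b * \<delta>) / ennreal r \<le> ennreal \<bar>v x\<bar> / ennreal r"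
        by (intro divide_right_mono_ennreal ennreal_leI)
      then have "young_ext A (ennreal ?y) \<le> young_ext A (ennreal \<bar>v x\<bar> / ennreal r)"
        using b \<delta> r by (intro young_ext_mono[OF A]) (simp add: divide_ennreal)
      then show ?thesis using True y by (simp add: young_ext_ennreal[OF A])
    qed simp
  qed
  also have "\<dots> \<le> 1" by (rule m)
  finally have "ennreal (1 / t) * (ennreal (A ?y) * ennreal p) \<le> ennreal 1" by simp
  moreover have "ennreal (1 / t * (A ?y * p)) = ennreal (1 / t) * (ennreal (A ?y) * ennreal p)"
    using t p Ay by (subst ennreal_mult, simp, simp, subst ennreal_mult) auto
  ultimately have "ennreal (1 / t * (A ?y * p)) \<le> ennreal 1" by (simp only:)
  then have "1 / t * (A ?y * p) \<le> 1" by (subst (asm) ennreal_le_iff) auto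
  then have "A ?y \<le> t / p" using t p by (simp add: field_simps)
  then have "?y \<le> young_inv A (t / p)" using young_le_iff[OF A, of ?y "t / p"] y t p by simp
  moreover have "p * young_inv A (t / p) \<le> young_inv A t"
    using young_inv_scale[OF A, of p "t / p"] p t by simp
  ultimately have "p * ?y \<le> young_inv A t" using p by (meson mult_left_mono less_imp_le order_trans)
  then have "b * \<delta> * p / young_inv A t \<le> r"
    using young_inv_pos[OF A t] r by (simp add: field_simps)
  then show "ennreal (b * \<delta> * p / young_inv A t) \<le> ennreal r" by (rule ennreal_leI)
qed

text \<open>For the bump dilated to volume proportional to \<open>1 / t\<close>, the three norms are
  comparable to reciprocals of the inverse Young functions at t, up to powers of \<epsilon> from
  differentiation. These powers cancel, and what remains is the condition at t with a constant
  depending on the bump only.\<close>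

lemma inverse_condition_necessary:
  assumes jk: "1 \<le> j" "j < k" and A: "young_function A" and B: "young_function B" and C: "young_function C"
    and "0 < c2" and ineq: "\<And>u :: real ^ 'n \<Rightarrow> real. weakly_differentiable k u \<Longrightarrow>
      orlicz_norm A (abs_nabla j u) \<le> ennreal c2 * interp (real j / real k) (orlicz_norm B (abs_nabla k u)) (orlicz_norm C u)"
  shows "inverse_condition (real j / real k) A B C"
proof -
  let ?\<theta> = "real j / real k"
  have \<theta>: "0 < ?\<theta>" "?\<theta> < 1" using jk by auto
  obtain \<phi> :: "real ^ 'n \<Rightarrow> real" where \<phi>: "test_function \<phi>" "\<exists>x. 0 < \<phi> x"
    by (rule smoothing_kernel_exists) blast
  obtain x0 where x0: "\<phi> x0 \<noteq> 0" using \<phi>(2) by force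
  obtain R where R: "R > 0" "\<And>x. norm x > R \<Longrightarrow> \<phi> x = 0" using test_function_support[OF \<phi>(1)] by blast
  have t\<phi>: "test_function (partial_deriv is \<phi>)" for "is" by (rule test_function_partial_deriv[OF \<phi>(1)])
  have "\<exists>b. b > 0 \<and> (\<forall>x. \<bar>partial_deriv is \<phi> x\<bar> \<le> b)" for "is"
    using test_function_bounded[OF t\<phi>[of "is"]] by metis
  then obtain b where b: "\<And>is. b is > 0" "\<And>is x. \<bar>partial_deriv is \<phi> x\<bar> \<le> b is" by metis
  \<comment> \<open>A bound for all entries of the k-th derivative together; the 1 ensures
    positivity, and \<open>rev\<close> matches the order in which weak derivatives of test functions
    are identified.\<close>
  define M where "M = 1 + (\<Sum>is :: 'n list | length is = k. b (rev is))"
  have M: "M > 0" unfolding M_def using b(1) by (intro add_pos_nonneg sum_nonneg) (auto intro: less_imp_le)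
  \<comment> \<open>Any direction will do: pure derivatives of a nonzero test function do not vanish
    identically, and one entry bounds \<open>abs_nabla\<close> from below.\<close>
  define i :: 'n where "i = undefined"
  define g where "g = partial_deriv (replicate j i) \<phi>"
  have g: "test_function g" unfolding g_def by (rule t\<phi>)
  have gm[measurable]: "g \<in> borel_measurable borel" by (rule smooth_measurable[OF test_function_smooth[OF g]])
  obtain x1 where x1: "g x1 \<noteq> 0" unfolding g_def using partial_deriv_nonvanishing[OF \<phi>(1) x0] by blast
  define \<delta> where "\<delta> = \<bar>g x1\<bar> / 2"
  have \<delta>: "\<delta> > 0" using x1 by (simp add: \<delta>_def)
  let ?P = "{x. \<delta> < \<bar>g x\<bar>}"
  have "open ?P"
    by (intro open_Collect_less continuous_intros smooth_continuous[OF test_function_smooth[OF g]])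
  moreover have "x1 \<in> ?P" using x1 by (simp add: \<delta>_def)
  ultimately have "\<not> negligible ?P" using open_not_negligible by blast
  then have "emeasure lborel ?P \<noteq> 0"
    using \<open>open ?P\<close> by (auto simp: negligible_iff_emeasure0 sets_completionI_sets)
  \<comment> \<open>The set may have measure above 1, whereas the lower estimate requires
    \<open>p \<le> 1\<close>.\<close>
  define p where "p = enn2real (min 1 (emeasure lborel ?P))"
  have p: "0 < p" "p \<le> 1" "ennreal p \<le> emeasure lborel ?P"
  proof -
    have e: "ennreal p = min 1 (emeasure lborel ?P)" unfolding p_def
      by (rule ennreal_enn2real) (simp add: min_less_iff_disj)
    show "ennreal p \<le> emeasure lborel ?P" unfolding e by simp
    have "ennreal p \<le> 1" unfolding e by simp
    then show "p \<le> 1" by simp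
    have "ennreal p > 0" unfolding e using \<open>emeasure lborel ?P \<noteq> 0\<close> by (simp add: zero_less_iff_neq_zero)
    then show "0 < p" by simp
  qed
  define q where "q = max 1 (measure lborel (cball (0::real ^ 'n) R))"
  have q: "1 \<le> q" "emeasure lborel (cball (0::real ^ 'n) R) \<le> ennreal q"
    using emeasure_lborel_cball_finite[of "0::real ^ 'n" R]
    by (auto simp: q_def emeasure_eq_ennreal_measure less_top intro!: ennreal_leI)
  define K where "K = (M * q) powr ?\<theta> * (b [] * q) powr (1 - ?\<theta>)"
  have K: "K > 0" using M q b(1)[of "[]"] by (simp add: K_def)
  have "young_inv B t powr ?\<theta> * young_inv C t powr (1 - ?\<theta>) \<le> (c2 * K / (\<delta> * p)) * young_inv A t" if t: "0 < t" for t
  proof -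
    define \<epsilon> where "\<epsilon> = t powr (- 1 / real CARD('n))"
    have "\<epsilon> powr real CARD('n) = t powr (- 1)"
      unfolding \<epsilon>_def powr_powr by simp
    then have \<epsilon>: "0 < \<epsilon>" "\<epsilon> ^ CARD('n) = 1 / t"
      using t by (simp_all add: \<epsilon>_def powr_realpow powr_minus_divide)
    define u where "u x = \<phi> (0 + (1 / \<epsilon>) *\<^sub>R x)" for x
    have u: "test_function u" unfolding u_def[abs_def] using \<epsilon> by (intro test_function_affine \<phi>) auto
    have wu: "weakly_differentiable m u" for m by (rule test_function_weakly_differentiable[OF u])
    have pu: "partial_deriv is u x = (1 / \<epsilon>) ^ length is * partial_deriv is \<phi> ((1 / \<epsilon>) *\<^sub>R x)" for "is" x
      unfolding u_def[abs_def] smooth_affine(1)[OF test_function_smooth[OF \<phi>(1)]] by simp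
    have 1: "orlicz_norm C u \<le> ennreal (b [] * q / young_inv C t)"
    proof (rule orlicz_norm_dilate_upper[OF C t \<epsilon> q b(1)], rule AE_I2)
      show "\<bar>u x\<bar> \<le> b [] * indicator (cball 0 R) ((1 / \<epsilon>) *\<^sub>R x)" for x
        using R(2)[of "(1 / \<epsilon>) *\<^sub>R x"] b(2)[of "[]"] by (cases "norm ((1 / \<epsilon>) *\<^sub>R x) \<le> R") (auto simp: u_def)
    qed
    have 2: "orlicz_norm B (abs_nabla k u) \<le> ennreal ((1 / \<epsilon>) ^ k * M * q / young_inv B t)"
    proof (rule orlicz_norm_dilate_upper[OF B t \<epsilon> q])
      show "0 < (1 / \<epsilon>) ^ k * M" using \<epsilon>(1) M by simp
      have "AE x in lebesgue. \<forall>is\<in>{is :: 'n list. length is = k}. weak_partial u is x = partial_deriv (rev is) u x"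
        by (intro AE_finite_allI finite_lists_length AE_weak_partial_test_function u)
      then show "AE x in lebesgue. \<bar>abs_nabla k u x\<bar> \<le> (1 / \<epsilon>) ^ k * M * indicator (cball 0 R) ((1 / \<epsilon>) *\<^sub>R x)"
      proof eventually_elim
        case (elim x)
        let ?y = "(1 / \<epsilon>) *\<^sub>R x"
        have "\<bar>abs_nabla k u x\<bar> \<le> (\<Sum>is | length is = k. \<bar>weak_partial u is x\<bar>)" by (rule abs_nabla_bounds(1))
        also have "\<dots> \<le> (\<Sum>is :: 'n list | length is = k. (1 / \<epsilon>) ^ k * (b (rev is) * indicator (cball 0 R) ?y))"
        proof (rule sum_mono)
          fix "is" :: "'n list" assume "is": "is \<in> {is. length is = k}"
          have "\<bar>partial_deriv (rev is) \<phi> ?y\<bar> \<le> b (rev is) * indicator (cball 0 R) ?y"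
            using partial_deriv_eq_0_outside[of R \<phi> ?y "rev is"] R(2) b(2)[of "rev is" ?y] by (cases "norm ?y \<le> R") auto
          then show "\<bar>weak_partial u is x\<bar> \<le> (1 / \<epsilon>) ^ k * (b (rev is) * indicator (cball 0 R) ?y)"
            using elim "is" \<epsilon>(1) by (auto simp: pu abs_mult divide_right_mono)
        qed
        also have "\<dots> = (1 / \<epsilon>) ^ k * ((\<Sum>is :: 'n list | length is = k. b (rev is)) * indicator (cball 0 R) ?y)"
          by (simp add: sum_distrib_left sum_distrib_right)
        also have "\<dots> \<le> (1 / \<epsilon>) ^ k * (M * indicator (cball 0 R) ?y)"
          using \<epsilon>(1) by (intro mult_left_mono mult_right_mono) (auto simp: M_def)
        finally show ?case by (simp add: mult.assoc)
      qed
    qed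
    have 3: "ennreal ((1 / \<epsilon>) ^ j * \<delta> * p / young_inv A t) \<le> orlicz_norm A (abs_nabla j u)"
    proof (rule orlicz_norm_dilate_lower[OF A t \<epsilon> p _ \<delta> gm])
      show "0 < (1 / \<epsilon>) ^ j" using \<epsilon>(1) by simp
      show "AE x in lebesgue. (1 / \<epsilon>) ^ j * \<bar>g ((1 / \<epsilon>) *\<^sub>R x)\<bar> \<le> \<bar>abs_nabla j u x\<bar>"
        using AE_weak_partial_test_function[OF u, of "replicate j i"]
      proof eventually_elim
        case (elim x)
        then show ?case
          using abs_nabla_bounds(2)[of "replicate j i" j u x] \<epsilon>(1) by (simp add: pu g_def abs_mult)
      qed
    qed
    let ?x = "(1 / \<epsilon>) ^ k * M * q / young_inv B t" and ?y = "b [] * q / young_inv C t"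
    have i: "young_inv A t > 0" "young_inv B t > 0" "young_inv C t > 0"
      using young_inv_pos[OF A t] young_inv_pos[OF B t] young_inv_pos[OF C t] by auto
    have xy: "?x > 0" "?y > 0" using i M q \<epsilon>(1) b(1) by auto
    have "interp ?\<theta> (orlicz_norm B (abs_nabla k u)) (orlicz_norm C u) \<le> ennreal (?x powr ?\<theta> * ?y powr (1 - ?\<theta>)) * interp ?\<theta> 1 1"
      using 1 2 by (intro interp_mono xy \<theta>) auto
    also have "interp ?\<theta> 1 1 = 1" by (simp add: interp_def)
    finally have "interp ?\<theta> (orlicz_norm B (abs_nabla k u)) (orlicz_norm C u) \<le> ennreal (?x powr ?\<theta> * ?y powr (1 - ?\<theta>))"
      by (simp only: mult_1_right)
    from order_trans[OF order_trans[OF 3 ineq[OF wu]] mult_left_mono[OF this zero_le]]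
    have "ennreal ((1 / \<epsilon>) ^ j * \<delta> * p / young_inv A t) \<le> ennreal c2 * ennreal (?x powr ?\<theta> * ?y powr (1 - ?\<theta>))" .
    then have "(1 / \<epsilon>) ^ j * \<delta> * p / young_inv A t \<le> c2 * (?x powr ?\<theta> * ?y powr (1 - ?\<theta>))"
      using \<open>0 < c2\<close> by (simp add: ennreal_mult[symmetric] ennreal_le_iff)
    also have "?x powr ?\<theta> * ?y powr (1 - ?\<theta>) = (1 / \<epsilon>) ^ j * K / (young_inv B t powr ?\<theta> * young_inv C t powr (1 - ?\<theta>))"
    proof -
      \<comment> \<open>Here the scales cancel: as k times j/k is j, both sides carry the same power
        of \<epsilon>.\<close>
      have "((1 / \<epsilon>) ^ k) powr ?\<theta> = (1 / \<epsilon>) ^ j"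
        using \<epsilon>(1) jk by (simp add: powr_realpow[symmetric] powr_powr)
      then show ?thesis
        using i M q \<epsilon>(1) b(1)[of "[]"] by (simp add: K_def powr_mult powr_divide)
    qed
    finally show ?thesis
      using i \<epsilon>(1) \<delta> p by (simp add: field_simps)
  qed
  moreover have "c2 * K / (\<delta> * p) > 0" using \<open>0 < c2\<close> K \<delta> p by simp
  ultimately show ?thesis unfolding inverse_condition_def by blast
qed

theorem corollary1p4:
  fixes j k :: nat and A B C :: "real \<Rightarrow> real"
  assumes "1 \<le> j" and "j < k"
    and "young_function A" and "young_function B" and "young_function C"
  shows
    "(inverse_condition (real j / real k) A B C \<longrightarrow>
       (\<exists>c1>0. \<forall>u :: real ^ 'n \<Rightarrow> real. weakly_differentiable k u \<longrightarrow>
          orlicz_norm A (abs_nabla j u) \<le>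
            ennreal c1 * interp (real j / real k)
              (orlicz_norm_halfline B (max_rearr (abs_nabla k u)))
              (orlicz_norm_halfline C (max_rearr u))))
     \<and>
     (inverse_condition (real j / real k) A B C \<and>
      upper_boyd_index (orlicz_norm_halfline B) < 1 \<and>
      upper_boyd_index (orlicz_norm_halfline C) < 1 \<longrightarrow>
       (\<exists>c2>0. \<forall>u :: real ^ 'n \<Rightarrow> real. weakly_differentiable k u \<longrightarrow>
          orlicz_norm A (abs_nabla j u) \<le>
            ennreal c2 * interp (real j / real k)
              (orlicz_norm B (abs_nabla k u)) (orlicz_norm C u)))
     \<and>
     (\<not> inverse_condition (real j / real k) A B C \<longrightarrow>
       \<not> (\<exists>c2>0. \<forall>u :: real ^ 'n \<Rightarrow> real. weakly_differentiable k u \<longrightarrow>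
          orlicz_norm A (abs_nabla j u) \<le>
            ennreal c2 * interp (real j / real k)
              (orlicz_norm B (abs_nabla k u)) (orlicz_norm C u)))"
proof (intro conjI impI)
  assume "inverse_condition (real j / real k) A B C"
  with assms show "\<exists>c1>0. \<forall>u :: real ^ 'n \<Rightarrow> real. weakly_differentiable k u \<longrightarrow>
      orlicz_norm A (abs_nabla j u) \<le> ennreal c1 * interp (real j / real k)
        (orlicz_norm_halfline B (max_rearr (abs_nabla k u))) (orlicz_norm_halfline C (max_rearr u))"
    by (rule orlicz_norm_nabla_le_max_rearr)
next
  assume "inverse_condition (real j / real k) A B C \<and>
    upper_boyd_index (orlicz_norm_halfline B) < 1 \<and> upper_boyd_index (orlicz_norm_halfline C) < 1"
  then show "\<exists>c2>0. \<forall>u :: real ^ 'n \<Rightarrow> real. weakly_differentiable k u \<longrightarrow>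
      orlicz_norm A (abs_nabla j u) \<le> ennreal c2 * interp (real j / real k)
        (orlicz_norm B (abs_nabla k u)) (orlicz_norm C u)"
    using orlicz_norm_nabla_le[OF assms] by blast
next
  assume "\<not> inverse_condition (real j / real k) A B C"
  then show "\<not> (\<exists>c2>0. \<forall>u :: real ^ 'n \<Rightarrow> real. weakly_differentiable k u \<longrightarrow>
      orlicz_norm A (abs_nabla j u) \<le> ennreal c2 * interp (real j / real k)
        (orlicz_norm B (abs_nabla k u)) (orlicz_norm C u))"
    using inverse_condition_necessary[OF assms] by blast
qed

end
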